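(* If the Prime Ideal Theorem holds, then the adjunction $\mathbf\Omega:\mathbf{Pervin}\leftrightarrows\mathbf{Frith}^{op}:\mathbf{pt}$ (with $\mathbf\Omega\dashv\mathbf{pt}$) restricts and co-restricts to a duality (dual equivalence of categories) between the category $\mathbf{CPervin}$ of $T_0$ complete Pervin spaces and the category $\mathbf{CFrith}$ of complete Frith frames.
   Context: Prime Ideal Theorem: every proper ideal of a bounded distributive lattice extends to a prime ideal. (The Axiom of Choice is not assumed.) Pervin spaces: a Pervin space is a pair $(X,\mathcal S)$ with $X$ a set and $\mathcal S$ a bounded sublattice of $\mathcal P(X)$. A morphism $(X,\mathcal S)\to(Y,\mathcal T)$ is a function $f$ with $f^{-1}(T)\in\mathcal S$ for all $T\in\mathcal T$; the category is $\mathbf{Pervin}$. $\Omega_{\mathcal S}(X)$ is the topology generated by $\mathcal S$; $(X,\mathcal S)$ is $T_0$ if this topology is $T_0$. $f$ is dense if $f[X]$ is dense in $(Y,\Omega_{\mathcal T}(Y))$, and it is an extremal monomorphism if and only if it is injective and every $S\in\mathcal S$ is $f^{-1}(T)$ for some $T\in\mathcal T$. $(X,\mathcal S)$ is symmetric if $\mathcal S$ is a Boolean algebra. A symmetric Pervin space $(X,\mathcal B)$ is complete if every dense extremal monomorphism from it into a $T_0$ symmetric Pervin space is an isomorphism. A Pervin space $(X,\mathcal S)$ is complete if $(X,\overline{\mathcal S})$ is complete, where $\overline{\mathcal S}$ is the Boolean subalgebra of $\mathcal P(X)$ generated by $\mathcal S$. Frith frames: a Frith frame is a pair $(L,S)$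 with $L$ a frame and $S$ a bounded sublattice of $L$ such that every element of $L$ is a join of elements of $S$. A morphism $(L,S)\to(M,T)$ is a frame homomorphism $h:L\to M$ with $h[S]\subseteq T$; the category is $\mathbf{Frith}$. It is dense if $h(a)=0$ implies $a=0$, and it is an extremal epimorphism if and only if $h[S]=T$. $(L,S)$ is symmetric if $S$ is a Boolean algebra. A symmetric Frith frame $(L,B)$ is complete if every dense extremal epimorphism $(M,C)\to(L,B)$ with $(M,C)$ symmetric is an isomorphism. For a general $(L,S)$, let $\mathcal CL$ be the frame of congruences of $L$, $\nabla_a=\{(x,y)\mid a\vee x=a\vee y\}$, $\Delta_a=\{(x,y)\mid a\wedge x=a\wedge y\}$ (complements of each other in $\mathcal CL$), $\mathcal C_SL$ the subframe of $\mathcal CL$ generated by $\{\nabla_a\mid a\in L\}\cup\{\Delta_s\mid s\in S\}$, and $\overline S$ the sublattice of $\mathcal C_SL$ generated by $\{\nabla_s,\Delta_s\mid s\in S\}$. $(L,S)$ is complete if the symmetric Frith frame $(\mathcal C_SL,\overline S)$ is complete. $\mathbf{CPervin}$ and $\mathbf{CFrith}$ are full subcategories of $\mathbf{Pervin}$ and $\mathbf{Frith}$. The adjunction: $\mathbf\Omega(X,\mathcal S)=(\Omega_{\mathcal S}(X),\mathcal S)$ and $\mathbf\Omega(f)=f^{-1}$; $\mathbf{pt}(L,S)=(\mathrm{pt}(L),\widehat S)$, where $\mathrm{pt}(L)$ is the set of frame homomorphisms $p:L\to\mathbf 2$, $\widehat s=\{p\mid p(s)=1\}$, $\widehat S=\{\widehat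 s\mid s\in S\}$, and $\mathbf{pt}(h)(p)=p\circ h$. *)

theory Defs
  imports "HOL-Analysis.Analysis" "HOL-Algebra.Complete_Lattice"
begin

text \<open>
  Lattices and frames are carrier-based orders from \<open>HOL-Algebra\<close>. Morphisms are extensional
  functions, so that equality of morphisms is equality on the domain.
\<close>

section \<open>Prime Ideal Theorem\<close>

definition bounded_distributive_lattice :: "'a gorder \<Rightarrow> bool" where
  "bounded_distributive_lattice D \<longleftrightarrow> bounded_lattice D \<and>
     (\<forall>a\<in>carrier D. \<forall>b\<in>carrier D. \<forall>c\<in>carrier D.
        a \<sqinter>\<^bsub>D\<^esub> (b \<squnion>\<^bsub>D\<^esub> c) = (a \<sqinter>\<^bsub>D\<^esub> b) \<squnion>\<^bsub>D\<^esub> (a \<sqinter>\<^bsub>D\<^esub> c))"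

definition lattice_ideal :: "'a gorder \<Rightarrow> 'a set \<Rightarrow> bool" where
  "lattice_ideal D I \<longleftrightarrow> I \<subseteq> carrier D \<and> I \<noteq> {} \<and>
     (\<forall>a\<in>carrier D. \<forall>b\<in>I. a \<sqsubseteq>\<^bsub>D\<^esub> b \<longrightarrow> a \<in> I) \<and>
     (\<forall>a\<in>I. \<forall>b\<in>I. a \<squnion>\<^bsub>D\<^esub> b \<in> I)"

definition proper_lattice_ideal :: "'a gorder \<Rightarrow> 'a set \<Rightarrow> bool" where
  "proper_lattice_ideal D I \<longleftrightarrow> lattice_ideal D I \<and> I \<noteq> carrier D"

definition prime_lattice_ideal :: "'a gorder \<Rightarrow> 'a set \<Rightarrow> bool" where
  "prime_lattice_ideal D I \<longleftrightarrow> proper_lattice_ideal D I \<and>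
     (\<forall>a\<in>carrier D. \<forall>b\<in>carrier D. a \<sqinter>\<^bsub>D\<^esub> b \<in> I \<longrightarrow> a \<in> I \<or> b \<in> I)"

definition prime_ideal_theorem :: "'a itself \<Rightarrow> bool" where
  "prime_ideal_theorem _ \<longleftrightarrow>
     (\<forall>(D::'a gorder) I. bounded_distributive_lattice D \<and> proper_lattice_ideal D I \<longrightarrow>
        (\<exists>J. prime_lattice_ideal D J \<and> I \<subseteq> J))"

section \<open>Pervin spaces\<close>

type_synonym 'a pervin = "'a set \<times> 'a set set"

definition pervin_space :: "'a pervin \<Rightarrow> bool" where
  "pervin_space P \<longleftrightarrow> snd P \<subseteq> Pow (fst P) \<and> {} \<in> snd P \<and> fst P \<in> snd P \<and>
     (\<forall>A\<in>snd P. \<forall>B\<in>snd P. A \<inter> B \<in> snd P \<and> A \<union> B \<in> snd P)"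

definition symmetric_pervin_space :: "'a pervin \<Rightarrow> bool" where
  "symmetric_pervin_space P \<longleftrightarrow> pervin_space P \<and>
     (\<forall>A\<in>snd P. \<exists>B\<in>snd P. A \<inter> B = {} \<and> A \<union> B = fst P)"

definition pervin_topology :: "'a pervin \<Rightarrow> 'a topology" where
  "pervin_topology P = topology_generated_by (snd P)"

definition pervin_hom :: "'a pervin \<Rightarrow> 'b pervin \<Rightarrow> ('a \<Rightarrow> 'b) set" where
  "pervin_hom P Q = {f \<in> fst P \<rightarrow>\<^sub>E fst Q. \<forall>T\<in>snd Q. f -` T \<inter> fst P \<in> snd P}"

definition pervin_id :: "'a pervin \<Rightarrow> 'a \<Rightarrow> 'a" where
  "pervin_id P = (\<lambda>x\<in>fst P. x)"

definition pervin_comp :: "'a pervin \<Rightarrow> ('b \<Rightarrow> 'c) \<Rightarrow> ('a \<Rightarrow> 'b) \<Rightarrow> 'a \<Rightarrow> 'c" where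
  "pervin_comp P g f = compose (fst P) g f"

definition pervin_iso :: "'a pervin \<Rightarrow> 'b pervin \<Rightarrow> ('a \<Rightarrow> 'b) \<Rightarrow> bool" where
  "pervin_iso P Q f \<longleftrightarrow> f \<in> pervin_hom P Q \<and>
     (\<exists>g\<in>pervin_hom Q P. pervin_comp P g f = pervin_id P \<and> pervin_comp Q f g = pervin_id Q)"

definition pervin_dense :: "'a pervin \<Rightarrow> 'b pervin \<Rightarrow> ('a \<Rightarrow> 'b) \<Rightarrow> bool" where
  "pervin_dense P Q f \<longleftrightarrow> Abstract_Topology.closure_of (pervin_topology Q) (f ` fst P) = fst Q"

text \<open>
  Extremal monomorphisms of Pervin spaces, and extremal epimorphisms of Frith frames below, are
  defined by their concrete descriptions.
\<close>
definition pervin_extremal_mono :: "'a pervin \<Rightarrow> 'b pervin \<Rightarrow> ('a \<Rightarrow> 'b) \<Rightarrow> bool" where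
  "pervin_extremal_mono P Q f \<longleftrightarrow> f \<in> pervin_hom P Q \<and> inj_on f (fst P) \<and>
     (\<forall>S\<in>snd P. \<exists>T\<in>snd Q. S = f -` T \<inter> fst P)"

definition symmetric_pervin_complete_wrt :: "'b itself \<Rightarrow> 'a pervin \<Rightarrow> bool" where
  "symmetric_pervin_complete_wrt _ P \<longleftrightarrow>
     (\<forall>(Q::'b pervin) f. symmetric_pervin_space Q \<and> t0_space (pervin_topology Q) \<and>
        pervin_extremal_mono P Q f \<and> pervin_dense P Q f \<longrightarrow> pervin_iso P Q f)"

text \<open>
  A definition in HOL cannot quantify over all types of test spaces \<open>Q\<close>. The type \<open>'a set set\<close>
  is large enough: by theorem \<open>symmetric_pervin_complete_universal\<close> below, testing there is
  equivalent to testing on every type.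
\<close>
definition symmetric_pervin_complete :: "'a pervin \<Rightarrow> bool" where
  "symmetric_pervin_complete P \<longleftrightarrow> symmetric_pervin_complete_wrt TYPE('a set set) P"

definition generated_boolean_algebra :: "'a pervin \<Rightarrow> 'a set set" where
  "generated_boolean_algebra P =
     \<Inter>{B. symmetric_pervin_space (fst P, B) \<and> snd P \<subseteq> B}"

definition pervin_complete :: "'a pervin \<Rightarrow> bool" where
  "pervin_complete P \<longleftrightarrow> symmetric_pervin_complete (fst P, generated_boolean_algebra P)"

definition cpervin :: "'a pervin \<Rightarrow> bool" where
  "cpervin P \<longleftrightarrow> pervin_space P \<and> t0_space (pervin_topology P) \<and> pervin_complete P"

section \<open>Frith frames\<close>

locale frame = complete_lattice +
  assumes frame_distrib:
    "\<lbrakk>a \<in> carrier L; A \<subseteq> carrier L\<rbrakk> \<Longrightarrow> a \<sqinter> (\<Squnion>A) = \<Squnion>((\<lambda>x. a \<sqinter> x) ` A)"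

definition frame_hom :: "'a gorder \<Rightarrow> 'b gorder \<Rightarrow> ('a \<Rightarrow> 'b) set" where
  "frame_hom L M = {h \<in> carrier L \<rightarrow>\<^sub>E carrier M.
     h \<top>\<^bsub>L\<^esub> = \<top>\<^bsub>M\<^esub> \<and>
     (\<forall>x\<in>carrier L. \<forall>y\<in>carrier L. h (x \<sqinter>\<^bsub>L\<^esub> y) = h x \<sqinter>\<^bsub>M\<^esub> h y) \<and>
     (\<forall>A. A \<subseteq> carrier L \<longrightarrow> h (\<Squnion>\<^bsub>L\<^esub>A) = \<Squnion>\<^bsub>M\<^esub>(h ` A))}"

definition sublattice :: "'a gorder \<Rightarrow> 'a set \<Rightarrow> bool" where
  "sublattice L S \<longleftrightarrow> S \<subseteq> carrier L \<and>
     (\<forall>a\<in>S. \<forall>b\<in>S. a \<sqinter>\<^bsub>L\<^esub> b \<in> S \<and> a \<squnion>\<^bsub>L\<^esub> b \<in> S)"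

definition bounded_sublattice :: "'a gorder \<Rightarrow> 'a set \<Rightarrow> bool" where
  "bounded_sublattice L S \<longleftrightarrow> sublattice L S \<and> \<bottom>\<^bsub>L\<^esub> \<in> S \<and> \<top>\<^bsub>L\<^esub> \<in> S"

type_synonym 'a frith = "'a gorder \<times> 'a set"

definition frith_frame :: "'a frith \<Rightarrow> bool" where
  "frith_frame F \<longleftrightarrow> frame (fst F) \<and> bounded_sublattice (fst F) (snd F) \<and>
     (\<forall>a\<in>carrier (fst F). \<exists>A\<subseteq>snd F. a = \<Squnion>\<^bsub>fst F\<^esub>A)"

definition symmetric_frith_frame :: "'a frith \<Rightarrow> bool" where
  "symmetric_frith_frame F \<longleftrightarrow> frith_frame F \<and>
     (\<forall>a\<in>snd F. \<exists>b\<in>snd F. a \<sqinter>\<^bsub>fst F\<^esub> b = \<bottom>\<^bsub>fst F\<^esub> \<and> a \<squnion>\<^bsub>fst F\<^esub> b = \<top>\<^bsub>fst F\<^esub>)"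

definition frith_hom :: "'a frith \<Rightarrow> 'b frith \<Rightarrow> ('a \<Rightarrow> 'b) set" where
  "frith_hom F G = {h \<in> frame_hom (fst F) (fst G). h ` snd F \<subseteq> snd G}"

definition frith_id :: "'a frith \<Rightarrow> 'a \<Rightarrow> 'a" where
  "frith_id F = (\<lambda>a\<in>carrier (fst F). a)"

definition frith_comp :: "'a frith \<Rightarrow> ('b \<Rightarrow> 'c) \<Rightarrow> ('a \<Rightarrow> 'b) \<Rightarrow> 'a \<Rightarrow> 'c" where
  "frith_comp F k h = compose (carrier (fst F)) k h"

definition frith_iso :: "'a frith \<Rightarrow> 'b frith \<Rightarrow> ('a \<Rightarrow> 'b) \<Rightarrow> bool" where
  "frith_iso F G h \<longleftrightarrow> h \<in> frith_hom F G \<and>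
     (\<exists>k\<in>frith_hom G F. frith_comp F k h = frith_id F \<and> frith_comp G h k = frith_id G)"

definition frith_dense :: "'a frith \<Rightarrow> 'b frith \<Rightarrow> ('a \<Rightarrow> 'b) \<Rightarrow> bool" where
  "frith_dense F G h \<longleftrightarrow>
     (\<forall>a\<in>carrier (fst F). h a = \<bottom>\<^bsub>fst G\<^esub> \<longrightarrow> a = \<bottom>\<^bsub>fst F\<^esub>)"

definition frith_extremal_epi :: "'a frith \<Rightarrow> 'b frith \<Rightarrow> ('a \<Rightarrow> 'b) \<Rightarrow> bool" where
  "frith_extremal_epi F G h \<longleftrightarrow> h \<in> frith_hom F G \<and> h ` snd F = snd G"

definition symmetric_frith_complete_wrt :: "'b itself \<Rightarrow> 'a frith \<Rightarrow> bool" where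
  "symmetric_frith_complete_wrt _ F \<longleftrightarrow>
     (\<forall>(G::'b frith) h. symmetric_frith_frame G \<and>
        frith_extremal_epi G F h \<and> frith_dense G F h \<longrightarrow> frith_iso G F h)"

text \<open>
  As for Pervin spaces, the type \<open>'a set\<close> of test frames is large enough: see theorem
  \<open>symmetric_frith_complete_universal\<close> below.
\<close>
definition symmetric_frith_complete :: "'a frith \<Rightarrow> bool" where
  "symmetric_frith_complete F \<longleftrightarrow> symmetric_frith_complete_wrt TYPE('a set) F"

definition frame_congruence :: "'a gorder \<Rightarrow> ('a \<times> 'a) set \<Rightarrow> bool" where
  "frame_congruence L r \<longleftrightarrow> equiv (carrier L) r \<and>
     (\<forall>(x, y)\<in>r. \<forall>(x', y')\<in>r. (x \<sqinter>\<^bsub>L\<^esub> x', y \<sqinter>\<^bsub>L\<^esub> y') \<in> r) \<and>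
     (\<forall>R\<subseteq>r. (\<Squnion>\<^bsub>L\<^esub>(fst ` R), \<Squnion>\<^bsub>L\<^esub>(snd ` R)) \<in> r)"

definition congruence_frame :: "'a gorder \<Rightarrow> ('a \<times> 'a) set gorder" where
  "congruence_frame L = \<lparr>carrier = {r. frame_congruence L r}, eq = (=), le = (\<subseteq>)\<rparr>"

definition nabla :: "'a gorder \<Rightarrow> 'a \<Rightarrow> ('a \<times> 'a) set" where
  "nabla L a = {(x, y). x \<in> carrier L \<and> y \<in> carrier L \<and> a \<squnion>\<^bsub>L\<^esub> x = a \<squnion>\<^bsub>L\<^esub> y}"

definition delta :: "'a gorder \<Rightarrow> 'a \<Rightarrow> ('a \<times> 'a) set" where
  "delta L a = {(x, y). x \<in> carrier L \<and> y \<in> carrier L \<and> a \<sqinter>\<^bsub>L\<^esub> x = a \<sqinter>\<^bsub>L\<^esub> y}"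

definition subframe :: "'a gorder \<Rightarrow> 'a set \<Rightarrow> bool" where
  "subframe L K \<longleftrightarrow> K \<subseteq> carrier L \<and> \<top>\<^bsub>L\<^esub> \<in> K \<and>
     (\<forall>a\<in>K. \<forall>b\<in>K. a \<sqinter>\<^bsub>L\<^esub> b \<in> K) \<and> (\<forall>A\<subseteq>K. \<Squnion>\<^bsub>L\<^esub>A \<in> K)"

definition generated_subframe :: "'a gorder \<Rightarrow> 'a set \<Rightarrow> 'a gorder" where
  "generated_subframe L G = L\<lparr>carrier := \<Inter>{K. subframe L K \<and> G \<subseteq> K}\<rparr>"

definition generated_sublattice :: "'a gorder \<Rightarrow> 'a set \<Rightarrow> 'a set" where
  "generated_sublattice L G = \<Inter>{K. sublattice L K \<and> G \<subseteq> K}"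

definition partial_congruence_frame :: "'a frith \<Rightarrow> ('a \<times> 'a) set gorder" where
  "partial_congruence_frame F = generated_subframe (congruence_frame (fst F))
     (nabla (fst F) ` carrier (fst F) \<union> delta (fst F) ` snd F)"

definition frith_symmetrization :: "'a frith \<Rightarrow> ('a \<times> 'a) set frith" where
  "frith_symmetrization F = (partial_congruence_frame F,
     generated_sublattice (partial_congruence_frame F)
       (nabla (fst F) ` snd F \<union> delta (fst F) ` snd F))"

definition frith_complete :: "'a frith \<Rightarrow> bool" where
  "frith_complete F \<longleftrightarrow> symmetric_frith_complete (frith_symmetrization F)"

definition cfrith :: "'a frith \<Rightarrow> bool" where
  "cfrith F \<longleftrightarrow> frith_frame F \<and> frith_complete F"

section \<open>The adjunction between Pervin spaces and Frith frames\<close>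

definition Omega :: "'a pervin \<Rightarrow> 'a set frith" where
  "Omega P = (\<lparr>carrier = {U. openin (pervin_topology P) U}, eq = (=), le = (\<subseteq>)\<rparr>, snd P)"

text \<open>For \<open>f : P \<rightarrow> Q\<close>, the morphism \<open>Omega_map P Q f\<close> goes from \<open>Omega Q\<close> to \<open>Omega P\<close>.\<close>
definition Omega_map :: "'a pervin \<Rightarrow> 'b pervin \<Rightarrow> ('a \<Rightarrow> 'b) \<Rightarrow> 'b set \<Rightarrow> 'a set" where
  "Omega_map P Q f = (\<lambda>V\<in>carrier (fst (Omega Q)). f -` V \<inter> fst P)"

definition two_frame :: "bool gorder" where
  "two_frame = \<lparr>carrier = UNIV, eq = (=), le = (\<le>)\<rparr>"

definition points :: "'a gorder \<Rightarrow> ('a \<Rightarrow> bool) set" where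
  "points L = frame_hom L two_frame"

definition hat :: "'a gorder \<Rightarrow> 'a \<Rightarrow> ('a \<Rightarrow> bool) set" where
  "hat L a = {p \<in> points L. p a = True}"

definition pt :: "'a frith \<Rightarrow> ('a \<Rightarrow> bool) pervin" where
  "pt F = (points (fst F), hat (fst F) ` snd F)"

text \<open>For \<open>h : F \<rightarrow> G\<close>, the morphism \<open>pt_map F G h\<close> goes from \<open>pt G\<close> to \<open>pt F\<close>.\<close>
definition pt_map :: "'a frith \<Rightarrow> 'b frith \<Rightarrow> ('a \<Rightarrow> 'b) \<Rightarrow> ('b \<Rightarrow> bool) \<Rightarrow> 'a \<Rightarrow> bool" where
  "pt_map F G h = (\<lambda>p\<in>fst (pt G). compose (carrier (fst F)) p h)"

definition adj_unit :: "'a pervin \<Rightarrow> 'a \<Rightarrow> 'a set \<Rightarrow> bool" where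
  "adj_unit P = (\<lambda>x\<in>fst P. \<lambda>U\<in>carrier (fst (Omega P)). x \<in> U)"

text \<open>
  The counit at \<open>F\<close> is a morphism of the opposite category; as a morphism of Frith
  frames it goes from \<open>F\<close> to \<open>Omega (pt F)\<close>.
\<close>
definition adj_counit :: "'a frith \<Rightarrow> 'a \<Rightarrow> ('a \<Rightarrow> bool) set" where
  "adj_counit F = (\<lambda>a\<in>carrier (fst F). hat (fst F) a)"

section \<open>Completeness does not depend on the type of the test objects\<close>

lemma pervin_base:
  assumes "pervin_space P" "openin (pervin_topology P) U" "x \<in> U"
  shows "\<exists>T\<in>snd P. x \<in> T \<and> T \<subseteq> U"
proof -
  have "generate_topology_on (snd P) U"
    using assms(2) by (simp add: pervin_topology_def openin_topology_generated_by_iff)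
  then have "\<forall>x\<in>U. \<exists>T\<in>snd P. x \<in> T \<and> T \<subseteq> U"
  proof induction
    case (Int a b)
    show ?case
    proof
      fix x assume "x \<in> a \<inter> b"
      then obtain T T' where "T \<in> snd P" "x \<in> T" "T \<subseteq> a" "T' \<in> snd P" "x \<in> T'" "T' \<subseteq> b"
        using Int.IH by blast
      then show "\<exists>T\<in>snd P. x \<in> T \<and> T \<subseteq> a \<inter> b"
        using assms(1) by (intro bexI[of _ "T \<inter> T'"]) (auto simp: pervin_space_def)
    qed
  next
    case (UN K)
    show ?case
    proof
      fix x assume "x \<in> \<Union>K"
      then obtain k where k: "k \<in> K" "x \<in> k" by blast
      then obtain T where "T \<in> snd P" "x \<in> T" "T \<subseteq> k" using UN.IH by blast
      then show "\<exists>T\<in>snd P. x \<in> T \<and> T \<subseteq> \<Union>K" using k(1) by blast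
    qed
  next
    case (Basis s)
    then show ?case by blast
  qed simp
  then show ?thesis using assms(3) by blast
qed

lemma topspace_pervin:
  "pervin_space P \<Longrightarrow> topspace (pervin_topology P) = fst P"
  by (auto simp: pervin_space_def pervin_topology_def)

lemma openin_pervin: "T \<in> snd P \<Longrightarrow> openin (pervin_topology P) T"
  by (simp add: pervin_topology_def topology_generated_by_Basis)

lemma t0_pervin_iff:
  assumes "pervin_space P"
  shows "t0_space (pervin_topology P) \<longleftrightarrow>
    (\<forall>x\<in>fst P. \<forall>y\<in>fst P. (\<forall>T\<in>snd P. x \<in> T \<longleftrightarrow> y \<in> T) \<longrightarrow> x = y)"
proof
  assume t0: "t0_space (pervin_topology P)"
  show "\<forall>x\<in>fst P. \<forall>y\<in>fst P. (\<forall>T\<in>snd P. x \<in> T \<longleftrightarrow> y \<in> T) \<longrightarrow> x = y"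
  proof (intro ballI impI, rule ccontr)
    fix x y assume xy: "x \<in> fst P" "y \<in> fst P" "\<forall>T\<in>snd P. x \<in> T \<longleftrightarrow> y \<in> T" "x \<noteq> y"
    have "\<exists>U. openin (pervin_topology P) U \<and> (x \<notin> U \<longleftrightarrow> y \<in> U)"
      using t0 xy(1,2,4) unfolding t0_space_def topspace_pervin[OF assms] by simp
    then obtain U where U: "openin (pervin_topology P) U" "x \<notin> U \<longleftrightarrow> y \<in> U" by (elim exE conjE)
    have "x \<in> U \<longleftrightarrow> y \<in> U"
      using pervin_base[OF assms U(1), of x] pervin_base[OF assms U(1), of y] xy(3) by auto
    then show False using U(2) by simp
  qed
next
  assume "\<forall>x\<in>fst P. \<forall>y\<in>fst P. (\<forall>T\<in>snd P. x \<in> T \<longleftrightarrow> y \<in> T) \<longrightarrow> x = y"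
  then have "\<exists>T. openin (pervin_topology P) T \<and> (x \<notin> T \<longleftrightarrow> y \<in> T)"
    if "x \<in> fst P" "y \<in> fst P" "x \<noteq> y" for x y
    using that openin_pervin[of _ P] by metis
  then show "t0_space (pervin_topology P)"
    unfolding t0_space_def topspace_pervin[OF assms] by blast
qed

lemma pervin_dense_iff:
  assumes "pervin_space Q"
  shows "pervin_dense P Q f \<longleftrightarrow> (\<forall>T\<in>snd Q. T \<noteq> {} \<longrightarrow> T \<inter> f ` fst P \<noteq> {})"
proof
  assume d: "pervin_dense P Q f"
  show "\<forall>T\<in>snd Q. T \<noteq> {} \<longrightarrow> T \<inter> f ` fst P \<noteq> {}"
  proof (intro ballI impI)
    fix T assume T: "T \<in> snd Q" "T \<noteq> {}"
    then obtain y where y: "y \<in> T" by blast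
    then have "y \<in> fst Q" using T assms by (auto simp: pervin_space_def)
    then have "y \<in> Abstract_Topology.closure_of (pervin_topology Q) (f ` fst P)" using d by (simp add: pervin_dense_def)
    then show "T \<inter> f ` fst P \<noteq> {}"
      using y openin_pervin[OF T(1)] unfolding in_closure_of by blast
  qed
next
  assume d: "\<forall>T\<in>snd Q. T \<noteq> {} \<longrightarrow> T \<inter> f ` fst P \<noteq> {}"
  have "y \<in> Abstract_Topology.closure_of (pervin_topology Q) (f ` fst P)" if "y \<in> fst Q" for y
    unfolding in_closure_of topspace_pervin[OF assms]
  proof (intro conjI allI impI, rule that, elim conjE)
    fix U assume "y \<in> U" "openin (pervin_topology Q) U"
    then obtain T where T: "T \<in> snd Q" "y \<in> T" "T \<subseteq> U" using pervin_base[OF assms] by metis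
    then have "T \<inter> f ` fst P \<noteq> {}" using d by auto
    then show "\<exists>z. z \<in> f ` fst P \<and> z \<in> U" using T(3) by auto
  qed
  moreover have "Abstract_Topology.closure_of (pervin_topology Q) (f ` fst P) \<subseteq> fst Q"
    using closure_of_subset_topspace[of "pervin_topology Q"] by (simp add: topspace_pervin[OF assms])
  ultimately show "pervin_dense P Q f" unfolding pervin_dense_def by (intro equalityI subsetI) (erule subsetD)
qed

lemma surj_extremal_mono_iso:
  assumes "pervin_space Q" "pervin_extremal_mono P Q f" "f ` fst P = fst Q"
  shows "pervin_iso P Q f"
proof -
  define g where "g = (\<lambda>y\<in>fst Q. the_inv_into (fst P) f y)"
  have f: "f \<in> pervin_hom P Q" "inj_on f (fst P)"
    "\<And>S. S \<in> snd P \<Longrightarrow> \<exists>T\<in>snd Q. S = f -` T \<inter> fst P"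
    using assms(2) by (auto simp: pervin_extremal_mono_def)
  have gf: "g (f x) = x" if "x \<in> fst P" for x
    using that f(2) assms(3) by (auto simp: g_def the_inv_into_f_f)
  have fg: "g y \<in> fst P \<and> f (g y) = y" if "y \<in> fst Q" for y
    using that gf unfolding assms(3)[symmetric] by (elim imageE) simp
  have "g -` S \<inter> fst Q \<in> snd Q" if "S \<in> snd P" for S
  proof -
    obtain T where T: "T \<in> snd Q" "S = f -` T \<inter> fst P" using f(3) \<open>S \<in> snd P\<close> by blast
    have "T \<subseteq> fst Q" using T assms(1) by (auto simp: pervin_space_def)
    then have "g -` S \<inter> fst Q = T" using T(2) fg by auto
    then show ?thesis using T by simp
  qed
  then have "g \<in> pervin_hom Q P"
    using fg by (auto simp: pervin_hom_def g_def)
  moreover have "pervin_comp P g f = pervin_id P" "pervin_comp Q f g = pervin_id Q"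
    using gf fg by (auto simp: pervin_comp_def pervin_id_def compose_def fun_eq_iff)
  ultimately show ?thesis using f(1) by (auto simp: pervin_iso_def)
qed

theorem symmetric_pervin_complete_universal:
  fixes P :: "'a pervin"
  assumes "symmetric_pervin_complete P"
  shows "symmetric_pervin_complete_wrt TYPE('b) P"
  unfolding symmetric_pervin_complete_wrt_def
proof (intro allI impI, elim conjE)
  fix Q :: "'b pervin" and f
  assume sym: "symmetric_pervin_space Q" and t0: "t0_space (pervin_topology Q)"
    and em: "pervin_extremal_mono P Q f" and d: "pervin_dense P Q f"
  have Q: "pervin_space Q" using sym by (simp add: symmetric_pervin_space_def)
  have fh: "f \<in> fst P \<rightarrow>\<^sub>E fst Q" "\<And>T. T \<in> snd Q \<Longrightarrow> f -` T \<inter> fst P \<in> snd P"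
    "inj_on f (fst P)" "\<And>S. S \<in> snd P \<Longrightarrow> \<exists>T\<in>snd Q. S = f -` T \<inter> fst P"
    using em by (auto simp: pervin_extremal_mono_def pervin_hom_def)
  have dT: "f -` T \<inter> fst P \<noteq> {}" if "T \<in> snd Q" "T \<noteq> {}" for T
    using d that unfolding pervin_dense_iff[OF Q] by blast
  have sub: "T \<subseteq> fst Q" if "T \<in> snd Q" for T
    using Q that by (auto simp: pervin_space_def)
  have preim_mono: "T \<subseteq> T'"
    if TT: "T \<in> snd Q" "T' \<in> snd Q" and eq: "f -` T \<inter> fst P \<subseteq> f -` T' \<inter> fst P" for T T'
  proof -
    obtain B where B: "B \<in> snd Q" "T' \<inter> B = {}" "T' \<union> B = fst Q"
      using sym TT(2) unfolding symmetric_pervin_space_def by blast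
    have "T \<inter> B \<in> snd Q" using Q TT B by (auto simp: pervin_space_def)
    moreover have "f -` (T \<inter> B) \<inter> fst P = {}" using eq B(2) by blast
    ultimately have "T \<inter> B = {}" using dT by blast
    then show ?thesis using B sub[OF TT(1)] by blast
  qed
  define c where "c y = {f -` T \<inter> fst P | T. T \<in> snd Q \<and> y \<in> T}" for y
  have c_mem: "f -` T \<inter> fst P \<in> c y \<longleftrightarrow> y \<in> T" if "T \<in> snd Q" for T y
    using that preim_mono unfolding c_def by blast
  have inj: "inj_on c (fst Q)"
  proof (rule inj_onI)
    fix x y assume "x \<in> fst Q" "y \<in> fst Q" "c x = c y"
    then show "x = y" using t0 c_mem unfolding t0_pervin_iff[OF Q] by blast
  qed
  define Q' where "Q' = (c ` fst Q, (\<lambda>T. c ` T) ` snd Q)"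
  have Q'_simps: "fst Q' = c ` fst Q" "snd Q' = (\<lambda>T. c ` T) ` snd Q" by (simp_all add: Q'_def)
  have cI: "c ` A \<inter> c ` B = c ` (A \<inter> B)" "c ` A \<union> c ` B = c ` (A \<union> B)"
    if "A \<in> snd Q" "B \<in> snd Q" for A B
    using inj_on_image_Int[OF inj sub[OF that(1)] sub[OF that(2)]] by (simp_all only: image_Un)
  have Q': "pervin_space Q'"
    unfolding pervin_space_def
  proof (intro conjI ballI)
    show "snd Q' \<subseteq> Pow (fst Q')" using sub by (auto simp: Q'_simps)
    have "{} \<in> snd Q" "fst Q \<in> snd Q" using Q by (simp_all add: pervin_space_def)
    then show "{} \<in> snd Q'" "fst Q' \<in> snd Q'" unfolding Q'_simps by (metis image_empty imageI, simp)
    fix A B assume "A \<in> snd Q'" "B \<in> snd Q'"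
    then obtain T U where TU: "T \<in> snd Q" "U \<in> snd Q" "A = c ` T" "B = c ` U"
      by (auto simp: Q'_simps)
    have "T \<inter> U \<in> snd Q" "T \<union> U \<in> snd Q" using Q TU(1,2) by (simp_all add: pervin_space_def)
    then show "A \<inter> B \<in> snd Q'" "A \<union> B \<in> snd Q'"
      unfolding TU(3,4) cI[OF TU(1,2)] Q'_simps by simp_all
  qed
  have "\<exists>B\<in>snd Q'. A \<inter> B = {} \<and> A \<union> B = fst Q'" if "A \<in> snd Q'" for A
  proof -
    obtain T where T: "T \<in> snd Q" "A = c ` T" using \<open>A \<in> snd Q'\<close> by (auto simp: Q'_simps)
    obtain B where B: "B \<in> snd Q" "T \<inter> B = {}" "T \<union> B = fst Q"
      using sym T(1) unfolding symmetric_pervin_space_def by blast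
    have "A \<inter> c ` B = {}" "A \<union> c ` B = fst Q'"
      unfolding T(2) cI[OF T(1) B(1)] B(2,3) Q'_simps by simp_all
    moreover have "c ` B \<in> snd Q'" using B(1) by (simp add: Q'_simps)
    ultimately show ?thesis by blast
  qed
  then have sym': "symmetric_pervin_space Q'" using Q' by (simp add: symmetric_pervin_space_def)
  have c_in: "c y \<in> c ` T \<longleftrightarrow> y \<in> T" if "T \<in> snd Q" "y \<in> fst Q" for T y
    using inj_on_image_mem_iff[OF inj that(2) sub[OF that(1)]] .
  have t0': "t0_space (pervin_topology Q')"
    using t0 unfolding t0_pervin_iff[OF Q] t0_pervin_iff[OF Q'] Q'_simps by (auto simp: c_in)
  define f' where "f' = (\<lambda>x\<in>fst P. c (f x))"
  have fm: "f x \<in> fst Q" if "x \<in> fst P" for x using fh(1) that by (rule PiE_mem)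
  have pre: "f' -` (c ` T) \<inter> fst P = f -` T \<inter> fst P" if "T \<in> snd Q" for T
  proof -
    have "f' x \<in> c ` T \<longleftrightarrow> f x \<in> T" if "x \<in> fst P" for x
      using c_in[OF \<open>T \<in> snd Q\<close> fm[OF that]] that by (simp add: f'_def)
    then show ?thesis by auto
  qed
  have hom': "f' \<in> pervin_hom P Q'"
  proof -
    have "f' \<in> fst P \<rightarrow>\<^sub>E fst Q'" using fm by (simp add: f'_def Q'_simps)
    moreover have "f' -` U \<inter> fst P \<in> snd P" if "U \<in> snd Q'" for U
    proof -
      obtain T where T: "T \<in> snd Q" "U = c ` T" using \<open>U \<in> snd Q'\<close> by (auto simp: Q'_simps)
      then show ?thesis using pre[OF T(1)] fh(2)[OF T(1)] by simp
    qed
    ultimately show ?thesis by (simp add: pervin_hom_def)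
  qed
  have inj': "inj_on f' (fst P)"
  proof (rule inj_onI)
    fix x y assume xy: "x \<in> fst P" "y \<in> fst P" "f' x = f' y"
    then have "f x = f y" using inj_onD[OF inj _ fm[OF xy(1)] fm[OF xy(2)]] by (simp add: f'_def)
    then show "x = y" using inj_onD[OF fh(3) _ xy(1,2)] by simp
  qed
  have em': "pervin_extremal_mono P Q' f'"
    unfolding pervin_extremal_mono_def
  proof (intro conjI ballI)
    fix S assume "S \<in> snd P"
    then obtain T where T: "T \<in> snd Q" "S = f -` T \<inter> fst P" using fh(4) by blast
    show "\<exists>T\<in>snd Q'. S = f' -` T \<inter> fst P"
      by (rule bexI[of _ "c ` T"]) (use T pre[OF T(1)] in \<open>simp_all add: Q'_simps\<close>)
  qed (use hom' inj' in auto)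
  have d': "pervin_dense P Q' f'"
    unfolding pervin_dense_iff[OF Q']
  proof (intro ballI impI)
    fix U assume U: "U \<in> snd Q'" "U \<noteq> {}"
    then obtain T where T: "T \<in> snd Q" "U = c ` T" "T \<noteq> {}" by (auto simp: Q'_simps)
    show "U \<inter> f' ` fst P \<noteq> {}" using dT[OF T(1,3)] pre[OF T(1)] T(2) by blast
  qed
  have "pervin_iso P Q' f'"
    using assms sym' t0' em' d'
    unfolding symmetric_pervin_complete_def symmetric_pervin_complete_wrt_def by blast
  then obtain g where g: "g \<in> pervin_hom Q' P" "pervin_comp Q' f' g = pervin_id Q'"
    by (auto simp: pervin_iso_def)
  have "f ` fst P = fst Q"
  proof
    show "fst Q \<subseteq> f ` fst P"
    proof
      fix y assume y: "y \<in> fst Q"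
      then have cy: "c y \<in> fst Q'" by (simp add: Q'_simps)
      then have gy: "g (c y) \<in> fst P" using g(1) by (auto simp: pervin_hom_def dest: PiE_mem)
      have "f' (g (c y)) = c y"
        using fun_cong[OF g(2), of "c y"] cy by (simp add: pervin_comp_def pervin_id_def compose_def)
      then have "c (f (g (c y))) = c y" using gy by (simp add: f'_def)
      then have "f (g (c y)) = y" using inj_onD[OF inj _ fm[OF gy] y] by simp
      then show "y \<in> f ` fst P" using gy by (metis imageI)
    qed
    show "f ` fst P \<subseteq> fst Q" using fm by (rule image_subsetI)
  qed
  then show "pervin_iso P Q f" by (rule surj_extremal_mono_iso[OF Q em])
qed

lemma bij_frith_iso:
  fixes F :: "'a frith" and G :: "'b frith"
  assumes F: "frame (fst F)" "snd F \<subseteq> carrier (fst F)" and G: "frame (fst G)"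
    and h: "h \<in> frith_hom F G" "bij_betw h (carrier (fst F)) (carrier (fst G))" "h ` snd F = snd G"
  shows "frith_iso F G h"
proof -
  interpret F: frame "fst F" by (rule F)
  interpret G: frame "fst G" by (rule G)
  define k where "k = (\<lambda>b\<in>carrier (fst G). the_inv_into (carrier (fst F)) h b)"
  have kh: "k (h a) = a" if "a \<in> carrier (fst F)" for a
    using that h(2) by (auto simp: k_def bij_betw_def the_inv_into_f_f)
  have hk: "k b \<in> carrier (fst F) \<and> h (k b) = b" if "b \<in> carrier (fst G)" for b
  proof -
    have "b \<in> h ` carrier (fst F)" using that h(2) by (simp add: bij_betw_def)
    then show ?thesis using kh by (elim imageE) simp
  qed
  have hom: "h \<top>\<^bsub>fst F\<^esub> = \<top>\<^bsub>fst G\<^esub>"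
    "\<And>x y. x \<in> carrier (fst F) \<Longrightarrow> y \<in> carrier (fst F) \<Longrightarrow> h (x \<sqinter>\<^bsub>fst F\<^esub> y) = h x \<sqinter>\<^bsub>fst G\<^esub> h y"
    "\<And>A. A \<subseteq> carrier (fst F) \<Longrightarrow> h (\<Squnion>\<^bsub>fst F\<^esub>A) = \<Squnion>\<^bsub>fst G\<^esub>(h ` A)"
    using h(1) by (auto simp: frith_hom_def frame_hom_def)
  have ktop: "k \<top>\<^bsub>fst G\<^esub> = \<top>\<^bsub>fst F\<^esub>" using kh[OF F.top_closed] hom(1) by simp
  have kmeet: "k (x \<sqinter>\<^bsub>fst G\<^esub> y) = k x \<sqinter>\<^bsub>fst F\<^esub> k y"
    if "x \<in> carrier (fst G)" "y \<in> carrier (fst G)" for x y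
    using kh[of "k x \<sqinter>\<^bsub>fst F\<^esub> k y"] hk that hom(2)[of "k x" "k y"] F.meet_closed by simp
  have ksup: "k (\<Squnion>\<^bsub>fst G\<^esub>A) = \<Squnion>\<^bsub>fst F\<^esub>(k ` A)" if A: "A \<subseteq> carrier (fst G)" for A
  proof -
    have kA: "k ` A \<subseteq> carrier (fst F)" using hk A by auto
    have "(\<lambda>b. h (k b)) ` A = (\<lambda>b. b) ` A" by (rule image_cong) (use hk A in auto)
    then have "h ` k ` A = A" by (simp add: image_image)
    then have "h (\<Squnion>\<^bsub>fst F\<^esub>(k ` A)) = \<Squnion>\<^bsub>fst G\<^esub>A" using hom(3)[OF kA] by simp
    then show ?thesis using kh[OF F.sup_closed[OF kA]] by simp
  qed
  have "k ` snd G \<subseteq> snd F"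
  proof
    fix u assume "u \<in> k ` snd G"
    then obtain a where "a \<in> snd F" "u = k (h a)" unfolding h(3)[symmetric] by blast
    then show "u \<in> snd F" using kh[of a] F(2) by auto
  qed
  then have "k \<in> frith_hom G F"
    using ktop kmeet ksup hk by (auto simp: frith_hom_def frame_hom_def k_def)
  moreover have "frith_comp F k h = frith_id F" "frith_comp G h k = frith_id G"
    using kh hk by (auto simp: frith_comp_def frith_id_def compose_def fun_eq_iff)
  ultimately show ?thesis using h(1) by (auto simp: frith_iso_def)
qed

text \<open>Transport of a frame along an order embedding into a powerset.\<close>

locale frame_copy = M: frame M for M :: "'a gorder" +
  fixes c :: "'a \<Rightarrow> 'b set"
  assumes emb: "\<And>x y. x \<in> carrier M \<Longrightarrow> y \<in> carrier M \<Longrightarrow> c x \<subseteq> c y \<longleftrightarrow> x \<sqsubseteq>\<^bsub>M\<^esub> y"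
begin

definition N :: "'b set gorder" where
  "N = \<lparr>carrier = c ` carrier M, eq = (=), le = (\<subseteq>)\<rparr>"

lemma N_simps [simp]: "carrier N = c ` carrier M" "le N = (\<subseteq>)" "eq N = (=)"
  by (simp_all add: N_def)

lemma inj: "inj_on c (carrier M)"
  by (rule inj_onI) (metis M.le_antisym emb order_refl)

lemma N_po: "partial_order N"
  by unfold_locales auto

lemma lub:
  assumes A: "A \<subseteq> carrier M"
  shows "is_lub N (c (\<Squnion>\<^bsub>M\<^esub>A)) (c ` A)"
proof (rule least_UpperI)
  fix x assume "x \<in> c ` A"
  then obtain a where "a \<in> A" "x = c a" by blast
  then show "x \<sqsubseteq>\<^bsub>N\<^esub> c (\<Squnion>\<^bsub>M\<^esub>A)"
    using A M.sup_upper[OF A] M.sup_closed[OF A] emb[of a "\<Squnion>\<^bsub>M\<^esub>A"] by auto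
next
  fix y assume y: "y \<in> Upper N (c ` A)"
  then have "y \<in> carrier N" by (simp add: Upper_def)
  then obtain b where b: "b \<in> carrier M" "y = c b" by auto
  have "a \<sqsubseteq>\<^bsub>M\<^esub> b" if "a \<in> A" for a
  proof -
    have "c a \<sqsubseteq>\<^bsub>N\<^esub> y" using y that A unfolding Upper_def by auto
    then show ?thesis using emb[of a b] that A b by auto
  qed
  then have "\<Squnion>\<^bsub>M\<^esub>A \<sqsubseteq>\<^bsub>M\<^esub> b" using M.sup_least[OF A b(1)] by blast
  then show "c (\<Squnion>\<^bsub>M\<^esub>A) \<sqsubseteq>\<^bsub>N\<^esub> y"
    using emb[OF M.sup_closed[OF A] b(1)] b(2) by simp
qed (use A in auto)

lemma glb:
  assumes A: "A \<subseteq> carrier M"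
  shows "is_glb N (c (\<Sqinter>\<^bsub>M\<^esub>A)) (c ` A)"
proof (rule greatest_LowerI)
  fix x assume "x \<in> c ` A"
  then obtain a where "a \<in> A" "x = c a" by blast
  then show "c (\<Sqinter>\<^bsub>M\<^esub>A) \<sqsubseteq>\<^bsub>N\<^esub> x"
    using A M.inf_lower[OF A] M.inf_closed[OF A] emb[of "\<Sqinter>\<^bsub>M\<^esub>A" a] by auto
next
  fix y assume y: "y \<in> Lower N (c ` A)"
  then have "y \<in> carrier N" by (simp add: Lower_def)
  then obtain b where b: "b \<in> carrier M" "y = c b" by auto
  have "b \<sqsubseteq>\<^bsub>M\<^esub> a" if "a \<in> A" for a
  proof -
    have "y \<sqsubseteq>\<^bsub>N\<^esub> c a" using y that A unfolding Lower_def by auto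
    then show ?thesis using emb[of b a] that A b by auto
  qed
  then have "b \<sqsubseteq>\<^bsub>M\<^esub> \<Sqinter>\<^bsub>M\<^esub>A" using M.inf_greatest[OF A b(1)] by blast
  then show "y \<sqsubseteq>\<^bsub>N\<^esub> c (\<Sqinter>\<^bsub>M\<^esub>A)"
    using emb[OF b(1) M.inf_closed[OF A]] b(2) by simp
qed (use A in auto)

lemma ex_preimage: "B \<subseteq> carrier N \<Longrightarrow> \<exists>A\<subseteq>carrier M. B = c ` A"
  by (simp add: subset_image_iff)

sublocale N: complete_lattice N
proof -
  interpret partial_order N by (rule N_po)
  show "complete_lattice N"
  proof
    fix B assume "B \<subseteq> carrier N"
    then obtain A where A: "A \<subseteq> carrier M" "B = c ` A" using ex_preimage by metis
    show "\<exists>s. is_lub N s B" unfolding A(2) using lub[OF A(1)] by (rule exI)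
    show "\<exists>s. is_glb N s B" unfolding A(2) using glb[OF A(1)] by (rule exI)
  qed
qed

lemma sup_N: "A \<subseteq> carrier M \<Longrightarrow> \<Squnion>\<^bsub>N\<^esub>(c ` A) = c (\<Squnion>\<^bsub>M\<^esub>A)"
  by (rule N.least_unique[OF N.sup_lub lub]) (simp_all add: image_mono)

lemma inf_N: "A \<subseteq> carrier M \<Longrightarrow> \<Sqinter>\<^bsub>N\<^esub>(c ` A) = c (\<Sqinter>\<^bsub>M\<^esub>A)"
  by (rule N.greatest_unique[OF N.inf_glb glb]) (simp_all add: image_mono)

lemma join_N: "x \<in> carrier M \<Longrightarrow> y \<in> carrier M \<Longrightarrow> c x \<squnion>\<^bsub>N\<^esub> c y = c (x \<squnion>\<^bsub>M\<^esub> y)"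
  using sup_N[of "{x, y}"] by (simp add: join_def)

lemma meet_N: "x \<in> carrier M \<Longrightarrow> y \<in> carrier M \<Longrightarrow> c x \<sqinter>\<^bsub>N\<^esub> c y = c (x \<sqinter>\<^bsub>M\<^esub> y)"
  using inf_N[of "{x, y}"] by (simp add: meet_def)

lemma top_N: "\<top>\<^bsub>N\<^esub> = c \<top>\<^bsub>M\<^esub>"
proof -
  have "\<top>\<^bsub>N\<^esub> = \<Sqinter>\<^bsub>N\<^esub>(c ` {})" by (simp only: image_empty N.weak_inf_empty[unfolded N_simps])
  also have "\<dots> = c (\<Sqinter>\<^bsub>M\<^esub>{})" by (rule inf_N) simp
  also have "\<Sqinter>\<^bsub>M\<^esub>{} = \<top>\<^bsub>M\<^esub>" by (rule M.weak_inf_empty[unfolded M.eq_is_equal])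
  finally show ?thesis .
qed

lemma bottom_N: "\<bottom>\<^bsub>N\<^esub> = c \<bottom>\<^bsub>M\<^esub>"
proof -
  have "\<bottom>\<^bsub>N\<^esub> = \<Squnion>\<^bsub>N\<^esub>(c ` {})" by (simp only: image_empty N.weak_sup_empty[unfolded N_simps])
  also have "\<dots> = c (\<Squnion>\<^bsub>M\<^esub>{})" by (rule sup_N) simp
  also have "\<Squnion>\<^bsub>M\<^esub>{} = \<bottom>\<^bsub>M\<^esub>" by (rule M.weak_sup_empty[unfolded M.eq_is_equal])
  finally show ?thesis .
qed

lemma frame_N: "frame N"
proof (intro frame.intro N.complete_lattice_axioms frame_axioms.intro)
  fix a B assume a: "a \<in> carrier N" and B: "B \<subseteq> carrier N"
  obtain x where x: "x \<in> carrier M" "a = c x" using a by auto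
  obtain A where A: "A \<subseteq> carrier M" "B = c ` A" using ex_preimage[OF B] by blast
  have "a \<sqinter>\<^bsub>N\<^esub> \<Squnion>\<^bsub>N\<^esub>B = c (x \<sqinter>\<^bsub>M\<^esub> \<Squnion>\<^bsub>M\<^esub>A)"
    using x A meet_N sup_N M.sup_closed by simp
  also have "\<dots> = c (\<Squnion>\<^bsub>M\<^esub>((\<lambda>y. x \<sqinter>\<^bsub>M\<^esub> y) ` A))" using M.frame_distrib x A by simp
  also have "\<dots> = \<Squnion>\<^bsub>N\<^esub>(c ` (\<lambda>y. x \<sqinter>\<^bsub>M\<^esub> y) ` A)"
    using x A M.meet_closed by (intro sup_N[symmetric]) auto
  also have "c ` (\<lambda>y. x \<sqinter>\<^bsub>M\<^esub> y) ` A = (\<lambda>y. a \<sqinter>\<^bsub>N\<^esub> y) ` B"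
    unfolding A(2) image_image using x A(1) by (intro image_cong) (auto simp: meet_N)
  finally show "a \<sqinter>\<^bsub>N\<^esub> \<Squnion>\<^bsub>N\<^esub>B = \<Squnion>\<^bsub>N\<^esub>((\<lambda>y. a \<sqinter>\<^bsub>N\<^esub> y) ` B)" .
qed

lemma symmetric_copy:
  assumes "symmetric_frith_frame (M, C)"
  shows "symmetric_frith_frame (N, c ` C)"
proof -
  have C: "C \<subseteq> carrier M" "\<bottom>\<^bsub>M\<^esub> \<in> C" "\<top>\<^bsub>M\<^esub> \<in> C"
    "\<And>a b. a \<in> C \<Longrightarrow> b \<in> C \<Longrightarrow> a \<sqinter>\<^bsub>M\<^esub> b \<in> C \<and> a \<squnion>\<^bsub>M\<^esub> b \<in> C"
    "\<And>a. a \<in> carrier M \<Longrightarrow> \<exists>A\<subseteq>C. a = \<Squnion>\<^bsub>M\<^esub>A"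
    "\<And>a. a \<in> C \<Longrightarrow> \<exists>b\<in>C. a \<sqinter>\<^bsub>M\<^esub> b = \<bottom>\<^bsub>M\<^esub> \<and> a \<squnion>\<^bsub>M\<^esub> b = \<top>\<^bsub>M\<^esub>"
    using assms by (auto simp: symmetric_frith_frame_def frith_frame_def bounded_sublattice_def
        sublattice_def)
  have "\<exists>A\<subseteq>c ` C. a = \<Squnion>\<^bsub>N\<^esub>A" if "a \<in> carrier N" for a
  proof -
    obtain x where x: "x \<in> carrier M" "a = c x" using \<open>a \<in> carrier N\<close> by auto
    then obtain A where A: "A \<subseteq> C" "x = \<Squnion>\<^bsub>M\<^esub>A" using C(5) by blast
    then have "a = \<Squnion>\<^bsub>N\<^esub>(c ` A)" using sup_N[of A] C(1) x(2) by auto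
    then show ?thesis using image_mono[OF A(1)] by (intro exI[of _ "c ` A"] conjI)
  qed
  moreover have "bounded_sublattice N (c ` C)"
    unfolding bounded_sublattice_def sublattice_def
  proof (intro conjI ballI)
    show "c ` C \<subseteq> carrier N" using C(1) by auto
    fix a b assume "a \<in> c ` C" "b \<in> c ` C"
    then obtain x y where xy: "x \<in> C" "y \<in> C" "a = c x" "b = c y" by blast
    then show "a \<sqinter>\<^bsub>N\<^esub> b \<in> c ` C" "a \<squnion>\<^bsub>N\<^esub> b \<in> c ` C"
      using meet_N[of x y] join_N[of x y] C(1) C(4)[OF xy(1,2)] by auto
  qed (use bottom_N top_N C in auto)
  moreover have "\<exists>b\<in>c ` C. a \<sqinter>\<^bsub>N\<^esub> b = \<bottom>\<^bsub>N\<^esub> \<and> a \<squnion>\<^bsub>N\<^esub> b = \<top>\<^bsub>N\<^esub>" if "a \<in> c ` C" for a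
  proof -
    obtain x where x: "x \<in> C" "a = c x" using \<open>a \<in> c ` C\<close> by blast
    obtain y where y: "y \<in> C" "x \<sqinter>\<^bsub>M\<^esub> y = \<bottom>\<^bsub>M\<^esub>" "x \<squnion>\<^bsub>M\<^esub> y = \<top>\<^bsub>M\<^esub>" using C(6)[OF x(1)] by blast
    have "x \<in> carrier M" "y \<in> carrier M" using x y C(1) by auto
    then show ?thesis
      using meet_N join_N bottom_N top_N x y by (intro bexI[of _ "c y"]) auto
  qed
  ultimately show ?thesis
    using frame_N by (simp add: symmetric_frith_frame_def frith_frame_def)
qed

end

theorem symmetric_frith_complete_universal:
  fixes F :: "'a frith"
  assumes F: "frith_frame F" and complete: "symmetric_frith_complete F"
  shows "symmetric_frith_complete_wrt TYPE('b) F"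
  unfolding symmetric_frith_complete_wrt_def
proof (intro allI impI, elim conjE)
  fix G :: "'b frith" and h
  assume sym: "symmetric_frith_frame G" and ee: "frith_extremal_epi G F h" and d: "frith_dense G F h"
  obtain L B where FL: "F = (L, B)" by (rule prod.exhaust)
  obtain M C where GM: "G = (M, C)" by (rule prod.exhaust)
  note FG = FL GM
  interpret L: frame L using F by (simp add: FG frith_frame_def)
  interpret M: frame M using sym by (simp add: FG symmetric_frith_frame_def frith_frame_def)
  have C: "C \<subseteq> carrier M"
    "\<And>a b. a \<in> C \<Longrightarrow> b \<in> C \<Longrightarrow> a \<sqinter>\<^bsub>M\<^esub> b \<in> C"
    "\<And>a. a \<in> carrier M \<Longrightarrow> \<exists>A\<subseteq>C. a = \<Squnion>\<^bsub>M\<^esub>A"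
    "\<And>a. a \<in> C \<Longrightarrow> \<exists>b\<in>C. a \<sqinter>\<^bsub>M\<^esub> b = \<bottom>\<^bsub>M\<^esub> \<and> a \<squnion>\<^bsub>M\<^esub> b = \<top>\<^bsub>M\<^esub>"
    using sym by (auto simp: FG symmetric_frith_frame_def frith_frame_def bounded_sublattice_def
        sublattice_def)
  have h: "h \<in> carrier M \<rightarrow>\<^sub>E carrier L" "h \<top>\<^bsub>M\<^esub> = \<top>\<^bsub>L\<^esub>"
    "\<And>x y. x \<in> carrier M \<Longrightarrow> y \<in> carrier M \<Longrightarrow> h (x \<sqinter>\<^bsub>M\<^esub> y) = h x \<sqinter>\<^bsub>L\<^esub> h y"
    "\<And>A. A \<subseteq> carrier M \<Longrightarrow> h (\<Squnion>\<^bsub>M\<^esub>A) = \<Squnion>\<^bsub>L\<^esub>(h ` A)"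
    "h ` C = B"
    using ee by (auto simp: FG frith_extremal_epi_def frith_hom_def frame_hom_def)
  have hm: "h x \<in> carrier L" if "x \<in> carrier M" for x using PiE_mem[OF h(1) that] .
  have hbot: "h \<bottom>\<^bsub>M\<^esub> = \<bottom>\<^bsub>L\<^esub>"
    using h(4)[of "{}"] M.weak_sup_empty L.weak_sup_empty by (simp add: M.eq_is_equal L.eq_is_equal)
  have dense: "x = \<bottom>\<^bsub>M\<^esub>" if "x \<in> carrier M" "h x = \<bottom>\<^bsub>L\<^esub>" for x
    using d that by (auto simp: frith_dense_def FG)
  have le_C: "a \<sqsubseteq>\<^bsub>M\<^esub> b" if ab: "a \<in> C" "b \<in> C" "h a = h b" for a b
  proof -
    obtain b' where b': "b' \<in> C" "b \<sqinter>\<^bsub>M\<^esub> b' = \<bottom>\<^bsub>M\<^esub>" "b \<squnion>\<^bsub>M\<^esub> b' = \<top>\<^bsub>M\<^esub>" using C(4)[OF ab(2)] by blast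
    have m: "a \<in> carrier M" "b \<in> carrier M" "b' \<in> carrier M" using ab b' C(1) by auto
    have "h (a \<sqinter>\<^bsub>M\<^esub> b') = h (b \<sqinter>\<^bsub>M\<^esub> b')" using h(3) m ab(3) by simp
    then have z: "a \<sqinter>\<^bsub>M\<^esub> b' = \<bottom>\<^bsub>M\<^esub>" using dense m b'(2) hbot M.meet_closed by simp
    have "a \<sqinter>\<^bsub>M\<^esub> (b \<squnion>\<^bsub>M\<^esub> b') = (a \<sqinter>\<^bsub>M\<^esub> b) \<squnion>\<^bsub>M\<^esub> (a \<sqinter>\<^bsub>M\<^esub> b')"
      using M.frame_distrib[of a "{b, b'}"] m by (simp add: join_def)
    moreover have "a \<sqinter>\<^bsub>M\<^esub> \<top>\<^bsub>M\<^esub> = a"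
      using M.le_iff_join M.top_higher m by (metis M.le_iff_meet M.top_closed)
    ultimately have "a = (a \<sqinter>\<^bsub>M\<^esub> b) \<squnion>\<^bsub>M\<^esub> \<bottom>\<^bsub>M\<^esub>" using b'(3) z by simp
    moreover have "(a \<sqinter>\<^bsub>M\<^esub> b) \<squnion>\<^bsub>M\<^esub> \<bottom>\<^bsub>M\<^esub> \<sqsubseteq>\<^bsub>M\<^esub> b"
      using m M.join_le M.bottom_lower M.meet_right M.meet_closed by simp
    ultimately show ?thesis by simp
  qed
  define c where "c m = h ` {a \<in> C. a \<sqsubseteq>\<^bsub>M\<^esub> m}" for m
  have emb: "c m \<subseteq> c n \<longleftrightarrow> m \<sqsubseteq>\<^bsub>M\<^esub> n" if mn: "m \<in> carrier M" "n \<in> carrier M" for m n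
  proof
    assume "m \<sqsubseteq>\<^bsub>M\<^esub> n"
    then show "c m \<subseteq> c n" using mn C(1) M.le_trans unfolding c_def by blast
  next
    assume sub: "c m \<subseteq> c n"
    obtain A where A: "A \<subseteq> C" "m = \<Squnion>\<^bsub>M\<^esub>A" using C(3)[OF mn(1)] by blast
    have AM: "A \<subseteq> carrier M" using A C(1) by blast
    have "a \<sqsubseteq>\<^bsub>M\<^esub> n" if "a \<in> A" for a
    proof -
      have "a \<sqsubseteq>\<^bsub>M\<^esub> m" using M.sup_upper[OF AM that] A(2) by simp
      then have "h a \<in> c n" using sub that A(1) unfolding c_def by blast
      then obtain b where b: "b \<in> C" "b \<sqsubseteq>\<^bsub>M\<^esub> n" "h a = h b" unfolding c_def by blast
      have "a \<sqsubseteq>\<^bsub>M\<^esub> b" using le_C b that A(1) by blast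
      then show ?thesis
        using M.le_trans[OF _ b(2) subsetD[OF AM that] subsetD[OF C(1) b(1)] mn(2)] by simp
    qed
    then show "m \<sqsubseteq>\<^bsub>M\<^esub> n" using M.sup_least[OF AM mn(2)] A(2) by simp
  qed
  interpret K: frame_copy M c
    by unfold_locales (rule emb)
  define r where "r = the_inv_into (carrier M) c"
  have rc: "r (c m) = m" if "m \<in> carrier M" for m
    unfolding r_def using the_inv_into_f_f[OF K.inj that] .
  define h' where "h' = (\<lambda>u\<in>carrier K.N. h (r u))"
  have h'c: "h' (c m) = h m" if "m \<in> carrier M" for m
    using that rc by (simp add: h'_def)
  have img: "h' ` c ` A = h ` A" if "A \<subseteq> carrier M" for A
    unfolding image_image using that by (intro image_cong refl h'c) (rule subsetD)
  have "h' \<in> frith_hom (K.N, c ` C) (L, B)"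
    unfolding frith_hom_def frame_hom_def mem_Collect_eq fst_conv snd_conv
  proof (intro conjI ballI allI impI)
    show "h' \<in> carrier K.N \<rightarrow>\<^sub>E carrier L" using hm rc by (auto simp: h'_def)
    show "h' \<top>\<^bsub>K.N\<^esub> = \<top>\<^bsub>L\<^esub>" using K.top_N h'c h(2) M.top_closed by simp
    show "h' (x \<sqinter>\<^bsub>K.N\<^esub> y) = h' x \<sqinter>\<^bsub>L\<^esub> h' y" if "x \<in> carrier K.N" "y \<in> carrier K.N" for x y
    proof -
      obtain a b where ab: "a \<in> carrier M" "b \<in> carrier M" "x = c a" "y = c b" using \<open>x \<in> _\<close> \<open>y \<in> _\<close> by auto
      then show ?thesis using K.meet_N[OF ab(1,2)] h'c h(3)[OF ab(1,2)] M.meet_closed by simp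
    qed
    show "h' (\<Squnion>\<^bsub>K.N\<^esub>X) = \<Squnion>\<^bsub>L\<^esub>(h' ` X)" if "X \<subseteq> carrier K.N" for X
    proof -
      obtain A where A: "A \<subseteq> carrier M" "X = c ` A" using K.ex_preimage[OF \<open>X \<subseteq> carrier K.N\<close>] by blast
      then show ?thesis using K.sup_N[OF A(1)] h'c[OF M.sup_closed[OF A(1)]] h(4)[OF A(1)] img[OF A(1)] by simp
    qed
    show "h' ` c ` C \<subseteq> B" using img[OF C(1)] h(5) by simp
  qed
  then have "frith_extremal_epi (K.N, c ` C) (L, B) h'"
    using img[OF C(1)] h(5) by (simp add: frith_extremal_epi_def)
  moreover have "frith_dense (K.N, c ` C) (L, B) h'"
    using dense K.bottom_N h'c by (auto simp: frith_dense_def)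
  moreover have "symmetric_frith_frame (K.N, c ` C)"
    using K.symmetric_copy sym by (simp add: FG)
  ultimately have "frith_iso (K.N, c ` C) (L, B) h'"
    using complete unfolding symmetric_frith_complete_def symmetric_frith_complete_wrt_def FG by blast
  then obtain k where k: "k \<in> frith_hom (L, B) (K.N, c ` C)"
    "frith_comp (K.N, c ` C) k h' = frith_id (K.N, c ` C)" "frith_comp (L, B) h' k = frith_id (L, B)"
    by (auto simp: frith_iso_def)
  have kh': "k (h' u) = u" if "u \<in> carrier K.N" for u
    using fun_cong[OF k(2), of u] that by (simp add: frith_comp_def frith_id_def compose_def)
  have h'k: "h' (k a) = a" if "a \<in> carrier L" for a
    using fun_cong[OF k(3), of a] that by (simp add: frith_comp_def frith_id_def compose_def)
  have km: "k a \<in> carrier K.N" if "a \<in> carrier L" for a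
    using k(1) that by (auto simp: frith_hom_def frame_hom_def dest: PiE_mem)
  have "bij_betw h (carrier M) (carrier L)"
  proof (rule bij_betwI[where g = "\<lambda>a. r (k a)"])
    show "h \<in> carrier M \<rightarrow> carrier L" using hm by blast
    show "(\<lambda>a. r (k a)) \<in> carrier L \<rightarrow> carrier M" using km rc by fastforce
    show "r (k (h x)) = x" if "x \<in> carrier M" for x
      using kh'[of "c x"] h'c[OF that] rc[OF that] that by simp
    show "h (r (k y)) = y" if "y \<in> carrier L" for y
      using h'k[OF that] km[OF that] by (simp add: h'_def)
  qed
  then show "frith_iso G F h"
    using ee h(5) C(1) M.frame_axioms L.frame_axioms
    by (intro bij_frith_iso) (auto simp: FG frith_extremal_epi_def)
qed

end

theory Submission
  imports Defs
begin

text \<open>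
  Both notions of completeness turn into conditions on the lattice of basic elements, and with
  these conditions the duality is of Stone type.

  A Frith frame \<open>(L, S)\<close> is complete if and only if every element of \<open>S\<close> is compact in \<open>L\<close>
  (\<open>cfrith_iff\<close>). In the symmetric case, joining up ideals maps the frame of ideals of \<open>S\<close> onto
  \<open>L\<close> by a dense extremal epimorphism. If this is an isomorphism, then a basic element below a join
  belongs to the ideal generated by the joined basic elements, which is compactness. Conversely, a dense
  homomorphism is injective on complemented elements, and compactness extends this to all joins of
  such elements. In the general case the embedding \<open>nabla\<close> of \<open>L\<close> into the symmetrization
  preserves joins, so compactness descends to \<open>L\<close>. To lift it from \<open>L\<close>, one needs to control
  infinite joins of congruences. If \<open>S\<close> is compact, then the basic congruences can be recovered
  from their traces on \<open>S\<close>, and the trace of a directed join is the union of the traces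
  (\<open>sym_basis_finitary\<close>, \<open>frame_congruence_basis_closure\<close>). Hence the top congruence is compact,
  and the complemented basic congruences inherit this.

  A \<open>T\<^sub>0\<close> Pervin space \<open>(X, S)\<close> is complete if and only if every prime filter of \<open>S\<close> consists of
  the basic sets around some point (\<open>cpervin_iff\<close>). Indeed, the ultrafilters of the generated
  Boolean algebra form a dense \<open>T\<^sub>0\<close> extension of the symmetrized space, any other such extension
  embeds into it, and these ultrafilters correspond to the prime filters of \<open>S\<close>.

  A point of a Frith frame is determined by the prime filter of basic elements that it contains.
  If \<open>S\<close> is compact in \<open>L\<close>, then every prime filter of \<open>S\<close> arises in this way, so that \<open>pt\<close>
  preserves completeness; and in a complete space every prime filter of \<open>S\<close> comes from an element
  of \<open>X\<close>, so that the unit is bijective. The remaining two facts need many prime filters, which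
  the Prime Ideal Theorem supplies. They show that the basic sets of a complete space
  are compact open sets, so that \<open>Omega\<close> preserves completeness, and that a complete Frith frame
  is spatial, so that the counit is an isomorphism. The adjunction itself holds for all Pervin
  spaces and Frith frames.
\<close>

section \<open>Orders by inclusion and frames\<close>

context partial_order
begin

lemma sup_eqI:
  assumes "A \<subseteq> carrier L" "s \<in> carrier L" "\<And>x. x \<in> A \<Longrightarrow> x \<sqsubseteq> s"
    "\<And>y. y \<in> carrier L \<Longrightarrow> (\<And>x. x \<in> A \<Longrightarrow> x \<sqsubseteq> y) \<Longrightarrow> s \<sqsubseteq> y"
  shows "\<Squnion>A = s"
proof -
  have "is_lub L s A"
    using assms by (intro least_UpperI) (auto simp: Upper_def subset_iff)
  then show ?thesis unfolding sup_def by (rule some_equality) (blast intro: least_unique \<open>is_lub L s A\<close>)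
qed

lemma inf_eqI:
  assumes "A \<subseteq> carrier L" "s \<in> carrier L" "\<And>x. x \<in> A \<Longrightarrow> s \<sqsubseteq> x"
    "\<And>y. y \<in> carrier L \<Longrightarrow> (\<And>x. x \<in> A \<Longrightarrow> y \<sqsubseteq> x) \<Longrightarrow> y \<sqsubseteq> s"
  shows "\<Sqinter>A = s"
proof -
  have "is_glb L s A"
    using assms by (intro greatest_LowerI) (auto simp: Lower_def subset_iff)
  then show ?thesis unfolding Lattice.inf_def by (rule some_equality) (blast intro: greatest_unique \<open>is_glb L s A\<close>)
qed

lemma top_eqI:
  assumes "s \<in> carrier L" "\<And>x. x \<in> carrier L \<Longrightarrow> x \<sqsubseteq> s"
  shows "\<top> = s"
proof -
  have "greatest L s (carrier L)" using assms by (auto simp: greatest_def)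
  then show ?thesis unfolding top_def
    by (rule some_equality) (blast intro: greatest_unique \<open>greatest L s (carrier L)\<close>)
qed

lemma bottom_eqI:
  assumes "s \<in> carrier L" "\<And>x. x \<in> carrier L \<Longrightarrow> s \<sqsubseteq> x"
  shows "\<bottom> = s"
proof -
  have "least L s (carrier L)" using assms by (auto simp: least_def)
  then show ?thesis unfolding bottom_def
    by (rule some_equality) (blast intro: least_unique \<open>least L s (carrier L)\<close>)
qed

text \<open>Infima are suprema of lower bounds.\<close>

lemma complete_lattice_from_sups:
  assumes "\<And>A. A \<subseteq> carrier L \<Longrightarrow> \<exists>s. is_lub L s A"
  shows "complete_lattice L"
proof (rule complete_latticeI)
  fix A assume A: "A \<subseteq> carrier L"
  have low: "Lower L A \<subseteq> carrier L" by simp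
  then obtain s where s: "is_lub L s (Lower L A)" using assms by blast
  have "s \<sqsubseteq> a" if "a \<in> A" for a
    using s that A by (intro least_le[OF s]) (auto simp: Upper_def Lower_def)
  moreover have "y \<sqsubseteq> s" if "y \<in> Lower L A" for y
    using least_Upper_above[OF s that low] .
  ultimately have "is_glb L s A"
    using A s by (intro greatest_LowerI) auto
  then show "\<exists>i. is_glb L i A" ..
qed (rule assms)

end

definition inclusion_order :: "'a set set \<Rightarrow> 'a set gorder" where
  "inclusion_order \<C> = \<lparr>carrier = \<C>, eq = (=), le = (\<subseteq>)\<rparr>"

lemma inclusion_order_simps [simp]:
  "carrier (inclusion_order \<C>) = \<C>" "le (inclusion_order \<C>) = (\<subseteq>)"
  "eq (inclusion_order \<C>) = (=)"
  by (simp_all add: inclusion_order_def)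

lemma partial_order_inclusion_order: "partial_order (inclusion_order \<C>)"
  by unfold_locales auto

text \<open>
  Two kinds of set families occur: topologies, where joins are unions, and closure systems (ideals,
  congruences), where they are not.
\<close>

lemma inclusion_order_sup_eq_Union:
  "D \<subseteq> \<C> \<Longrightarrow> \<Union>D \<in> \<C> \<Longrightarrow> \<Squnion>\<^bsub>inclusion_order \<C>\<^esub>D = \<Union>D"
  by (rule partial_order.sup_eqI[OF partial_order_inclusion_order]) auto

lemma inclusion_order_meet_eq_Int:
  "A \<in> \<C> \<Longrightarrow> B \<in> \<C> \<Longrightarrow> A \<inter> B \<in> \<C> \<Longrightarrow> A \<sqinter>\<^bsub>inclusion_order \<C>\<^esub> B = A \<inter> B"
  unfolding meet_def by (rule partial_order.inf_eqI[OF partial_order_inclusion_order]) auto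

lemma inclusion_order_top:
  "X \<in> \<C> \<Longrightarrow> (\<And>A. A \<in> \<C> \<Longrightarrow> A \<subseteq> X) \<Longrightarrow> \<top>\<^bsub>inclusion_order \<C>\<^esub> = X"
  by (rule partial_order.top_eqI[OF partial_order_inclusion_order]) auto

lemma inclusion_order_bottom:
  "X \<in> \<C> \<Longrightarrow> (\<And>A. A \<in> \<C> \<Longrightarrow> X \<subseteq> A) \<Longrightarrow> \<bottom>\<^bsub>inclusion_order \<C>\<^esub> = X"
  by (rule partial_order.bottom_eqI[OF partial_order_inclusion_order]) auto

lemma frame_of_open_sets:
  assumes Un: "\<And>D. D \<subseteq> \<C> \<Longrightarrow> \<Union>D \<in> \<C>"
    and Int: "\<And>A B. A \<in> \<C> \<Longrightarrow> B \<in> \<C> \<Longrightarrow> A \<inter> B \<in> \<C>"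
  shows "frame (inclusion_order \<C>)"
proof -
  interpret partial_order "inclusion_order \<C>" by (rule partial_order_inclusion_order)
  interpret complete_lattice "inclusion_order \<C>"
  proof (rule complete_lattice_from_sups)
    fix D assume "D \<subseteq> carrier (inclusion_order \<C>)"
    then have "is_lub (inclusion_order \<C>) (\<Union>D) D"
      using Un by (intro least_UpperI) (auto simp: Upper_def)
    then show "\<exists>s. is_lub (inclusion_order \<C>) s D" ..
  qed
  show ?thesis
  proof (unfold_locales, unfold inclusion_order_simps)
    fix A D assume A: "A \<in> \<C>" and D: "D \<subseteq> \<C>"
    have eq: "(\<lambda>B. A \<sqinter>\<^bsub>inclusion_order \<C>\<^esub> B) ` D = (\<lambda>B. A \<inter> B) ` D"
      using A D Int by (intro image_cong refl inclusion_order_meet_eq_Int) auto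
    have sub: "(\<lambda>B. A \<inter> B) ` D \<subseteq> \<C>" using A D Int by auto
    have "A \<sqinter>\<^bsub>inclusion_order \<C>\<^esub> \<Squnion>\<^bsub>inclusion_order \<C>\<^esub>D = A \<inter> \<Union>D"
      using A D Un Int by (simp add: inclusion_order_sup_eq_Union inclusion_order_meet_eq_Int)
    also have "\<dots> = \<Union>((\<lambda>B. A \<inter> B) ` D)" by blast
    also have "\<dots> = \<Squnion>\<^bsub>inclusion_order \<C>\<^esub>((\<lambda>B. A \<sqinter>\<^bsub>inclusion_order \<C>\<^esub> B) ` D)"
      unfolding eq by (rule inclusion_order_sup_eq_Union[OF sub Un[OF sub], symmetric])
    finally show "A \<sqinter>\<^bsub>inclusion_order \<C>\<^esub> \<Squnion>\<^bsub>inclusion_order \<C>\<^esub>D =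
      \<Squnion>\<^bsub>inclusion_order \<C>\<^esub>((\<lambda>B. A \<sqinter>\<^bsub>inclusion_order \<C>\<^esub> B) ` D)" .
  qed
qed

lemma closure_system_complete_lattice:
  assumes X: "X \<in> \<C>" "\<And>A. A \<in> \<C> \<Longrightarrow> A \<subseteq> X"
    and Int: "\<And>D. D \<subseteq> \<C> \<Longrightarrow> D \<noteq> {} \<Longrightarrow> \<Inter>D \<in> \<C>"
  shows "complete_lattice (inclusion_order \<C>)"
proof -
  interpret partial_order "inclusion_order \<C>" by (rule partial_order_inclusion_order)
  show ?thesis
  proof (rule complete_lattice_criterion1)
    show "\<exists>g. greatest (inclusion_order \<C>) g (carrier (inclusion_order \<C>))"
      using X by (intro exI[of _ X]) (auto simp: greatest_def)
    fix D assume D: "D \<subseteq> carrier (inclusion_order \<C>)" "D \<noteq> {}"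
    then have "is_glb (inclusion_order \<C>) (\<Inter>D) D"
      using Int by (intro greatest_LowerI) (auto simp: Lower_def)
    then show "\<exists>i. is_glb (inclusion_order \<C>) i D" ..
  qed
qed

context frame
begin

lemma meet_top: "a \<in> carrier L \<Longrightarrow> a \<sqinter> \<top> = a"
  using le_iff_join[of a "\<top>"] top_higher by simp

lemma join_bottom: "a \<in> carrier L \<Longrightarrow> a \<squnion> \<bottom> = a"
  using bottom_join[of a] by (simp add: join_comm eq_is_equal)

lemma meet_bottom: "a \<in> carrier L \<Longrightarrow> a \<sqinter> \<bottom> = \<bottom>"
  using bottom_meet[of a] by (simp add: meet_comm eq_is_equal)

lemma sup_empty: "\<Squnion>{} = \<bottom>"
  using weak_sup_empty by (simp add: eq_is_equal)

lemma sup_insert: "a \<in> carrier L \<Longrightarrow> A \<subseteq> carrier L \<Longrightarrow> \<Squnion>(insert a A) = a \<squnion> \<Squnion>A"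
  using weak_sup_insert[of a A] by (simp add: eq_is_equal)

lemma sup_mono: "A \<subseteq> B \<Longrightarrow> B \<subseteq> carrier L \<Longrightarrow> \<Squnion>A \<sqsubseteq> \<Squnion>B"
  by (rule sup_least) (auto intro: sup_upper)

lemma sup_Un: "A \<subseteq> carrier L \<Longrightarrow> B \<subseteq> carrier L \<Longrightarrow> \<Squnion>(A \<union> B) = \<Squnion>A \<squnion> \<Squnion>B"
proof (rule le_antisym)
  assume AB: "A \<subseteq> carrier L" "B \<subseteq> carrier L"
  show "\<Squnion>(A \<union> B) \<sqsubseteq> \<Squnion>A \<squnion> \<Squnion>B"
  proof (rule sup_least)
    fix x assume "x \<in> A \<union> B"
    then have x: "x \<in> carrier L" "x \<sqsubseteq> \<Squnion>A \<or> x \<sqsubseteq> \<Squnion>B" using AB sup_upper by auto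
    then show "x \<sqsubseteq> \<Squnion>A \<squnion> \<Squnion>B"
      using AB le_trans[OF _ join_left] le_trans[OF _ join_right] by auto
  qed (use AB in auto)
  show "\<Squnion>A \<squnion> \<Squnion>B \<sqsubseteq> \<Squnion>(A \<union> B)"
    using AB by (intro join_le sup_mono) auto
qed auto

lemma meet_mono:
  "a \<sqsubseteq> a' \<Longrightarrow> b \<sqsubseteq> b' \<Longrightarrow> a \<in> carrier L \<Longrightarrow> a' \<in> carrier L \<Longrightarrow> b \<in> carrier L \<Longrightarrow> b' \<in> carrier L \<Longrightarrow>
   a \<sqinter> b \<sqsubseteq> a' \<sqinter> b'"
  using le_trans[OF meet_left[of a b], of a'] le_trans[OF meet_right[of a b], of b']
  by (intro meet_le) auto

lemma join_mono:
  "a \<sqsubseteq> a' \<Longrightarrow> b \<sqsubseteq> b' \<Longrightarrow> a \<in> carrier L \<Longrightarrow> a' \<in> carrier L \<Longrightarrow> b \<in> carrier L \<Longrightarrow> b' \<in> carrier L \<Longrightarrow>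
   a \<squnion> b \<sqsubseteq> a' \<squnion> b'"
  using le_trans[OF _ join_left[of a' b'], of a] le_trans[OF _ join_right[of a' b'], of b]
  by (intro join_le) auto

lemma meet_join_distrib:
  assumes "a \<in> carrier L" "b \<in> carrier L" "c \<in> carrier L"
  shows "a \<sqinter> (b \<squnion> c) = (a \<sqinter> b) \<squnion> (a \<sqinter> c)"
  using frame_distrib[of a "{b, c}"] assms by (simp add: join_def)

lemma meet_absorb: "a \<in> carrier L \<Longrightarrow> b \<in> carrier L \<Longrightarrow> a \<sqsubseteq> b \<Longrightarrow> a \<sqinter> b = a"
  using le_iff_join by metis

lemma meet_absorb2: "a \<in> carrier L \<Longrightarrow> b \<in> carrier L \<Longrightarrow> a \<sqsubseteq> b \<Longrightarrow> b \<sqinter> a = a"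
  using meet_absorb meet_comm by metis

lemma join_absorb: "a \<in> carrier L \<Longrightarrow> b \<in> carrier L \<Longrightarrow> a \<sqsubseteq> b \<Longrightarrow> a \<squnion> b = b"
  using le_iff_meet by metis

lemma join_absorb2: "a \<in> carrier L \<Longrightarrow> b \<in> carrier L \<Longrightarrow> a \<sqsubseteq> b \<Longrightarrow> b \<squnion> a = b"
  using join_absorb join_comm by metis

lemma join_meet_distrib:
  assumes abc: "a \<in> carrier L" "b \<in> carrier L" "c \<in> carrier L"
  shows "a \<squnion> (b \<sqinter> c) = (a \<squnion> b) \<sqinter> (a \<squnion> c)"
proof -
  have "(a \<squnion> b) \<sqinter> (a \<squnion> c) = ((a \<squnion> b) \<sqinter> a) \<squnion> ((a \<squnion> b) \<sqinter> c)"
    using abc by (intro meet_join_distrib) auto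
  also have "(a \<squnion> b) \<sqinter> a = a" using abc by (intro meet_absorb2) (auto intro: join_left)
  also have "(a \<squnion> b) \<sqinter> c = (c \<sqinter> a) \<squnion> (c \<sqinter> b)"
    using abc by (subst meet_comm) (rule meet_join_distrib)
  also have "a \<squnion> ((c \<sqinter> a) \<squnion> (c \<sqinter> b)) = (a \<squnion> (c \<sqinter> a)) \<squnion> (c \<sqinter> b)"
    using abc by (simp add: join_assoc)
  also have "a \<squnion> (c \<sqinter> a) = a" using abc by (intro join_absorb2) (auto intro: meet_right)
  finally show ?thesis by (simp add: meet_comm)
qed

text \<open>Distributivity makes complements reflect the order.\<close>

lemma le_if_meet_complement_bottom:
  assumes "a \<in> carrier L" "b \<in> carrier L" "b' \<in> carrier L" "b \<squnion> b' = \<top>" "a \<sqinter> b' = \<bottom>"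
  shows "a \<sqsubseteq> b"
proof -
  have "a = a \<sqinter> (b \<squnion> b')" using assms meet_top by simp
  also have "\<dots> = a \<sqinter> b" using assms(1-3,5) meet_join_distrib join_bottom by simp
  finally show ?thesis using assms(1,2) meet_right by metis
qed

lemma sup_meet_sup:
  assumes A: "A \<subseteq> carrier L" and B: "B \<subseteq> carrier L"
  shows "\<Squnion>A \<sqinter> \<Squnion>B = \<Squnion>{a \<sqinter> b | a b. a \<in> A \<and> b \<in> B}"
proof -
  let ?C = "{a \<sqinter> b | a b. a \<in> A \<and> b \<in> B}"
  have C: "?C \<subseteq> carrier L" using A B meet_closed by blast
  have 1: "a \<sqinter> \<Squnion>B \<sqsubseteq> \<Squnion>?C" if "a \<in> A" for a
  proof -
    have a: "a \<in> carrier L" using A that by blast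
    have "\<Squnion>((\<lambda>b. a \<sqinter> b) ` B) \<sqsubseteq> \<Squnion>?C"
      using that by (intro sup_mono C) auto
    then show ?thesis using frame_distrib[OF a B] by simp
  qed
  have im: "(\<lambda>a. \<Squnion>B \<sqinter> a) ` A \<subseteq> carrier L" using A B by auto
  have "\<Squnion>B \<sqinter> \<Squnion>A = \<Squnion>((\<lambda>a. \<Squnion>B \<sqinter> a) ` A)" using A B by (intro frame_distrib) auto
  also have "\<dots> \<sqsubseteq> \<Squnion>?C" using im C 1 by (intro sup_least) (auto simp: meet_comm)
  finally have le: "\<Squnion>A \<sqinter> \<Squnion>B \<sqsubseteq> \<Squnion>?C" by (simp add: meet_comm)
  have ge: "\<Squnion>?C \<sqsubseteq> \<Squnion>A \<sqinter> \<Squnion>B"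
  proof (rule sup_least[OF C])
    fix x assume "x \<in> ?C"
    then obtain a b where "a \<in> A" "b \<in> B" "x = a \<sqinter> b" by blast
    then show "x \<sqsubseteq> \<Squnion>A \<sqinter> \<Squnion>B"
      using A B by (auto intro!: meet_mono sup_upper)
  qed (use A B in auto)
  show ?thesis using le_antisym[OF le ge] A B C by simp
qed

end

lemma subframe_inherits:
  fixes L :: "'a gorder" (structure)
  assumes "frame L" and K: "subframe L K"
  shows "frame (L\<lparr>carrier := K\<rparr>)"
    and "\<And>A. A \<subseteq> K \<Longrightarrow> \<Squnion>\<^bsub>L\<lparr>carrier := K\<rparr>\<^esub>A = \<Squnion>A"
    and "\<And>a b. a \<in> K \<Longrightarrow> b \<in> K \<Longrightarrow> a \<sqinter>\<^bsub>L\<lparr>carrier := K\<rparr>\<^esub> b = a \<sqinter> b"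
    and "\<And>a b. a \<in> K \<Longrightarrow> b \<in> K \<Longrightarrow> a \<squnion>\<^bsub>L\<lparr>carrier := K\<rparr>\<^esub> b = a \<squnion> b"
    and "\<top>\<^bsub>L\<lparr>carrier := K\<rparr>\<^esub> = \<top>" and "\<bottom>\<^bsub>L\<lparr>carrier := K\<rparr>\<^esub> = \<bottom>"
proof -
  interpret frame L by fact
  let ?M = "L\<lparr>carrier := K\<rparr>"
  have sub: "K \<subseteq> carrier L" and top: "\<top> \<in> K" and meet: "\<And>a b. a \<in> K \<Longrightarrow> b \<in> K \<Longrightarrow> a \<sqinter> b \<in> K"
    and sup: "\<And>A. A \<subseteq> K \<Longrightarrow> \<Squnion>A \<in> K"
    using K by (auto simp: subframe_def)
  interpret M: partial_order ?M
    using sub by unfold_locales (auto simp: eq_is_equal intro: le_antisym le_trans)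
  have M_sup: "\<Squnion>\<^bsub>?M\<^esub>A = \<Squnion>A" if "A \<subseteq> K" for A
    using that sub sup by (intro M.sup_eqI) (auto intro!: sup_upper sup_least)
  have M_meet: "a \<sqinter>\<^bsub>?M\<^esub> b = a \<sqinter> b" if "a \<in> K" "b \<in> K" for a b
    unfolding meet_def[of ?M] using that sub meet
    by (intro M.inf_eqI) (auto intro: meet_left meet_right intro!: meet_le)
  interpret M: complete_lattice ?M
  proof (rule M.complete_lattice_from_sups)
    fix A assume "A \<subseteq> carrier ?M"
    then have "is_lub ?M (\<Squnion>A) A"
      using sub sup by (intro least_UpperI) (auto simp: Upper_def intro!: sup_upper sup_least)
    then show "\<exists>s. is_lub ?M s A" ..
  qed
  show "\<Squnion>\<^bsub>?M\<^esub>A = \<Squnion>A" if "A \<subseteq> K" for A using M_sup[OF that] .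
  show "a \<sqinter>\<^bsub>?M\<^esub> b = a \<sqinter> b" if "a \<in> K" "b \<in> K" for a b using M_meet[OF that] .
  show "a \<squnion>\<^bsub>?M\<^esub> b = a \<squnion> b" if "a \<in> K" "b \<in> K" for a b
    using M_sup[of "{a, b}"] that by (simp add: join_def)
  show "\<top>\<^bsub>?M\<^esub> = \<top>" using top sub top_higher by (intro M.top_eqI) auto
  show "\<bottom>\<^bsub>?M\<^esub> = \<bottom>"
    using sup[of "{}"] sub bottom_lower by (intro M.bottom_eqI) (auto simp: sup_empty)
  show "frame ?M"
  proof
    fix a A assume "a \<in> carrier ?M" "A \<subseteq> carrier ?M"
    then have a: "a \<in> K" and A: "A \<subseteq> K" by auto
    have eq: "(\<lambda>x. a \<sqinter>\<^bsub>?M\<^esub> x) ` A = (\<lambda>x. a \<sqinter> x) ` A"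
      using a A by (intro image_cong refl M_meet) auto
    have "(\<lambda>x. a \<sqinter> x) ` A \<subseteq> K" using a A meet by auto
    then show "a \<sqinter>\<^bsub>?M\<^esub> \<Squnion>\<^bsub>?M\<^esub>A = \<Squnion>\<^bsub>?M\<^esub>((\<lambda>x. a \<sqinter>\<^bsub>?M\<^esub> x) ` A)"
      unfolding eq using a A sub by (simp add: M_sup M_meet sup frame_distrib subset_iff)
  qed
qed

definition compact_in :: "'a gorder \<Rightarrow> 'a \<Rightarrow> bool" where
  "compact_in L s \<longleftrightarrow> s \<in> carrier L \<and>
     (\<forall>A\<subseteq>carrier L. s \<sqsubseteq>\<^bsub>L\<^esub> \<Squnion>\<^bsub>L\<^esub>A \<longrightarrow> (\<exists>A\<^sub>0\<subseteq>A. finite A\<^sub>0 \<and> s \<sqsubseteq>\<^bsub>L\<^esub> \<Squnion>\<^bsub>L\<^esub>A\<^sub>0))"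

lemma compact_inE:
  assumes "compact_in L s" "A \<subseteq> carrier L" "s \<sqsubseteq>\<^bsub>L\<^esub> \<Squnion>\<^bsub>L\<^esub>A"
  obtains A\<^sub>0 where "A\<^sub>0 \<subseteq> A" "finite A\<^sub>0" "s \<sqsubseteq>\<^bsub>L\<^esub> \<Squnion>\<^bsub>L\<^esub>A\<^sub>0"
  using assms unfolding compact_in_def by blast

locale frith = frame L for L (structure) +
  fixes S
  assumes bounded_sublattice: "bounded_sublattice L S"
    and joins_of_basis: "a \<in> carrier L \<Longrightarrow> \<exists>A\<subseteq>S. a = \<Squnion>A"
begin

lemma basis_carrier: "s \<in> S \<Longrightarrow> s \<in> carrier L"
  and basis_meet: "s \<in> S \<Longrightarrow> t \<in> S \<Longrightarrow> s \<sqinter> t \<in> S"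
  and basis_join: "s \<in> S \<Longrightarrow> t \<in> S \<Longrightarrow> s \<squnion> t \<in> S"
  and basis_bottom: "\<bottom> \<in> S" and basis_top: "\<top> \<in> S"
  using bounded_sublattice by (auto simp: bounded_sublattice_def sublattice_def)

lemma basis_subset: "S \<subseteq> carrier L" using basis_carrier by blast

lemma finite_sup_in_basis:
  assumes "finite A" "A \<subseteq> S"
  shows "\<Squnion>A \<in> S"
  using assms
proof (induction A)
  case empty
  then show ?case by (simp add: sup_empty basis_bottom)
next
  case (insert a A)
  then have "a \<in> carrier L" "A \<subseteq> carrier L" using basis_subset by auto
  then show ?case using insert by (simp add: sup_insert basis_join)
qed

lemma le_via_basis:
  assumes "a \<in> carrier L" "b \<in> carrier L" "\<And>s. s \<in> S \<Longrightarrow> s \<sqsubseteq> a \<Longrightarrow> s \<sqsubseteq> b"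
  shows "a \<sqsubseteq> b"
proof -
  obtain A where A: "A \<subseteq> S" "a = \<Squnion>A" using joins_of_basis[OF assms(1)] by blast
  then have "A \<subseteq> carrier L" using basis_subset by blast
  then have "\<Squnion>A \<sqsubseteq> b"
    using A(2) assms(2) assms(3)[OF subsetD[OF A(1)]] sup_upper by (intro sup_least) auto
  then show ?thesis using A(2) by simp
qed

lemma sup_basis_below: "a \<in> carrier L \<Longrightarrow> \<Squnion>{s \<in> S. s \<sqsubseteq> a} = a"
  by (rule sup_eqI) (use basis_subset le_via_basis in auto)

end

lemma frith_frame_iff: "frith_frame (L, S) \<longleftrightarrow> frith L S"
  by (auto simp: frith_frame_def frith_def frith_axioms_def)

section \<open>Complete symmetric Frith frames are those with a compact basis\<close>

lemma frame_hom_closed: "h \<in> frame_hom M L \<Longrightarrow> x \<in> carrier M \<Longrightarrow> h x \<in> carrier L"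
  by (auto simp: frame_hom_def dest: PiE_mem)

lemma frame_hom_meet:
  "h \<in> frame_hom M L \<Longrightarrow> x \<in> carrier M \<Longrightarrow> y \<in> carrier M \<Longrightarrow> h (x \<sqinter>\<^bsub>M\<^esub> y) = h x \<sqinter>\<^bsub>L\<^esub> h y"
  by (auto simp: frame_hom_def)

lemma frame_hom_sup:
  "h \<in> frame_hom M L \<Longrightarrow> A \<subseteq> carrier M \<Longrightarrow> h (\<Squnion>\<^bsub>M\<^esub>A) = \<Squnion>\<^bsub>L\<^esub>(h ` A)"
  by (auto simp: frame_hom_def)

lemma frame_hom_top: "h \<in> frame_hom M L \<Longrightarrow> h \<top>\<^bsub>M\<^esub> = \<top>\<^bsub>L\<^esub>"
  by (auto simp: frame_hom_def)

lemma frame_hom_bottom: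
  assumes "frame M" "frame L" "h \<in> frame_hom M L"
  shows "h \<bottom>\<^bsub>M\<^esub> = \<bottom>\<^bsub>L\<^esub>"
  using frame_hom_sup[OF assms(3), of "{}"] frame.sup_empty[OF assms(1)] frame.sup_empty[OF assms(2)]
  by simp

lemma frame_hom_mono:
  assumes M: "frame M" and L: "frame L" and h: "h \<in> frame_hom M L"
    and xy: "x \<in> carrier M" "y \<in> carrier M" "x \<sqsubseteq>\<^bsub>M\<^esub> y"
  shows "h x \<sqsubseteq>\<^bsub>L\<^esub> h y"
proof -
  interpret M: frame M by (rule M)
  interpret L: frame L by (rule L)
  have "h x = h x \<sqinter>\<^bsub>L\<^esub> h y" using frame_hom_meet[OF h xy(1,2)] M.meet_absorb xy by simp
  then show ?thesis using L.meet_right frame_hom_closed[OF h] xy(1,2) by metis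
qed

context frith
begin

lemma sup_basis_refinement:
  assumes A: "A \<subseteq> carrier L"
  shows "\<Squnion>{t \<in> S. \<exists>a\<in>A. t \<sqsubseteq> a} = \<Squnion>A"
proof (rule sup_eqI)
  let ?T = "{t \<in> S. \<exists>a\<in>A. t \<sqsubseteq> a}"
  show T: "?T \<subseteq> carrier L" using basis_subset by auto
  show "\<Squnion>A \<in> carrier L" using A by simp
  show "t \<sqsubseteq> \<Squnion>A" if t: "t \<in> ?T" for t
  proof -
    obtain a where a: "a \<in> A" "t \<sqsubseteq> a" using t by blast
    have "t \<in> carrier L" "a \<in> carrier L" using t T A a(1) by blast+
    then show ?thesis using le_trans[OF a(2) sup_upper[OF A a(1)]] A by auto
  qed
  show "\<Squnion>A \<sqsubseteq> y" if y: "y \<in> carrier L" "\<And>t. t \<in> ?T \<Longrightarrow> t \<sqsubseteq> y" for y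
  proof (rule sup_least[OF A y(1)])
    fix a assume a: "a \<in> A"
    show "a \<sqsubseteq> y"
    proof (rule le_via_basis)
      show "a \<in> carrier L" using a A by blast
      show "s \<sqsubseteq> y" if "s \<in> S" "s \<sqsubseteq> a" for s using y(2)[of s] that a by blast
    qed (rule y(1))
  qed
qed

text \<open>Only covers by basic elements need to be tested: refine a cover, then enlarge the chosen pieces.\<close>

lemma compact_inI_basis:
  assumes s: "s \<in> carrier L"
    and fin: "\<And>T. T \<subseteq> S \<Longrightarrow> s \<sqsubseteq> \<Squnion>T \<Longrightarrow> \<exists>T\<^sub>0\<subseteq>T. finite T\<^sub>0 \<and> s \<sqsubseteq> \<Squnion>T\<^sub>0"
  shows "compact_in L s"
  unfolding compact_in_def
proof (intro conjI allI impI, rule s)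
  fix A assume A: "A \<subseteq> carrier L" and le: "s \<sqsubseteq> \<Squnion>A"
  let ?T = "{t \<in> S. \<exists>a\<in>A. t \<sqsubseteq> a}"
  obtain T\<^sub>0 where T\<^sub>0: "T\<^sub>0 \<subseteq> ?T" "finite T\<^sub>0" "s \<sqsubseteq> \<Squnion>T\<^sub>0"
    using fin[of ?T] le sup_basis_refinement[OF A] by auto
  have "\<forall>t\<in>T\<^sub>0. \<exists>a. a \<in> A \<and> t \<sqsubseteq> a" using T\<^sub>0(1) by auto
  then obtain f where f: "\<And>t. t \<in> T\<^sub>0 \<Longrightarrow> f t \<in> A \<and> t \<sqsubseteq> f t" by metis
  have fc: "f ` T\<^sub>0 \<subseteq> carrier L" "T\<^sub>0 \<subseteq> carrier L" using f A T\<^sub>0(1) basis_subset by auto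
  have "\<Squnion>T\<^sub>0 \<sqsubseteq> \<Squnion>(f ` T\<^sub>0)"
  proof (rule sup_least)
    fix t assume t: "t \<in> T\<^sub>0"
    have "t \<in> carrier L" "f t \<in> carrier L" using t fc by auto
    then show "t \<sqsubseteq> \<Squnion>(f ` T\<^sub>0)"
      using le_trans[OF conjunct2[OF f[OF t]] sup_upper[OF fc(1) imageI[OF t]]] fc t by auto
  qed (use fc in auto)
  then have "s \<sqsubseteq> \<Squnion>(f ` T\<^sub>0)" using le_trans[OF T\<^sub>0(3)] s fc by simp
  then show "\<exists>A\<^sub>0\<subseteq>A. finite A\<^sub>0 \<and> s \<sqsubseteq> \<Squnion>A\<^sub>0"
    using f T\<^sub>0(2) by (intro exI[of _ "f ` T\<^sub>0"]) auto
qed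

definition ideals :: "'a set set" where
  "ideals = {I. I \<subseteq> S \<and> \<bottom> \<in> I \<and> (\<forall>b\<in>I. \<forall>a\<in>S. a \<sqsubseteq> b \<longrightarrow> a \<in> I) \<and> (\<forall>a\<in>I. \<forall>b\<in>I. a \<squnion> b \<in> I)}"

definition generated_ideal :: "'a set \<Rightarrow> 'a set" where
  "generated_ideal A = {b \<in> S. \<exists>A\<^sub>0\<subseteq>A. finite A\<^sub>0 \<and> b \<sqsubseteq> \<Squnion>A\<^sub>0}"

definition down :: "'a \<Rightarrow> 'a set" where
  "down b = {a \<in> S. a \<sqsubseteq> b}"

abbreviation Idl :: "'a set gorder" where
  "Idl \<equiv> inclusion_order ideals"

lemma ideals_subset: "I \<in> ideals \<Longrightarrow> I \<subseteq> S"
  and ideals_carrier: "I \<in> ideals \<Longrightarrow> I \<subseteq> carrier L"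
  and ideals_bottom: "I \<in> ideals \<Longrightarrow> \<bottom> \<in> I"
  and ideals_down: "I \<in> ideals \<Longrightarrow> b \<in> I \<Longrightarrow> a \<in> S \<Longrightarrow> a \<sqsubseteq> b \<Longrightarrow> a \<in> I"
  and ideals_join: "I \<in> ideals \<Longrightarrow> a \<in> I \<Longrightarrow> b \<in> I \<Longrightarrow> a \<squnion> b \<in> I"
  using basis_subset by (auto simp: ideals_def)

lemma ideals_finite_sup:
  assumes I: "I \<in> ideals" and A: "finite A" "A \<subseteq> I"
  shows "\<Squnion>A \<in> I"
  using A
proof (induction A)
  case empty
  then show ?case using ideals_bottom[OF I] by (simp add: sup_empty)
next
  case (insert a A)
  then show ?case using I ideals_carrier[OF I] ideals_join[OF I, of a "\<Squnion>A"]
    by (subst sup_insert) auto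
qed

lemma generated_ideal_in:
  assumes A: "A \<subseteq> S"
  shows "generated_ideal A \<in> ideals"
proof -
  have Ac: "A \<subseteq> carrier L" using A basis_subset by blast
  have "\<bottom> \<in> generated_ideal A"
    using basis_bottom by (auto simp: generated_ideal_def intro!: exI[of _ "{}"])
  moreover have "a \<in> generated_ideal A" if b: "b \<in> generated_ideal A" and a: "a \<in> S" "a \<sqsubseteq> b" for a b
  proof -
    obtain A\<^sub>0 where A\<^sub>0: "A\<^sub>0 \<subseteq> A" "finite A\<^sub>0" "b \<sqsubseteq> \<Squnion>A\<^sub>0" "b \<in> S"
      using b unfolding generated_ideal_def by blast
    have "a \<sqsubseteq> \<Squnion>A\<^sub>0"
      using le_trans[OF a(2) A\<^sub>0(3)] a A\<^sub>0 Ac basis_carrier by (meson sup_closed subset_trans)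
    then show ?thesis using A\<^sub>0 a unfolding generated_ideal_def by blast
  qed
  moreover have "a \<squnion> b \<in> generated_ideal A" if ab: "a \<in> generated_ideal A" "b \<in> generated_ideal A" for a b
  proof -
    obtain A\<^sub>0 where A\<^sub>0: "A\<^sub>0 \<subseteq> A" "finite A\<^sub>0" "a \<sqsubseteq> \<Squnion>A\<^sub>0" "a \<in> S"
      using ab(1) unfolding generated_ideal_def by blast
    obtain A\<^sub>1 where A\<^sub>1: "A\<^sub>1 \<subseteq> A" "finite A\<^sub>1" "b \<sqsubseteq> \<Squnion>A\<^sub>1" "b \<in> S"
      using ab(2) unfolding generated_ideal_def by blast
    have c: "A\<^sub>0 \<subseteq> carrier L" "A\<^sub>1 \<subseteq> carrier L" using A\<^sub>0(1) A\<^sub>1(1) Ac by auto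
    have "a \<squnion> b \<sqsubseteq> \<Squnion>A\<^sub>0 \<squnion> \<Squnion>A\<^sub>1"
      using A\<^sub>0 A\<^sub>1 c basis_carrier by (intro join_mono) auto
    then have "a \<squnion> b \<sqsubseteq> \<Squnion>(A\<^sub>0 \<union> A\<^sub>1)" using c by (simp add: sup_Un)
    moreover have "A\<^sub>0 \<union> A\<^sub>1 \<subseteq> A" "finite (A\<^sub>0 \<union> A\<^sub>1)" using A\<^sub>0 A\<^sub>1 by auto
    ultimately show ?thesis using basis_join[OF A\<^sub>0(4) A\<^sub>1(4)] unfolding generated_ideal_def by blast
  qed
  moreover have "generated_ideal A \<subseteq> S" by (auto simp: generated_ideal_def)
  ultimately show ?thesis unfolding ideals_def by blast
qed

lemma generated_ideal_upper:
  assumes "A \<subseteq> S"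
  shows "A \<subseteq> generated_ideal A"
proof
  fix a assume "a \<in> A"
  then have "a \<in> S" "{a} \<subseteq> A" "a \<sqsubseteq> \<Squnion>{a}" using assms basis_carrier by auto
  then show "a \<in> generated_ideal A" unfolding generated_ideal_def by blast
qed

lemma generated_ideal_least:
  assumes "I \<in> ideals" "A \<subseteq> I"
  shows "generated_ideal A \<subseteq> I"
  using assms ideals_down ideals_finite_sup unfolding generated_ideal_def by blast

lemma sup_generated_ideal:
  assumes A: "A \<subseteq> S"
  shows "\<Squnion>(generated_ideal A) = \<Squnion>A"
proof (rule sup_eqI)
  have Ac: "A \<subseteq> carrier L" using A basis_subset by blast
  show gc: "generated_ideal A \<subseteq> carrier L" using basis_subset by (auto simp: generated_ideal_def)
  show "\<Squnion>A \<in> carrier L" using Ac by simp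
  show "x \<sqsubseteq> \<Squnion>A" if x: "x \<in> generated_ideal A" for x
  proof -
    obtain A\<^sub>0 where A\<^sub>0: "A\<^sub>0 \<subseteq> A" "x \<sqsubseteq> \<Squnion>A\<^sub>0" using x unfolding generated_ideal_def by blast
    show ?thesis
      using le_trans[OF A\<^sub>0(2) sup_mono[OF A\<^sub>0(1) Ac]] x gc A\<^sub>0 Ac by (auto simp: subset_iff)
  qed
  show "\<Squnion>A \<sqsubseteq> y" if "y \<in> carrier L" "\<And>x. x \<in> generated_ideal A \<Longrightarrow> x \<sqsubseteq> y" for y
    using that generated_ideal_upper[OF A] Ac by (intro sup_least) auto
qed

lemma down_in: "b \<in> carrier L \<Longrightarrow> down b \<in> ideals"
  unfolding ideals_def down_def
  by (auto simp: basis_bottom basis_join basis_carrier bottom_lower join_le dest: le_trans)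

lemma sup_down: "b \<in> carrier L \<Longrightarrow> \<Squnion>(down b) = b"
  unfolding down_def by (rule sup_basis_below)

lemma down_Int:
  "a \<in> S \<Longrightarrow> b \<in> S \<Longrightarrow> down a \<inter> down b = down (a \<sqinter> b)"
  unfolding down_def
  by (auto simp: basis_carrier meet_le dest: le_trans[OF _ meet_left] le_trans[OF _ meet_right])

lemma ideals_Inter: "D \<subseteq> ideals \<Longrightarrow> D \<noteq> {} \<Longrightarrow> \<Inter>D \<in> ideals"
  unfolding ideals_def by (intro CollectI conjI ballI impI; blast)

lemma ideals_Int: "I \<in> ideals \<Longrightarrow> J \<in> ideals \<Longrightarrow> I \<inter> J \<in> ideals"
  unfolding ideals_def by blast

lemma basis_in_ideals: "S \<in> ideals"
  unfolding ideals_def using basis_bottom basis_join by blast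

lemma ideal_frame_meet: "I \<in> ideals \<Longrightarrow> J \<in> ideals \<Longrightarrow> I \<sqinter>\<^bsub>Idl\<^esub> J = I \<inter> J"
  by (intro inclusion_order_meet_eq_Int ideals_Int)

lemma ideal_frame_sup:
  assumes D: "D \<subseteq> ideals"
  shows "\<Squnion>\<^bsub>Idl\<^esub>D = generated_ideal (\<Union>D)"
proof (rule partial_order.sup_eqI[OF partial_order_inclusion_order])
  have sub: "\<Union>D \<subseteq> S" using D ideals_subset by blast
  show "generated_ideal (\<Union>D) \<in> carrier Idl" using generated_ideal_in[OF sub] by simp
  show "x \<sqsubseteq>\<^bsub>Idl\<^esub> generated_ideal (\<Union>D)" if "x \<in> D" for x
    using that generated_ideal_upper[OF sub] by auto
  show "generated_ideal (\<Union>D) \<sqsubseteq>\<^bsub>Idl\<^esub> y"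
    if "y \<in> carrier Idl" "\<And>x. x \<in> D \<Longrightarrow> x \<sqsubseteq>\<^bsub>Idl\<^esub> y" for y
    using that generated_ideal_least[of y "\<Union>D"] by auto
qed (use D in simp)

lemma ideal_frame_top: "\<top>\<^bsub>Idl\<^esub> = S"
  by (rule inclusion_order_top[OF basis_in_ideals ideals_subset])

lemma ideal_frame_bottom: "\<bottom>\<^bsub>Idl\<^esub> = {\<bottom>}"
proof (rule inclusion_order_bottom)
  have "down \<bottom> = {\<bottom>}"
    unfolding down_def using basis_bottom basis_carrier bottom_lower le_antisym by force
  then show "{\<bottom>} \<in> ideals" using down_in[OF bottom_closed] by simp
qed (use ideals_bottom in auto)

text \<open>
  If \<open>b \<in> I\<close> lies below a finite join of members of the ideals in \<open>D\<close>, then distributivity of \<open>L\<close>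
  writes \<open>b\<close> as a join of members of the ideals \<open>I \<inter> J\<close>.
\<close>

lemma frame_ideal_frame: "frame Idl"
proof -
  interpret Idl: complete_lattice Idl
    by (rule closure_system_complete_lattice[OF basis_in_ideals ideals_subset ideals_Inter])
  show ?thesis
  proof (unfold_locales, unfold inclusion_order_simps)
    fix I D assume I: "I \<in> ideals" and D: "D \<subseteq> ideals"
    have eq: "(\<lambda>J. I \<sqinter>\<^bsub>Idl\<^esub> J) ` D = (\<lambda>J. I \<inter> J) ` D"
      using I D by (intro image_cong refl ideal_frame_meet) auto
    have ID: "(\<lambda>J. I \<inter> J) ` D \<subseteq> ideals" using I D ideals_Int by blast
    have subD: "\<Union>D \<subseteq> S" and subID: "\<Union>((\<lambda>J. I \<inter> J) ` D) \<subseteq> S" using D ID ideals_subset by blast+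
    have "I \<inter> generated_ideal (\<Union>D) = generated_ideal (\<Union>((\<lambda>J. I \<inter> J) ` D))"
    proof
      show "I \<inter> generated_ideal (\<Union>D) \<subseteq> generated_ideal (\<Union>((\<lambda>J. I \<inter> J) ` D))"
      proof
        fix b assume b: "b \<in> I \<inter> generated_ideal (\<Union>D)"
        then obtain A where A: "A \<subseteq> \<Union>D" "finite A" "b \<sqsubseteq> \<Squnion>A" unfolding generated_ideal_def by blast
        have bS: "b \<in> S" "b \<in> carrier L" using b I ideals_subset basis_carrier by blast+
        have Ac: "A \<subseteq> carrier L" using A(1) subD basis_subset by blast
        have "b = b \<sqinter> \<Squnion>A" using A(3) Ac bS meet_absorb by simp
        also have "\<dots> = \<Squnion>((\<lambda>a. b \<sqinter> a) ` A)" using bS Ac by (intro frame_distrib)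
        finally have "b = \<Squnion>((\<lambda>a. b \<sqinter> a) ` A)" .
        then have "b \<sqsubseteq> \<Squnion>((\<lambda>a. b \<sqinter> a) ` A)"
          using arg_cong[of b _ "\<lambda>z. b \<sqsubseteq> z"] bS(2) by simp
        moreover have "(\<lambda>a. b \<sqinter> a) ` A \<subseteq> \<Union>((\<lambda>J. I \<inter> J) ` D)"
        proof
          fix x assume "x \<in> (\<lambda>a. b \<sqinter> a) ` A"
          then obtain a J where aJ: "a \<in> A" "x = b \<sqinter> a" "J \<in> D" "a \<in> J" using A(1) by blast
          have aS: "a \<in> S" "a \<in> carrier L" using aJ A(1) subD basis_carrier by blast+
          have x: "x \<in> S" "x \<sqsubseteq> b" "x \<sqsubseteq> a"
            using bS aS aJ(2) basis_meet meet_left meet_right by auto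
          have "x \<in> I" using ideals_down[OF I _ x(1,2)] b by blast
          moreover have "x \<in> J" using ideals_down[OF _ aJ(4) x(1,3)] aJ(3) D by blast
          ultimately show "x \<in> \<Union>((\<lambda>J. I \<inter> J) ` D)" using aJ(3) by blast
        qed
        ultimately show "b \<in> generated_ideal (\<Union>((\<lambda>J. I \<inter> J) ` D))"
          using A(2) bS(1) unfolding generated_ideal_def by blast
      qed
      show "generated_ideal (\<Union>((\<lambda>J. I \<inter> J) ` D)) \<subseteq> I \<inter> generated_ideal (\<Union>D)"
        using generated_ideal_upper[OF subD]
        by (intro generated_ideal_least ideals_Int generated_ideal_in I subD) auto
    qed
    then show "I \<sqinter>\<^bsub>Idl\<^esub> \<Squnion>\<^bsub>Idl\<^esub>D = \<Squnion>\<^bsub>Idl\<^esub>((\<lambda>J. I \<sqinter>\<^bsub>Idl\<^esub> J) ` D)"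
      unfolding eq using ID D I generated_ideal_in[OF subD]
      by (simp add: ideal_frame_sup ideal_frame_meet)
  qed
qed

lemma down_join:
  assumes ab: "a \<in> S" "b \<in> S"
  shows "down a \<squnion>\<^bsub>Idl\<^esub> down b = down (a \<squnion> b)"
proof -
  have c: "a \<in> carrier L" "b \<in> carrier L" using ab basis_carrier by auto
  have D: "{down a, down b} \<subseteq> ideals" using c down_in by simp
  have sub: "down a \<union> down b \<subseteq> S" by (auto simp: down_def)
  have "generated_ideal (down a \<union> down b) = down (a \<squnion> b)"
  proof
    show "generated_ideal (down a \<union> down b) \<subseteq> down (a \<squnion> b)"
    proof (rule generated_ideal_least)
      show "down a \<union> down b \<subseteq> down (a \<squnion> b)"
        using c basis_carrier le_trans[OF _ join_left] le_trans[OF _ join_right]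
        by (auto simp: down_def)
    qed (use c down_in in simp)
    have "a \<in> down a" "b \<in> down b" using ab c by (auto simp: down_def)
    then have "a \<squnion> b \<in> generated_ideal (down a \<union> down b)"
      using generated_ideal_upper[OF sub] by (intro ideals_join[OF generated_ideal_in[OF sub]]) auto
    then show "down (a \<squnion> b) \<subseteq> generated_ideal (down a \<union> down b)"
      using ideals_down[OF generated_ideal_in[OF sub]] by (auto simp: down_def)
  qed
  then show ?thesis using ideal_frame_sup[OF D] by (simp add: join_def)
qed

lemma frith_ideal_frame: "frith Idl (down ` S)"
proof (intro frith.intro frame_ideal_frame frith_axioms.intro)
  have "down \<bottom> = \<bottom>\<^bsub>Idl\<^esub>"
    unfolding down_def ideal_frame_bottom
    using basis_bottom basis_carrier bottom_lower le_antisym by force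
  moreover have "down \<top> = \<top>\<^bsub>Idl\<^esub>"
    unfolding down_def ideal_frame_top using basis_carrier top_higher by auto
  ultimately show "bounded_sublattice Idl (down ` S)"
    unfolding bounded_sublattice_def sublattice_def
    using basis_bottom basis_top imageI[of _ S down]
    by (auto simp: ideal_frame_meet down_join down_Int down_in
        basis_carrier basis_meet basis_join)
  fix I assume I: "I \<in> carrier Idl"
  have sub: "down ` I \<subseteq> ideals" using I ideals_carrier down_in by auto
  have "\<Union>(down ` I) = I"
    using I ideals_down[of I] ideals_subset[of I] basis_carrier by (fastforce simp: down_def)
  then have "I = \<Squnion>\<^bsub>Idl\<^esub>(down ` I)"
    using ideal_frame_sup[OF sub] generated_ideal_upper[of I] generated_ideal_least[of I I] I ideals_subset
    by auto
  then show "\<exists>A\<subseteq>down ` S. I = \<Squnion>\<^bsub>Idl\<^esub>A"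
    using I ideals_subset by (intro exI[of _ "down ` I"]) auto
qed

text \<open>
  Joining up an ideal maps the ideal frame onto \<open>L\<close>. This is the comparison that completeness
  tests.
\<close>

definition ideal_sup :: "'a set \<Rightarrow> 'a" where
  "ideal_sup = (\<lambda>I\<in>ideals. \<Squnion>I)"

lemma ideal_sup_frame_hom: "ideal_sup \<in> frame_hom Idl L"
  unfolding frame_hom_def mem_Collect_eq inclusion_order_simps
proof (intro conjI ballI allI impI)
  show "ideal_sup \<in> ideals \<rightarrow>\<^sub>E carrier L" using ideals_carrier by (auto simp: ideal_sup_def)
  have "\<Squnion>S = \<top>" using sup_upper[OF basis_subset basis_top] basis_subset top_higher le_antisym by simp
  then show "ideal_sup \<top>\<^bsub>Idl\<^esub> = \<top>"
    by (simp add: ideal_frame_top ideal_sup_def basis_in_ideals)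
  fix I J assume I: "I \<in> ideals" and J: "J \<in> ideals"
  have "\<Squnion>I \<sqinter> \<Squnion>J = \<Squnion>{a \<sqinter> b | a b. a \<in> I \<and> b \<in> J}"
    using I J ideals_carrier by (intro sup_meet_sup)
  also have "{a \<sqinter> b | a b. a \<in> I \<and> b \<in> J} = I \<inter> J"
  proof
    show "{a \<sqinter> b | a b. a \<in> I \<and> b \<in> J} \<subseteq> I \<inter> J"
    proof
      fix x assume "x \<in> {a \<sqinter> b | a b. a \<in> I \<and> b \<in> J}"
      then obtain a b where ab: "a \<in> I" "b \<in> J" "x = a \<sqinter> b" by blast
      then have "a \<in> S" "b \<in> S" using I J ideals_subset by blast+
      then have "a \<sqinter> b \<in> S" "a \<sqinter> b \<sqsubseteq> a" "a \<sqinter> b \<sqsubseteq> b"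
        using basis_carrier basis_meet meet_left meet_right by auto
      then show "x \<in> I \<inter> J" using ab I J ideals_down by blast
    qed
    show "I \<inter> J \<subseteq> {a \<sqinter> b | a b. a \<in> I \<and> b \<in> J}"
    proof
      fix x assume x: "x \<in> I \<inter> J"
      then have "x = x \<sqinter> x" using ideals_carrier[OF I] meet_absorb[of x x] by auto
      then show "x \<in> {a \<sqinter> b | a b. a \<in> I \<and> b \<in> J}" using x by blast
    qed
  qed
  finally show "ideal_sup (I \<sqinter>\<^bsub>Idl\<^esub> J) = ideal_sup I \<sqinter> ideal_sup J"
    using I J by (simp add: ideal_sup_def ideal_frame_meet ideals_Int)
next
  fix D assume D: "D \<subseteq> ideals"
  have sub: "\<Union>D \<subseteq> S" and subc: "\<Union>D \<subseteq> carrier L" using D ideals_subset basis_subset by blast+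
  have img: "ideal_sup ` D = (\<lambda>I. \<Squnion>I) ` D" using D by (intro image_cong refl) (auto simp: ideal_sup_def)
  have "\<Squnion>(\<Union>D) = \<Squnion>((\<lambda>I. \<Squnion>I) ` D)"
  proof (rule sup_eqI)
    show "\<Squnion>((\<lambda>I. \<Squnion>I) ` D) \<in> carrier L" using D ideals_carrier by (intro sup_closed) auto
    have Dc: "(\<lambda>I. \<Squnion>I) ` D \<subseteq> carrier L" using D ideals_carrier by auto
    show "x \<sqsubseteq> \<Squnion>((\<lambda>I. \<Squnion>I) ` D)" if x: "x \<in> \<Union>D" for x
    proof -
      obtain I where I: "I \<in> D" "x \<in> I" using x by blast
      then have Ic: "I \<subseteq> carrier L" using D ideals_carrier by blast
      show ?thesis
        using le_trans[OF sup_upper[OF Ic I(2)] sup_upper[OF Dc imageI[OF I(1)]]] Ic I(2) Dc by auto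
    qed
    show "\<Squnion>((\<lambda>I. \<Squnion>I) ` D) \<sqsubseteq> y" if y: "y \<in> carrier L" "\<And>x. x \<in> \<Union>D \<Longrightarrow> x \<sqsubseteq> y" for y
    proof (rule sup_least[OF Dc y(1)])
      fix z assume "z \<in> (\<lambda>I. \<Squnion>I) ` D"
      then obtain I where I: "I \<in> D" "z = \<Squnion>I" by blast
      then have "I \<subseteq> carrier L" using D ideals_carrier by blast
      then show "z \<sqsubseteq> y" using sup_least[of I y] y I by blast
    qed
  qed (rule subc)
  then show "ideal_sup (\<Squnion>\<^bsub>Idl\<^esub>D) = \<Squnion>(ideal_sup ` D)"
    using D sub by (simp add: ideal_frame_sup img) (simp add: ideal_sup_def generated_ideal_in sup_generated_ideal)
qed

lemma ideal_sup_principal: "ideal_sup ` down ` S = S"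
proof -
  have "ideal_sup (down b) = b" if "b \<in> S" for b
    using basis_carrier[OF that] by (simp add: ideal_sup_def down_in sup_down)
  then show ?thesis by (simp add: image_image)
qed

lemma ideal_sup_dense: "frith_dense (Idl, down ` S) (L, S) ideal_sup"
proof -
  have "I = {\<bottom>}" if I: "I \<in> ideals" "\<Squnion>I = \<bottom>" for I
  proof -
    have "x = \<bottom>" if "x \<in> I" for x
    proof -
      have "x \<in> carrier L" using I(1) that ideals_carrier by blast
      then show ?thesis using sup_upper[OF ideals_carrier[OF I(1)] that] I(2) bottom_lower le_antisym by simp
    qed
    then show ?thesis using ideals_bottom[OF I(1)] by blast
  qed
  then show ?thesis by (simp add: frith_dense_def ideal_sup_def ideal_frame_bottom)
qed

text \<open>
  If joins of ideals determine the ideals, then \<open>s \<le> \<Squnion>B\<close> makes the ideal generated by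
  \<open>B\<close> contain \<open>s\<close>, and membership in a generated ideal is witnessed by
  finitely many generators.
\<close>

lemma compact_basis_if_ideal_sup_inj:
  assumes inj: "inj_on ideal_sup ideals" and s: "s \<in> S"
  shows "compact_in L s"
proof (rule compact_inI_basis)
  show sc: "s \<in> carrier L" using basis_carrier[OF s] .
  fix B assume B: "B \<subseteq> S" and le: "s \<sqsubseteq> \<Squnion>B"
  have Bc: "B \<subseteq> carrier L" using B basis_subset by blast
  have g: "generated_ideal B \<in> ideals" by (rule generated_ideal_in[OF B])
  have p: "down s \<in> ideals" by (rule down_in[OF sc])
  have "ideal_sup (generated_ideal B \<sqinter>\<^bsub>Idl\<^esub> down s) =
      ideal_sup (generated_ideal B) \<sqinter> ideal_sup (down s)"
    using g p by (intro frame_hom_meet[OF ideal_sup_frame_hom]) auto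
  also have "\<dots> = \<Squnion>B \<sqinter> s"
    using g p sc by (simp add: ideal_sup_def sup_generated_ideal[OF B] sup_down)
  also have "\<dots> = ideal_sup (down s)"
    using p sc Bc le by (simp add: ideal_sup_def sup_down meet_absorb2)
  finally have "ideal_sup (generated_ideal B \<inter> down s) = ideal_sup (down s)"
    using g p by (simp add: ideal_frame_meet)
  then have "generated_ideal B \<inter> down s = down s"
    using inj_onD[OF inj] ideals_Int[OF g p] p by blast
  then have "s \<in> generated_ideal B" using s sc by (auto simp: down_def)
  then show "\<exists>B\<^sub>0\<subseteq>B. finite B\<^sub>0 \<and> s \<sqsubseteq> \<Squnion>B\<^sub>0" unfolding generated_ideal_def by blast
qed

end

locale symmetric_frith = frith +
  assumes complement: "s \<in> S \<Longrightarrow> \<exists>t\<in>S. s \<sqinter> t = \<bottom> \<and> s \<squnion> t = \<top>"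

lemma symmetric_frith_frame_iff: "symmetric_frith_frame (L, S) \<longleftrightarrow> symmetric_frith L S"
  by (auto simp: symmetric_frith_frame_def frith_frame_iff symmetric_frith_def symmetric_frith_axioms_def)

lemma (in symmetric_frith) symmetric_ideal_frame: "symmetric_frith Idl (down ` S)"
proof (intro symmetric_frith.intro frith_ideal_frame symmetric_frith_axioms.intro)
  fix I assume "I \<in> down ` S"
  then obtain s where s: "s \<in> S" "I = down s" by blast
  obtain t where t: "t \<in> S" "s \<sqinter> t = \<bottom>" "s \<squnion> t = \<top>" using complement[OF s(1)] by blast
  have "down \<bottom> = {\<bottom>}"
    unfolding down_def using basis_bottom basis_carrier bottom_lower le_antisym by force
  then have "I \<sqinter>\<^bsub>Idl\<^esub> down t = \<bottom>\<^bsub>Idl\<^esub>"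
    using s t basis_carrier
    by (simp add: ideal_frame_meet down_in down_Int ideal_frame_bottom)
  moreover have "down \<top> = S" unfolding down_def using basis_carrier top_higher by auto
  then have "I \<squnion>\<^bsub>Idl\<^esub> down t = \<top>\<^bsub>Idl\<^esub>"
    using s t by (simp add: down_join ideal_frame_top)
  ultimately show "\<exists>t\<in>down ` S.
      I \<sqinter>\<^bsub>Idl\<^esub> t = \<bottom>\<^bsub>Idl\<^esub> \<and> I \<squnion>\<^bsub>Idl\<^esub> t = \<top>\<^bsub>Idl\<^esub>"
    using t(1) by blast
qed

text \<open>
  Completeness applies to the comparison with the ideal frame, since complements make the principal
  ideals a Boolean algebra.
\<close>

theorem (in symmetric_frith) symmetric_complete_imp_compact_basis:
  assumes complete: "symmetric_frith_complete (L, S)" and s: "s \<in> S"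
  shows "compact_in L s"
proof -
  have "frith_extremal_epi (Idl, down ` S) (L, S) ideal_sup"
    using ideal_sup_frame_hom ideal_sup_principal by (simp add: frith_extremal_epi_def frith_hom_def)
  then have "frith_iso (Idl, down ` S) (L, S) ideal_sup"
    using complete[unfolded symmetric_frith_complete_def symmetric_frith_complete_wrt_def]
      symmetric_ideal_frame ideal_sup_dense
    by (simp add: symmetric_frith_frame_iff)
  then obtain k where k: "frith_comp (Idl, down ` S) k ideal_sup =
      frith_id (Idl, down ` S)"
    unfolding frith_iso_def by blast
  have "k (ideal_sup I) = I" if "I \<in> ideals" for I
    using fun_cong[OF k, of I] that by (simp add: frith_comp_def frith_id_def compose_def)
  then have "inj_on ideal_sup ideals" by (rule inj_on_inverseI)
  then show ?thesis using s by (rule compact_basis_if_ideal_sup_inj)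
qed

text \<open>
  A dense homomorphism is injective on complemented elements; compactness extends this to joins of
  such elements.
\<close>

theorem (in frith) compact_basis_imp_complete_wrt:
  assumes compact: "\<And>s. s \<in> S \<Longrightarrow> compact_in L s"
  shows "symmetric_frith_complete_wrt TYPE('b) (L, S)"
  unfolding symmetric_frith_complete_wrt_def
proof (intro allI impI, elim conjE)
  fix G :: "'b frith" and h
  assume G: "symmetric_frith_frame G" "frith_extremal_epi G (L, S) h" "frith_dense G (L, S) h"
  obtain M C where GM: "G = (M, C)" by (rule prod.exhaust)
  interpret M: symmetric_frith M C using G(1) by (simp add: GM symmetric_frith_frame_iff)
  have h: "h \<in> frame_hom M L" "h ` C = S"
    using G(2) by (auto simp: GM frith_extremal_epi_def frith_hom_def)
  have frames: "frame M" "frame L" by unfold_locales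
  note hc = frame_hom_closed[OF h(1)] and h_mono = frame_hom_mono[OF frames h(1)]
  have reflect_C: "a \<sqsubseteq>\<^bsub>M\<^esub> b" if ab: "a \<in> C" "b \<in> C" "h a \<sqsubseteq> h b" for a b
  proof -
    obtain b' where b': "b' \<in> C" "b \<sqinter>\<^bsub>M\<^esub> b' = \<bottom>\<^bsub>M\<^esub>" "b \<squnion>\<^bsub>M\<^esub> b' = \<top>\<^bsub>M\<^esub>"
      using M.complement[OF ab(2)] by blast
    have m: "a \<in> carrier M" "b \<in> carrier M" "b' \<in> carrier M" using ab b' M.basis_carrier by auto
    have "h (a \<sqinter>\<^bsub>M\<^esub> b') = h a \<sqinter> h b'" using m by (intro frame_hom_meet[OF h(1)])
    also have "\<dots> \<sqsubseteq> h b \<sqinter> h b'" using ab(3) m hc by (intro meet_mono) auto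
    also have "h b \<sqinter> h b' = \<bottom>"
      using m b'(2) frame_hom_meet[OF h(1), of b b'] frame_hom_bottom[OF frames h(1)] by simp
    finally have "h (a \<sqinter>\<^bsub>M\<^esub> b') = \<bottom>" using m hc bottom_lower le_antisym by simp
    then have "a \<sqinter>\<^bsub>M\<^esub> b' = \<bottom>\<^bsub>M\<^esub>" using G(3) m by (simp add: frith_dense_def GM)
    then show ?thesis using m b'(3) by (intro M.le_if_meet_complement_bottom[of a b b'])
  qed
  have reflect: "x \<sqsubseteq>\<^bsub>M\<^esub> y" if xy: "x \<in> carrier M" "y \<in> carrier M" "h x \<sqsubseteq> h y" for x y
  proof (rule M.le_via_basis[OF xy(1,2)])
    fix a assume a: "a \<in> C" "a \<sqsubseteq>\<^bsub>M\<^esub> x"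
    have ac: "a \<in> carrier M" using a M.basis_carrier by blast
    define Cy where "Cy = {c \<in> C. c \<sqsubseteq>\<^bsub>M\<^esub> y}"
    have Cy: "Cy \<subseteq> C" "Cy \<subseteq> carrier M" using M.basis_subset by (auto simp: Cy_def)
    have hCy: "h ` Cy \<subseteq> carrier L" using Cy hc by auto
    have "h a \<sqsubseteq> h y" using le_trans[OF h_mono[OF ac xy(1) a(2)] xy(3)] ac xy hc by simp
    also have "h y = \<Squnion>(h ` Cy)"
      using frame_hom_sup[OF h(1) Cy(2)] M.sup_basis_below[OF xy(2)] by (simp add: Cy_def)
    finally have le: "h a \<sqsubseteq> \<Squnion>(h ` Cy)" .
    have "compact_in L (h a)" using compact[of "h a"] a(1) h(2) by blast
    then obtain D where D: "D \<subseteq> h ` Cy" "finite D" "h a \<sqsubseteq> \<Squnion>D"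
      by (rule compact_inE[OF _ hCy le])
    then obtain E where E: "E \<subseteq> Cy" "finite E" "D = h ` E" using finite_subset_image[OF D(2,1)] by blast
    have Ec: "E \<subseteq> C" "E \<subseteq> carrier M" using E Cy by auto
    have "h a \<sqsubseteq> h (\<Squnion>\<^bsub>M\<^esub>E)" using D(3) E(3) frame_hom_sup[OF h(1) Ec(2)] by simp
    then have "a \<sqsubseteq>\<^bsub>M\<^esub> \<Squnion>\<^bsub>M\<^esub>E" using a(1) M.finite_sup_in_basis[OF E(2) Ec(1)] by (intro reflect_C)
    moreover have "\<Squnion>\<^bsub>M\<^esub>E \<sqsubseteq>\<^bsub>M\<^esub> y"
      using E(1) xy(2) Ec by (intro M.sup_least) (auto simp: Cy_def)
    ultimately show "a \<sqsubseteq>\<^bsub>M\<^esub> y" using M.le_trans[of a "\<Squnion>\<^bsub>M\<^esub>E" y] ac Ec xy by simp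
  qed
  have "bij_betw h (carrier M) (carrier L)"
    unfolding bij_betw_def
  proof
    show "inj_on h (carrier M)"
    proof (rule inj_onI)
      fix x y assume "x \<in> carrier M" "y \<in> carrier M" "h x = h y"
      then show "x = y" using reflect[of x y] reflect[of y x] hc by (intro M.le_antisym) auto
    qed
    show "h ` carrier M = carrier L"
    proof
      show "carrier L \<subseteq> h ` carrier M"
      proof
        fix z assume "z \<in> carrier L"
        then obtain A where A: "A \<subseteq> h ` C" "z = \<Squnion>A" using joins_of_basis h(2) by blast
        then obtain E where E: "E \<subseteq> C" "A = h ` E" by (auto simp: subset_image_iff)
        have Ec: "E \<subseteq> carrier M" using E M.basis_subset by auto
        then show "z \<in> h ` carrier M"
          using A(2) E(2) frame_hom_sup[OF h(1) Ec] by (metis M.sup_closed imageI)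
      qed
    qed (use hc in auto)
  qed
  then show "frith_iso G (L, S) h"
    using G(2) h(2) M.basis_subset frames
    by (intro bij_frith_iso) (auto simp: GM frith_extremal_epi_def)
qed

section \<open>The frame of congruences\<close>

text \<open>Congruence frames are defined for orders without further record fields only.\<close>

locale frame_congruences = frame L for L :: "'a gorder" (structure)
begin

abbreviation congruences :: "('a \<times> 'a) set set" where
  "congruences \<equiv> {r. frame_congruence L r}"

lemma congruence_frame_eq: "congruence_frame L = inclusion_order congruences"
  by (simp add: congruence_frame_def inclusion_order_def)

text \<open>
  Directed unions of frame congruences are in general no longer closed under infinite joins; what
  survives is closure under the lattice operations.
\<close>

definition lattice_congruence :: "('a \<times> 'a) set \<Rightarrow> bool" where
  "lattice_congruence r \<longleftrightarrow> equiv (carrier L) r \<and>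
     (\<forall>(x, y)\<in>r. \<forall>(x', y')\<in>r. (x \<sqinter> x', y \<sqinter> y') \<in> r \<and> (x \<squnion> x', y \<squnion> y') \<in> r)"

lemma frame_congruence_sup:
  "frame_congruence L r \<Longrightarrow> R \<subseteq> r \<Longrightarrow> (\<Squnion>(fst ` R), \<Squnion>(snd ` R)) \<in> r"
  by (auto simp: frame_congruence_def)

lemma lattice_congruence_if_frame:
  assumes r: "frame_congruence L r"
  shows "lattice_congruence r"
proof -
  have "(x \<squnion> x', y \<squnion> y') \<in> r" if "(x, y) \<in> r" "(x', y') \<in> r" for x y x' y'
    using frame_congruence_sup[OF r, of "{(x, y), (x', y')}"] that by (simp add: join_def)
  then show ?thesis using r unfolding lattice_congruence_def frame_congruence_def by blast
qed

lemma
  assumes "lattice_congruence r"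
  shows congruence_subset: "r \<subseteq> carrier L \<times> carrier L"
    and congruence_refl: "x \<in> carrier L \<Longrightarrow> (x, x) \<in> r"
    and congruence_sym: "(x, y) \<in> r \<Longrightarrow> (y, x) \<in> r"
    and congruence_trans: "(x, y) \<in> r \<Longrightarrow> (y, z) \<in> r \<Longrightarrow> (x, z) \<in> r"
    and congruence_meet: "(x, y) \<in> r \<Longrightarrow> (x', y') \<in> r \<Longrightarrow> (x \<sqinter> x', y \<sqinter> y') \<in> r"
    and congruence_join: "(x, y) \<in> r \<Longrightarrow> (x', y') \<in> r \<Longrightarrow> (x \<squnion> x', y \<squnion> y') \<in> r"
  using assms unfolding lattice_congruence_def equiv_def
  by (auto simp: refl_on_def dest: symD transD)

lemma congruence_carrier:
  assumes "lattice_congruence r" "(x, y) \<in> r"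
  shows "x \<in> carrier L" "y \<in> carrier L"
  using congruence_subset[OF assms(1)] assms(2) by auto

text \<open>Congruence classes are convex.\<close>

lemma congruence_sandwich:
  assumes e: "lattice_congruence e" and "(w, z) \<in> e" "z \<sqsubseteq> m" "m \<sqsubseteq> w" "m \<in> carrier L"
  shows "(w, m) \<in> e"
proof -
  have "w \<in> carrier L" "z \<in> carrier L" using congruence_carrier[OF e assms(2)] .
  then show ?thesis
    using congruence_join[OF e assms(2) congruence_refl[OF e assms(5)]] assms
    by (simp add: join_absorb join_absorb2)
qed

lemma frame_congruenceI:
  assumes "r \<subseteq> carrier L \<times> carrier L" "\<And>x. x \<in> carrier L \<Longrightarrow> (x, x) \<in> r"
    "\<And>x y. (x, y) \<in> r \<Longrightarrow> (y, x) \<in> r" "\<And>x y z. (x, y) \<in> r \<Longrightarrow> (y, z) \<in> r \<Longrightarrow> (x, z) \<in> r"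
    "\<And>x y x' y'. (x, y) \<in> r \<Longrightarrow> (x', y') \<in> r \<Longrightarrow> (x \<sqinter> x', y \<sqinter> y') \<in> r"
    "\<And>R. R \<subseteq> r \<Longrightarrow> (\<Squnion>(fst ` R), \<Squnion>(snd ` R)) \<in> r"
  shows "frame_congruence L r"
proof -
  have "sym r" "trans r" using assms(3) by (auto intro: symI) (use assms(4) in \<open>blast intro: transI\<close>)
  then have "equiv (carrier L) r" using assms(1,2) by (auto simp: equiv_def refl_on_def)
  then show ?thesis using assms(5,6) unfolding frame_congruence_def by blast
qed

text \<open>
  The maps \<open>x \<mapsto> a \<sqinter> x\<close> and \<open>x \<mapsto> a \<squnion> x\<close> preserve binary meets and nonempty joins. Hence
  preimages of congruences under them are congruences; those of the equality relation are
  \<open>delta\<close> and \<open>nabla\<close>. The constant \<open>c\<close> is the value at the empty join.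
\<close>

lemma frame_congruence_preimage:
  assumes r: "frame_congruence L r" and c: "c \<in> carrier L"
    and f: "\<And>x. x \<in> carrier L \<Longrightarrow> f x \<in> carrier L"
    and f_meet: "\<And>x y. x \<in> carrier L \<Longrightarrow> y \<in> carrier L \<Longrightarrow> f (x \<sqinter> y) = f x \<sqinter> f y"
    and f_sup: "\<And>A. A \<subseteq> carrier L \<Longrightarrow> f (\<Squnion>A) = \<Squnion>(insert c (f ` A))"
  shows "frame_congruence L {(x, y). x \<in> carrier L \<and> y \<in> carrier L \<and> (f x, f y) \<in> r}"
    (is "frame_congruence L ?r")
proof (rule frame_congruenceI)
  note lr = lattice_congruence_if_frame[OF r]
  show "?r \<subseteq> carrier L \<times> carrier L" by auto
  show "(x, x) \<in> ?r" if "x \<in> carrier L" for x using that f congruence_refl[OF lr] by auto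
  show "(y, x) \<in> ?r" if "(x, y) \<in> ?r" for x y using that congruence_sym[OF lr] by auto
  show "(x, z) \<in> ?r" if "(x, y) \<in> ?r" "(y, z) \<in> ?r" for x y z
    using that congruence_trans[OF lr] by auto
  show "(x \<sqinter> x', y \<sqinter> y') \<in> ?r" if "(x, y) \<in> ?r" "(x', y') \<in> ?r" for x y x' y'
    using that congruence_meet[OF lr] by (auto simp: f_meet)
  show "(\<Squnion>(fst ` R), \<Squnion>(snd ` R)) \<in> ?r" if R: "R \<subseteq> ?r" for R
  proof -
    have Rc: "fst ` R \<subseteq> carrier L" "snd ` R \<subseteq> carrier L" using R by auto
    let ?R = "insert (c, c) ((\<lambda>p. (f (fst p), f (snd p))) ` R)"
    have "?R \<subseteq> r" using R congruence_refl[OF lr c] by auto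
    then have "(\<Squnion>(fst ` ?R), \<Squnion>(snd ` ?R)) \<in> r" by (rule frame_congruence_sup[OF r])
    then have "(\<Squnion>(insert c (f ` fst ` R)), \<Squnion>(insert c (f ` snd ` R))) \<in> r"
      by (simp add: image_image)
    then show ?thesis using Rc by (simp add: f_sup)
  qed
qed

text \<open>
  The right adjoints of meeting with \<open>nabla a\<close> and with \<open>delta a\<close>, that is, the implications
  from these congruences in the lattice of congruences.
\<close>

definition nabla_imp :: "'a \<Rightarrow> ('a \<times> 'a) set \<Rightarrow> ('a \<times> 'a) set" where
  "nabla_imp a r = {(x, y). x \<in> carrier L \<and> y \<in> carrier L \<and> (a \<sqinter> x, a \<sqinter> y) \<in> r}"

definition delta_imp :: "'a \<Rightarrow> ('a \<times> 'a) set \<Rightarrow> ('a \<times> 'a) set" where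
  "delta_imp a r = {(x, y). x \<in> carrier L \<and> y \<in> carrier L \<and> (a \<squnion> x, a \<squnion> y) \<in> r}"

lemma congruence_Id: "frame_congruence L (Id_on (carrier L))"
proof (rule frame_congruenceI)
  show "(\<Squnion>(fst ` R), \<Squnion>(snd ` R)) \<in> Id_on (carrier L)" if "R \<subseteq> Id_on (carrier L)" for R
  proof -
    have "fst ` R = snd ` R" using that by (intro image_cong refl) (auto simp: Id_on_iff)
    moreover have "fst ` R \<subseteq> carrier L" using that by auto
    ultimately show ?thesis by (simp add: Id_on_iff)
  qed
qed (auto simp: Id_on_def)

lemma congruence_nabla_imp:
  assumes r: "frame_congruence L r" and a: "a \<in> carrier L"
  shows "frame_congruence L (nabla_imp a r)"
  unfolding nabla_imp_def
proof (rule frame_congruence_preimage[OF r bottom_closed])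
  fix x y assume xy: "x \<in> carrier L" "y \<in> carrier L"
  have "(a \<sqinter> x) \<sqinter> (a \<sqinter> y) = a \<sqinter> (x \<sqinter> y)"
    using a xy
    by (intro le_antisym meet_le)
       (auto intro: le_trans[OF meet_left meet_left] le_trans[OF meet_left meet_right]
         le_trans[OF meet_right meet_right] le_trans[OF meet_right meet_left] meet_left
         meet_mono meet_right)
  then show "a \<sqinter> (x \<sqinter> y) = (a \<sqinter> x) \<sqinter> (a \<sqinter> y)" by simp
next
  fix A assume A: "A \<subseteq> carrier L"
  then have im: "(\<lambda>x. a \<sqinter> x) ` A \<subseteq> carrier L" using a by auto
  show "a \<sqinter> \<Squnion>A = \<Squnion>(insert \<bottom> ((\<lambda>x. a \<sqinter> x) ` A))"
    using frame_distrib[OF a A] im by (simp add: sup_insert join_absorb)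
qed (use a in auto)

lemma congruence_delta_imp:
  assumes r: "frame_congruence L r" and a: "a \<in> carrier L"
  shows "frame_congruence L (delta_imp a r)"
  unfolding delta_imp_def
proof (rule frame_congruence_preimage[OF r a])
  fix A assume A: "A \<subseteq> carrier L"
  have im: "(\<lambda>x. a \<squnion> x) ` A \<subseteq> carrier L" using a A by auto
  show "a \<squnion> \<Squnion>A = \<Squnion>(insert a ((\<lambda>x. a \<squnion> x) ` A))"
  proof (rule sup_eqI[symmetric])
    show "x \<sqsubseteq> a \<squnion> \<Squnion>A" if "x \<in> insert a ((\<lambda>x. a \<squnion> x) ` A)" for x
      using that a A subsetD[OF A] by (auto intro: join_left join_mono sup_upper)
    show "a \<squnion> \<Squnion>A \<sqsubseteq> y"
      if y: "y \<in> carrier L" "\<And>x. x \<in> insert a ((\<lambda>x. a \<squnion> x) ` A) \<Longrightarrow> x \<sqsubseteq> y" for y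
    proof (intro join_le sup_least)
      fix x assume x: "x \<in> A"
      then have "x \<in> carrier L" using A by blast
      then show "x \<sqsubseteq> y" using le_trans[OF join_right y(2)] x a y(1) by auto
    qed (use y a A in auto)
  qed (use a A im in auto)
qed (use a in \<open>auto simp: join_meet_distrib\<close>)

lemma delta_congruence: "a \<in> carrier L \<Longrightarrow> frame_congruence L (delta L a)"
  using congruence_nabla_imp[OF congruence_Id, of a]
  by (simp add: delta_def nabla_imp_def Id_on_iff conj_ac cong: conj_cong)

lemma nabla_congruence: "a \<in> carrier L \<Longrightarrow> frame_congruence L (nabla L a)"
  using congruence_delta_imp[OF congruence_Id, of a]
  by (simp add: nabla_def delta_imp_def Id_on_iff conj_ac cong: conj_cong)

text \<open>A pair is determined by its traces below and above any fixed element.\<close>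

lemma congruence_from_meet_and_join:
  assumes t: "lattice_congruence t" and c: "a \<in> carrier L" "x \<in> carrier L" "y \<in> carrier L"
    and m: "(a \<sqinter> x, a \<sqinter> y) \<in> t" and j: "(a \<squnion> x, a \<squnion> y) \<in> t"
  shows "(x, y) \<in> t"
proof -
  have dist: "u \<sqinter> (a \<squnion> v) = (a \<sqinter> u) \<squnion> (x \<sqinter> y)"
    if "u = x \<and> v = y \<or> u = y \<and> v = x" for u v
    using that c meet_join_distrib[of u a v] by (auto simp: meet_comm)
  have self: "u \<sqinter> (a \<squnion> u) = u" if "u \<in> carrier L" for u
    using that c by (intro meet_absorb) (auto intro: join_right)
  note refl = congruence_refl[OF t]
  have 1: "(x, (a \<sqinter> x) \<squnion> (x \<sqinter> y)) \<in> t"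
    using congruence_meet[OF t refl[OF c(2)] j] dist[of x y] self[OF c(2)] by simp
  have 2: "((a \<sqinter> x) \<squnion> (x \<sqinter> y), (a \<sqinter> y) \<squnion> (x \<sqinter> y)) \<in> t"
    using congruence_join[OF t m refl[of "x \<sqinter> y"]] c by simp
  have 3: "((a \<sqinter> y) \<squnion> (x \<sqinter> y), y) \<in> t"
    using congruence_meet[OF t refl[OF c(3)] j] dist[of y x] self[OF c(3)] by simp
  show ?thesis using congruence_trans[OF t 1 congruence_trans[OF t 2 3]] .
qed

lemma Int_nabla_subset_iff:
  assumes c: "lattice_congruence c" and t: "lattice_congruence t" and a: "a \<in> carrier L"
  shows "c \<inter> nabla L a \<subseteq> t \<longleftrightarrow> c \<subseteq> nabla_imp a t"
proof
  assume sub: "c \<inter> nabla L a \<subseteq> t"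
  show "c \<subseteq> nabla_imp a t"
    unfolding nabla_imp_def
  proof clarify
    fix x y assume xy: "(x, y) \<in> c"
    note xyc = congruence_carrier[OF c xy]
    have "(a \<sqinter> x, a \<sqinter> y) \<in> c" using congruence_meet[OF c congruence_refl[OF c a] xy] .
    moreover have "a \<squnion> (a \<sqinter> x) = a" "a \<squnion> (a \<sqinter> y) = a"
      using a xyc by (auto intro!: join_absorb2 intro: meet_left)
    ultimately show "x \<in> carrier L \<and> y \<in> carrier L \<and> (a \<sqinter> x, a \<sqinter> y) \<in> t"
      using sub a xyc by (auto simp: nabla_def)
  qed
next
  assume sub: "c \<subseteq> nabla_imp a t"
  show "c \<inter> nabla L a \<subseteq> t"
  proof clarify
    fix x y assume xy: "(x, y) \<in> c" "(x, y) \<in> nabla L a"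
    note xyc = congruence_carrier[OF c xy(1)]
    have mem: "(a \<sqinter> x, a \<sqinter> y) \<in> t" using subsetD[OF sub xy(1)] by (simp add: nabla_imp_def)
    have refl: "(a \<squnion> x, a \<squnion> y) \<in> t"
      using xy(2) xyc a congruence_refl[OF t, of "a \<squnion> y"] by (simp add: nabla_def)
    show "(x, y) \<in> t" by (rule congruence_from_meet_and_join[OF t a xyc mem refl])
  qed
qed

lemma Int_delta_subset_iff:
  assumes c: "lattice_congruence c" and t: "lattice_congruence t" and a: "a \<in> carrier L"
  shows "c \<inter> delta L a \<subseteq> t \<longleftrightarrow> c \<subseteq> delta_imp a t"
proof
  assume sub: "c \<inter> delta L a \<subseteq> t"
  show "c \<subseteq> delta_imp a t"
    unfolding delta_imp_def
  proof clarify
    fix x y assume xy: "(x, y) \<in> c"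
    note xyc = congruence_carrier[OF c xy]
    have "(a \<squnion> x, a \<squnion> y) \<in> c" using congruence_join[OF c congruence_refl[OF c a] xy] .
    moreover have "a \<sqinter> (a \<squnion> x) = a" "a \<sqinter> (a \<squnion> y) = a"
      using a xyc by (auto intro!: meet_absorb intro: join_left)
    ultimately show "x \<in> carrier L \<and> y \<in> carrier L \<and> (a \<squnion> x, a \<squnion> y) \<in> t"
      using sub a xyc by (auto simp: delta_def)
  qed
next
  assume sub: "c \<subseteq> delta_imp a t"
  show "c \<inter> delta L a \<subseteq> t"
  proof clarify
    fix x y assume xy: "(x, y) \<in> c" "(x, y) \<in> delta L a"
    note xyc = congruence_carrier[OF c xy(1)]
    have mem: "(a \<squnion> x, a \<squnion> y) \<in> t" using subsetD[OF sub xy(1)] by (simp add: delta_imp_def)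
    have refl: "(a \<sqinter> x, a \<sqinter> y) \<in> t"
      using xy(2) xyc a congruence_refl[OF t, of "a \<sqinter> y"] by (simp add: delta_def)
    show "(x, y) \<in> t" by (rule congruence_from_meet_and_join[OF t a xyc refl mem])
  qed
qed

text \<open>
  Together with \<open>generator_mem\<close>: the congruence \<open>nabla (x \<squnion> y) \<inter> delta (x \<sqinter> y)\<close> is the least
  one identifying \<open>x\<close> and \<open>y\<close>. Indeed \<open>r\<close> identifies \<open>x \<squnion> y\<close> with \<open>x \<sqinter> y\<close>, so elements with
  the same meet with \<open>x \<sqinter> y\<close> have \<open>r\<close>-related meets with \<open>x \<squnion> y\<close>.
\<close>

lemma generator_subset:
  assumes r: "lattice_congruence r" and xy: "(x, y) \<in> r"
  shows "nabla L (x \<squnion> y) \<inter> delta L (x \<sqinter> y) \<subseteq> r"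
proof clarify
  fix u v assume uv: "(u, v) \<in> nabla L (x \<squnion> y)" "(u, v) \<in> delta L (x \<sqinter> y)"
  note c = congruence_carrier[OF r xy]
  have uvc: "u \<in> carrier L" "v \<in> carrier L" using uv by (auto simp: nabla_def)
  let ?p = "x \<squnion> y" and ?q = "x \<sqinter> y"
  have idem: "y \<squnion> y = y" "y \<sqinter> y = y" using c by (auto intro: join_absorb meet_absorb)
  have "(?p, y) \<in> r" "(?q, y) \<in> r"
    using congruence_join[OF r xy congruence_refl[OF r c(2)]]
      congruence_meet[OF r xy congruence_refl[OF r c(2)]] idem by simp_all
  then have pq: "(?p, ?q) \<in> r" using congruence_trans[OF r _ congruence_sym[OF r]] by blast
  have u: "(?p \<sqinter> u, ?q \<sqinter> u) \<in> r" and v: "(?p \<sqinter> v, ?q \<sqinter> v) \<in> r"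
    using congruence_meet[OF r pq] congruence_refl[OF r] uvc by auto
  have "(?p \<sqinter> u, ?p \<sqinter> v) \<in> r"
    using congruence_trans[OF r u] congruence_sym[OF r v] uv(2) by (simp add: delta_def)
  moreover have "(?p \<squnion> u, ?p \<squnion> v) \<in> r"
    using uv(1) congruence_refl[OF r, of "?p \<squnion> v"] c by (simp add: nabla_def)
  ultimately show "(u, v) \<in> r"
    using congruence_from_meet_and_join[OF r _ uvc, of ?p] c by simp
qed

lemma generator_mem:
  assumes "x \<in> carrier L" "y \<in> carrier L"
  shows "(x, y) \<in> nabla L (x \<squnion> y) \<inter> delta L (x \<sqinter> y)"
proof -
  have "(x \<squnion> y) \<squnion> x = x \<squnion> y" "(x \<squnion> y) \<squnion> y = x \<squnion> y" "(x \<sqinter> y) \<sqinter> x = x \<sqinter> y" "(x \<sqinter> y) \<sqinter> y = x \<sqinter> y"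
    using assms by (auto intro!: join_absorb2 meet_absorb intro: join_left join_right meet_left meet_right)
  then show ?thesis using assms by (simp add: nabla_def delta_def)
qed

lemma congruence_total: "frame_congruence L (carrier L \<times> carrier L)"
  by (rule frame_congruenceI) (auto intro!: sup_closed)

lemma congruence_Inter:
  assumes D: "D \<subseteq> congruences" "D \<noteq> {}"
  shows "\<Inter>D \<in> congruences"
proof -
  have l: "lattice_congruence r" if "r \<in> D" for r
    using D that by (auto intro: lattice_congruence_if_frame)
  have "frame_congruence L (\<Inter>D)"
  proof (rule frame_congruenceI)
    show "\<Inter>D \<subseteq> carrier L \<times> carrier L" using D(2) congruence_subset[OF l] by blast
    show "(\<Squnion>(fst ` R), \<Squnion>(snd ` R)) \<in> \<Inter>D" if "R \<subseteq> \<Inter>D" for R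
      using that D by (auto intro!: frame_congruence_sup)
  qed (use l congruence_refl congruence_sym congruence_trans congruence_meet in blast)+
  then show ?thesis by simp
qed

lemma congruence_Int: "r \<in> congruences \<Longrightarrow> s \<in> congruences \<Longrightarrow> r \<inter> s \<in> congruences"
  using congruence_Inter[of "{r, s}"] by simp

lemma congruence_frame_meet:
  "r \<in> congruences \<Longrightarrow> s \<in> congruences \<Longrightarrow> r \<sqinter>\<^bsub>congruence_frame L\<^esub> s = r \<inter> s"
  unfolding congruence_frame_eq by (intro inclusion_order_meet_eq_Int congruence_Int)

lemma congruence_subset_total: "r \<in> congruences \<Longrightarrow> r \<subseteq> carrier L \<times> carrier L"
  by (rule congruence_subset) (auto intro: lattice_congruence_if_frame)

lemma congruence_frame_top: "\<top>\<^bsub>congruence_frame L\<^esub> = carrier L \<times> carrier L"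
  unfolding congruence_frame_eq
  by (rule inclusion_order_top) (use congruence_total congruence_subset_total in auto)

lemma congruence_frame_bottom: "\<bottom>\<^bsub>congruence_frame L\<^esub> = Id_on (carrier L)"
  unfolding congruence_frame_eq
  by (rule inclusion_order_bottom)
    (use congruence_Id congruence_refl[OF lattice_congruence_if_frame] in auto)

lemma congruence_frame_simps [simp]:
  "carrier (congruence_frame L) = congruences" "le (congruence_frame L) = (\<subseteq>)"
  by (simp_all add: congruence_frame_def)

lemma complete_lattice_congruence_frame: "complete_lattice (congruence_frame L)"
  unfolding congruence_frame_eq
  by (rule closure_system_complete_lattice[OF _ _ congruence_Inter])
    (use congruence_total congruence_subset_total in auto)

text \<open>
  A pair in \<open>r \<inter> \<Squnion>R\<close> generates a congruence \<open>nabla a \<inter> delta b\<close> inside \<open>r\<close>. Meeting with such a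
  congruence has the right adjoint \<open>t \<mapsto> nabla_imp a (delta_imp b t)\<close>, hence distributes over
  \<open>\<Squnion>R\<close>.
\<close>

theorem frame_congruence_frame: "frame (congruence_frame L)"
proof -
  interpret C: complete_lattice "congruence_frame L" by (rule complete_lattice_congruence_frame)
  show ?thesis
  proof (unfold_locales, rule C.le_antisym, unfold congruence_frame_simps)
    fix r R assume r: "r \<in> congruences" and R: "R \<subseteq> congruences"
    let ?C = "congruence_frame L" and ?rR = "(\<lambda>s. r \<sqinter>\<^bsub>congruence_frame L\<^esub> s) ` R"
    have rR: "?rR \<subseteq> congruences" using r R C.meet_closed by auto
    have supR: "\<Squnion>\<^bsub>?C\<^esub>R \<in> congruences" using C.sup_closed[of R] R by simp
    define t where "t = \<Squnion>\<^bsub>?C\<^esub>?rR"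
    have t: "t \<in> congruences" using C.sup_closed[of ?rR] rR unfolding t_def by simp
    note lt = lattice_congruence_if_frame[OF CollectD[OF t]]
    have meet_eq: "r \<sqinter>\<^bsub>?C\<^esub> \<Squnion>\<^bsub>?C\<^esub>R = r \<inter> \<Squnion>\<^bsub>?C\<^esub>R" by (rule congruence_frame_meet[OF r supR])
    have "r \<inter> \<Squnion>\<^bsub>?C\<^esub>R \<subseteq> t"
    proof clarify
      fix x y assume xy: "(x, y) \<in> r" "(x, y) \<in> \<Squnion>\<^bsub>?C\<^esub>R"
      have lr: "lattice_congruence r" using r by (auto intro: lattice_congruence_if_frame)
      note c = congruence_carrier[OF lr xy(1)]
      let ?a = "x \<squnion> y" and ?b = "x \<sqinter> y"
      have ab: "?a \<in> carrier L" "?b \<in> carrier L" using c by auto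
      let ?t\<^sub>1 = "delta_imp ?b t" and ?t\<^sub>2 = "nabla_imp ?a (delta_imp ?b t)"
      have t\<^sub>1: "frame_congruence L ?t\<^sub>1" using t ab by (intro congruence_delta_imp) auto
      have t\<^sub>2: "frame_congruence L ?t\<^sub>2" by (rule congruence_nabla_imp[OF t\<^sub>1 ab(1)])
      note lt\<^sub>1 = lattice_congruence_if_frame[OF t\<^sub>1]
      have adj: "(s \<inter> nabla L ?a) \<inter> delta L ?b \<subseteq> t \<longleftrightarrow> s \<subseteq> ?t\<^sub>2" if s: "s \<in> congruences" for s
      proof -
        have "lattice_congruence s" "lattice_congruence (s \<inter> nabla L ?a)"
          using s congruence_Int[OF s] nabla_congruence[OF ab(1)]
          by (auto intro: lattice_congruence_if_frame)
        then show ?thesis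
          unfolding Int_delta_subset_iff[OF \<open>lattice_congruence (s \<inter> _)\<close> lt ab(2)]
            Int_nabla_subset_iff[OF \<open>lattice_congruence s\<close> lt\<^sub>1 ab(1)] by simp
      qed
      have "s \<subseteq> ?t\<^sub>2" if s: "s \<in> R" for s
      proof -
        have sc: "s \<in> congruences" using s R by blast
        have "r \<sqinter>\<^bsub>?C\<^esub> s \<subseteq> t" unfolding t_def using C.sup_upper[of ?rR] rR s by auto
        then have "r \<inter> s \<subseteq> t" using congruence_frame_meet[OF r sc] by simp
        then have "(s \<inter> nabla L ?a) \<inter> delta L ?b \<subseteq> t" using generator_subset[OF lr xy(1)] by blast
        then show ?thesis using adj[OF sc] by simp
      qed
      then have "\<Squnion>\<^bsub>?C\<^esub>R \<subseteq> ?t\<^sub>2" using C.sup_least[of R ?t\<^sub>2] R t\<^sub>2 by simp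
      then have "(\<Squnion>\<^bsub>?C\<^esub>R \<inter> nabla L ?a) \<inter> delta L ?b \<subseteq> t" using adj[OF supR] by simp
      then show "(x, y) \<in> t" using xy(2) generator_mem[OF c] by blast
    qed
    then show "r \<sqinter>\<^bsub>?C\<^esub> \<Squnion>\<^bsub>?C\<^esub>R \<subseteq> \<Squnion>\<^bsub>?C\<^esub>?rR" unfolding meet_eq t_def .
    show "r \<sqinter>\<^bsub>?C\<^esub> \<Squnion>\<^bsub>?C\<^esub>R \<in> congruences" unfolding meet_eq by (rule congruence_Int[OF r supR])
    show "\<Squnion>\<^bsub>?C\<^esub>?rR \<in> congruences" using t unfolding t_def .
    have "s \<subseteq> r \<inter> \<Squnion>\<^bsub>?C\<^esub>R" if s: "s \<in> ?rR" for s
    proof -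
      obtain q where q: "q \<in> R" "s = r \<sqinter>\<^bsub>?C\<^esub> q" using s by blast
      then have "s = r \<inter> q" using congruence_frame_meet[OF r] R by blast
      moreover have "q \<subseteq> \<Squnion>\<^bsub>?C\<^esub>R" using C.sup_upper[of R q] R q(1) by simp
      ultimately show ?thesis by blast
    qed
    then show "\<Squnion>\<^bsub>?C\<^esub>?rR \<subseteq> r \<sqinter>\<^bsub>?C\<^esub> \<Squnion>\<^bsub>?C\<^esub>R"
      unfolding meet_eq using C.sup_least[of ?rR "r \<inter> \<Squnion>\<^bsub>?C\<^esub>R"] rR congruence_Int[OF r supR] by simp
  qed
qed

text \<open>So \<open>nabla a\<close> is the least congruence identifying \<open>\<bottom>\<close> with \<open>a\<close>.\<close>

lemma nabla_subset_iff:
  assumes r: "lattice_congruence r" and a: "a \<in> carrier L"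
  shows "nabla L a \<subseteq> r \<longleftrightarrow> (\<bottom>, a) \<in> r"
proof
  have "(\<bottom>, a) \<in> nabla L a" using a by (simp add: nabla_def join_bottom join_absorb)
  then show "nabla L a \<subseteq> r \<Longrightarrow> (\<bottom>, a) \<in> r" by blast
  assume ba: "(\<bottom>, a) \<in> r"
  show "nabla L a \<subseteq> r"
  proof clarify
    fix u v assume uv: "(u, v) \<in> nabla L a"
    then have c: "u \<in> carrier L" "v \<in> carrier L" "a \<squnion> u = a \<squnion> v" by (auto simp: nabla_def)
    have up: "(x, a \<squnion> x) \<in> r" if "x \<in> carrier L" for x
      using congruence_join[OF r ba congruence_refl[OF r that]] that by (simp add: join_absorb)
    show "(u, v) \<in> r"
      using congruence_trans[OF r up[OF c(1)]] congruence_sym[OF r up[OF c(2)]] c(3) by simp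
  qed
qed

lemma nabla_le_iff:
  assumes "a \<in> carrier L" "b \<in> carrier L"
  shows "nabla L a \<subseteq> nabla L b \<longleftrightarrow> a \<sqsubseteq> b"
proof -
  have "nabla L a \<subseteq> nabla L b \<longleftrightarrow> b \<squnion> a = b"
    using assms nabla_subset_iff[OF lattice_congruence_if_frame[OF nabla_congruence[OF assms(2)]] assms(1)]
    by (auto simp: nabla_def join_bottom)
  then show ?thesis using assms by (metis join_absorb2 join_right)
qed

lemma nabla_sup_subset:
  assumes r: "frame_congruence L r" and A: "A \<subseteq> carrier L" and sub: "\<And>a. a \<in> A \<Longrightarrow> nabla L a \<subseteq> r"
  shows "nabla L (\<Squnion>A) \<subseteq> r"
proof -
  note lr = lattice_congruence_if_frame[OF r]
  let ?R = "Pair \<bottom> ` insert \<bottom> A"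
  have "(\<bottom>, a) \<in> r" if "a \<in> A" for a using sub nabla_subset_iff[OF lr] A that by blast
  then have "?R \<subseteq> r" using congruence_refl[OF lr bottom_closed] by auto
  then have "(\<Squnion>(fst ` ?R), \<Squnion>(snd ` ?R)) \<in> r" by (rule frame_congruence_sup[OF r])
  moreover have "fst ` ?R = {\<bottom>}" "snd ` ?R = insert \<bottom> A" by (auto simp: image_image)
  ultimately have "(\<Squnion>{\<bottom>}, \<Squnion>(insert \<bottom> A)) \<in> r" by (simp only:)
  then have "(\<bottom>, \<Squnion>A) \<in> r" using A by (simp add: sup_insert sup_empty join_absorb)
  then show ?thesis using nabla_subset_iff[OF lr] A by simp
qed

lemma nabla_delta_complement:
  assumes a: "a \<in> carrier L"
  shows "nabla L a \<inter> delta L a = Id_on (carrier L)"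
    and "lattice_congruence r \<Longrightarrow> nabla L a \<subseteq> r \<Longrightarrow> delta L a \<subseteq> r \<Longrightarrow> r = carrier L \<times> carrier L"
proof -
  have "x = y" if "x \<in> carrier L" "y \<in> carrier L" "a \<squnion> x = a \<squnion> y" "a \<sqinter> x = a \<sqinter> y" for x y
    using congruence_from_meet_and_join[OF lattice_congruence_if_frame[OF congruence_Id] a that(1,2)]
      that a by (simp add: Id_on_iff)
  then show "nabla L a \<inter> delta L a = Id_on (carrier L)"
    by (auto simp: nabla_def delta_def Id_on_def)
  assume r: "lattice_congruence r" and sub: "nabla L a \<subseteq> r" "delta L a \<subseteq> r"
  have "(\<bottom>, a) \<in> r" using sub(1) nabla_subset_iff[OF r a] by simp
  moreover have "(a, \<top>) \<in> delta L a"
    using a meet_top meet_absorb[of a a] by (simp add: delta_def)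
  ultimately have bt: "(\<bottom>, \<top>) \<in> r" using sub(2) congruence_trans[OF r] by blast
  have "(\<bottom>, x) \<in> r" if "x \<in> carrier L" for x
    using congruence_meet[OF r bt congruence_refl[OF r that]] that meet_bottom meet_top
    by (simp add: meet_comm)
  then have "(x, y) \<in> r" if "x \<in> carrier L" "y \<in> carrier L" for x y
    using that congruence_trans[OF r congruence_sym[OF r]] by blast
  then show "r = carrier L \<times> carrier L" using congruence_subset[OF r] by auto
qed

end

section \<open>The symmetrization of a Frith frame\<close>

lemma (in frame) complement_meet:
  assumes c: "a \<in> carrier L" "a' \<in> carrier L" "b \<in> carrier L" "b' \<in> carrier L"
    and a: "a \<sqinter> a' = \<bottom>" "a \<squnion> a' = \<top>" and b: "b \<sqinter> b' = \<bottom>" "b \<squnion> b' = \<top>"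
  shows "(a \<sqinter> b) \<sqinter> (a' \<squnion> b') = \<bottom>" and "(a \<sqinter> b) \<squnion> (a' \<squnion> b') = \<top>"
proof -
  have "(a \<sqinter> b) \<sqinter> a' \<sqsubseteq> a \<sqinter> a'" using c by (intro meet_mono meet_left) auto
  then have 1: "(a \<sqinter> b) \<sqinter> a' = \<bottom>" using a c bottom_lower by (intro le_antisym) auto
  have "(a \<sqinter> b) \<sqinter> b' \<sqsubseteq> b \<sqinter> b'" using c by (intro meet_mono meet_right) auto
  then have 2: "(a \<sqinter> b) \<sqinter> b' = \<bottom>" using b c bottom_lower by (intro le_antisym) auto
  show "(a \<sqinter> b) \<sqinter> (a' \<squnion> b') = \<bottom>" using c 1 2 by (simp add: meet_join_distrib join_bottom)
  have "a \<squnion> a' \<sqsubseteq> (a' \<squnion> b') \<squnion> a"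
    using c le_trans[OF join_left[of a' b'] join_left[of "a' \<squnion> b'" a]] by (intro join_le join_right) auto
  then have 3: "(a' \<squnion> b') \<squnion> a = \<top>" using a c top_higher by (intro le_antisym) auto
  have "b \<squnion> b' \<sqsubseteq> (a' \<squnion> b') \<squnion> b"
    using c le_trans[OF join_right[of a' b'] join_left[of "a' \<squnion> b'" b]] by (intro join_le join_right) auto
  then have 4: "(a' \<squnion> b') \<squnion> b = \<top>" using b c top_higher by (intro le_antisym) auto
  show "(a \<sqinter> b) \<squnion> (a' \<squnion> b') = \<top>"
    using join_meet_distrib[of "a' \<squnion> b'" a b] c 3 4 by (simp add: meet_top join_comm)
qed

lemma generated_subframe_eq:
  "generated_subframe L G = L\<lparr>carrier := carrier (generated_subframe L G)\<rparr>"
  by (simp add: generated_subframe_def)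

lemma subframe_generated_subframe:
  assumes L: "frame L" and G: "G \<subseteq> carrier L"
  shows "subframe L (carrier (generated_subframe L G))" and "G \<subseteq> carrier (generated_subframe L G)"
proof -
  interpret frame L by (rule L)
  have "subframe L (carrier L)" by (simp add: subframe_def)
  then have "carrier (generated_subframe L G) \<subseteq> carrier L"
    using G by (auto simp: generated_subframe_def)
  then show "subframe L (carrier (generated_subframe L G))"
    unfolding subframe_def
  proof (intro conjI ballI allI impI)
    show "\<Squnion>\<^bsub>L\<^esub>A \<in> carrier (generated_subframe L G)"
      if A: "A \<subseteq> carrier (generated_subframe L G)" for A
    proof -
      have "\<Squnion>\<^bsub>L\<^esub>A \<in> K" if K: "subframe L K" "G \<subseteq> K" for K
      proof -
        have "A \<subseteq> K" using A K by (auto simp: generated_subframe_def)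
        then show ?thesis using K(1) by (simp add: subframe_def)
      qed
      then show ?thesis by (simp add: generated_subframe_def)
    qed
  qed (auto simp: generated_subframe_def subframe_def)
  show "G \<subseteq> carrier (generated_subframe L G)" by (auto simp: generated_subframe_def)
qed

lemma generated_subframe_least: "subframe L K \<Longrightarrow> G \<subseteq> K \<Longrightarrow> carrier (generated_subframe L G) \<subseteq> K"
  by (auto simp: generated_subframe_def)

lemma generated_sublattice_least: "sublattice L K \<Longrightarrow> G \<subseteq> K \<Longrightarrow> generated_sublattice L G \<subseteq> K"
  by (auto simp: generated_sublattice_def)

lemma generated_sublattice_upper: "G \<subseteq> generated_sublattice L G"
  by (auto simp: generated_sublattice_def)

lemma sublattice_generated_sublattice:
  assumes "sublattice L K" "G \<subseteq> K"
  shows "sublattice L (generated_sublattice L G)"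
  unfolding sublattice_def
proof (intro conjI ballI)
  show "generated_sublattice L G \<subseteq> carrier L"
    using generated_sublattice_least[OF assms] assms(1) by (auto simp: sublattice_def)
qed (auto simp: generated_sublattice_def sublattice_def)

context frith
begin

sublocale frame_congruences L ..

abbreviation CS :: "('a \<times> 'a) set gorder" where
  "CS \<equiv> partial_congruence_frame (L, S)"

abbreviation generators :: "('a \<times> 'a) set set" where
  "generators \<equiv> nabla L ` S \<union> delta L ` S"

definition sym_basis :: "('a \<times> 'a) set set" where
  "sym_basis = generated_sublattice CS generators"

lemma frith_symmetrization_eq: "frith_symmetrization (L, S) = (CS, sym_basis)"
  by (simp add: frith_symmetrization_def sym_basis_def)

lemma subframe_partial: "subframe (congruence_frame L) (carrier CS)"
  and nabla_in_partial: "a \<in> carrier L \<Longrightarrow> nabla L a \<in> carrier CS"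
  and delta_in_partial: "s \<in> S \<Longrightarrow> delta L s \<in> carrier CS"
proof -
  have G: "nabla L ` carrier L \<union> delta L ` S \<subseteq> carrier (congruence_frame L)"
    using nabla_congruence delta_congruence basis_carrier by auto
  show "subframe (congruence_frame L) (carrier CS)"
    using subframe_generated_subframe(1)[OF frame_congruence_frame G]
    by (simp add: partial_congruence_frame_def)
  show "a \<in> carrier L \<Longrightarrow> nabla L a \<in> carrier CS" "s \<in> S \<Longrightarrow> delta L s \<in> carrier CS"
    using subframe_generated_subframe(2)[OF frame_congruence_frame G]
    by (auto simp: partial_congruence_frame_def)
qed

lemma partial_eq: "CS = (congruence_frame L)\<lparr>carrier := carrier CS\<rparr>"
  unfolding partial_congruence_frame_def fst_conv snd_conv by (rule generated_subframe_eq)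

lemma partial_subset: "carrier CS \<subseteq> congruences"
  using subframe_partial by (simp add: subframe_def)

lemma partial_le [simp]: "le CS = (\<subseteq>)"
  by (subst partial_eq) simp

lemma frame_partial: "frame CS"
  using subframe_inherits(1)[OF frame_congruence_frame subframe_partial] by (simp add: partial_eq[symmetric])

lemma partial_sup: "A \<subseteq> carrier CS \<Longrightarrow> \<Squnion>\<^bsub>CS\<^esub>A = \<Squnion>\<^bsub>congruence_frame L\<^esub>A"
  using subframe_inherits(2)[OF frame_congruence_frame subframe_partial] by (simp add: partial_eq[symmetric])

lemma partial_meet: "r \<in> carrier CS \<Longrightarrow> q \<in> carrier CS \<Longrightarrow> r \<sqinter>\<^bsub>CS\<^esub> q = r \<inter> q"
  using subframe_inherits(3)[OF frame_congruence_frame subframe_partial] congruence_frame_meet partial_subset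
  by (simp add: partial_eq[symmetric] subset_iff)

lemma partial_join: "r \<in> carrier CS \<Longrightarrow> q \<in> carrier CS \<Longrightarrow> r \<squnion>\<^bsub>CS\<^esub> q = r \<squnion>\<^bsub>congruence_frame L\<^esub> q"
  using subframe_inherits(4)[OF frame_congruence_frame subframe_partial] by (simp add: partial_eq[symmetric])

lemma partial_top: "\<top>\<^bsub>CS\<^esub> = carrier L \<times> carrier L"
  using subframe_inherits(5)[OF frame_congruence_frame subframe_partial] congruence_frame_top
  by (simp add: partial_eq[symmetric])

lemma partial_bottom: "\<bottom>\<^bsub>CS\<^esub> = Id_on (carrier L)"
  using subframe_inherits(6)[OF frame_congruence_frame subframe_partial] congruence_frame_bottom
  by (simp add: partial_eq[symmetric])

lemma partial_nabla_sup_le: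
  assumes "r \<in> carrier CS" "A \<subseteq> carrier L" "\<And>a. a \<in> A \<Longrightarrow> nabla L a \<subseteq> r"
  shows "nabla L (\<Squnion>A) \<subseteq> r"
  using nabla_sup_subset[OF _ assms(2,3)] assms(1) partial_subset by auto

lemma sublattice_sym_basis: "sublattice CS sym_basis"
proof -
  interpret N: frame CS by (rule frame_partial)
  show ?thesis
    unfolding sym_basis_def
    by (rule sublattice_generated_sublattice[of CS "carrier CS"])
      (use nabla_in_partial delta_in_partial basis_carrier in \<open>auto simp: sublattice_def\<close>)
qed

lemma sym_basis_induct: "sublattice CS P \<Longrightarrow> generators \<subseteq> P \<Longrightarrow> sym_basis \<subseteq> P"
  unfolding sym_basis_def by (rule generated_sublattice_least)

lemma nabla_in_sym_basis: "s \<in> S \<Longrightarrow> nabla L s \<in> sym_basis"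
  and delta_in_sym_basis: "s \<in> S \<Longrightarrow> delta L s \<in> sym_basis"
  unfolding sym_basis_def using generated_sublattice_upper[of generators CS] by auto

lemma nabla_delta_partial:
  assumes s: "s \<in> S"
  shows "nabla L s \<sqinter>\<^bsub>CS\<^esub> delta L s = \<bottom>\<^bsub>CS\<^esub>" and "nabla L s \<squnion>\<^bsub>CS\<^esub> delta L s = \<top>\<^bsub>CS\<^esub>"
proof -
  interpret N: frame CS by (rule frame_partial)
  have c: "nabla L s \<in> carrier CS" "delta L s \<in> carrier CS"
    using s nabla_in_partial delta_in_partial basis_carrier by auto
  show "nabla L s \<sqinter>\<^bsub>CS\<^esub> delta L s = \<bottom>\<^bsub>CS\<^esub>"
    using c nabla_delta_complement(1)[OF basis_carrier[OF s]] by (simp add: partial_meet partial_bottom)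
  let ?j = "nabla L s \<squnion>\<^bsub>CS\<^esub> delta L s"
  have "?j \<in> carrier CS" using c by simp
  then have "lattice_congruence ?j" using partial_subset by (auto intro: lattice_congruence_if_frame)
  then show "?j = \<top>\<^bsub>CS\<^esub>"
    using nabla_delta_complement(2)[OF basis_carrier[OF s], of ?j] N.join_left[OF c] N.join_right[OF c]
    by (simp add: partial_top)
qed

text \<open>
  Complements pass from the generators to the sublattice by De Morgan's laws, and the
  basis is join-dense because each \<open>nabla a\<close> is the join of the basic \<open>nabla s\<close> with \<open>s \<le> a\<close>.
\<close>

theorem symmetric_frith_symmetrization: "symmetric_frith CS sym_basis"
proof -
  interpret N: frame CS by (rule frame_partial)
  have sub: "sym_basis \<subseteq> carrier CS"
    and meet: "\<And>a b. a \<in> sym_basis \<Longrightarrow> b \<in> sym_basis \<Longrightarrow> a \<sqinter>\<^bsub>CS\<^esub> b \<in> sym_basis"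
    and join: "\<And>a b. a \<in> sym_basis \<Longrightarrow> b \<in> sym_basis \<Longrightarrow> a \<squnion>\<^bsub>CS\<^esub> b \<in> sym_basis"
    using sublattice_sym_basis by (auto simp: sublattice_def)
  have bot: "\<bottom>\<^bsub>CS\<^esub> \<in> sym_basis" and top: "\<top>\<^bsub>CS\<^esub> \<in> sym_basis"
    using nabla_delta_partial[OF basis_top] meet join nabla_in_sym_basis[OF basis_top]
      delta_in_sym_basis[OF basis_top] by metis+
  have complement: "\<exists>c\<in>sym_basis. b \<sqinter>\<^bsub>CS\<^esub> c = \<bottom>\<^bsub>CS\<^esub> \<and> b \<squnion>\<^bsub>CS\<^esub> c = \<top>\<^bsub>CS\<^esub>"
    if "b \<in> sym_basis" for b
  proof -
    let ?P = "{b \<in> sym_basis. \<exists>c\<in>sym_basis. b \<sqinter>\<^bsub>CS\<^esub> c = \<bottom>\<^bsub>CS\<^esub> \<and> b \<squnion>\<^bsub>CS\<^esub> c = \<top>\<^bsub>CS\<^esub>}"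
    have "sublattice CS ?P"
      unfolding sublattice_def
    proof (intro conjI ballI)
      fix a b assume "a \<in> ?P" "b \<in> ?P"
      then obtain a' b' where ab: "a \<in> sym_basis" "b \<in> sym_basis" "a' \<in> sym_basis" "b' \<in> sym_basis"
        "a \<sqinter>\<^bsub>CS\<^esub> a' = \<bottom>\<^bsub>CS\<^esub>" "a \<squnion>\<^bsub>CS\<^esub> a' = \<top>\<^bsub>CS\<^esub>" "b \<sqinter>\<^bsub>CS\<^esub> b' = \<bottom>\<^bsub>CS\<^esub>" "b \<squnion>\<^bsub>CS\<^esub> b' = \<top>\<^bsub>CS\<^esub>"
        by blast
      have c: "a \<in> carrier CS" "b \<in> carrier CS" "a' \<in> carrier CS" "b' \<in> carrier CS"
        using ab sub by auto
      note m = N.complement_meet[OF c(1,3,2,4) ab(5,6,7,8)]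
      show "a \<sqinter>\<^bsub>CS\<^esub> b \<in> ?P"
        using m meet[OF ab(1,2)] join[OF ab(3,4)] by blast
      have "a' \<sqinter>\<^bsub>CS\<^esub> a = \<bottom>\<^bsub>CS\<^esub>" "a' \<squnion>\<^bsub>CS\<^esub> a = \<top>\<^bsub>CS\<^esub>" "b' \<sqinter>\<^bsub>CS\<^esub> b = \<bottom>\<^bsub>CS\<^esub>" "b' \<squnion>\<^bsub>CS\<^esub> b = \<top>\<^bsub>CS\<^esub>"
        using ab(5-8) by (simp_all add: meet_comm join_comm)
      note m' = N.complement_meet[OF c(3,1,4,2) this]
      have "(a \<squnion>\<^bsub>CS\<^esub> b) \<sqinter>\<^bsub>CS\<^esub> (a' \<sqinter>\<^bsub>CS\<^esub> b') = \<bottom>\<^bsub>CS\<^esub>" "(a \<squnion>\<^bsub>CS\<^esub> b) \<squnion>\<^bsub>CS\<^esub> (a' \<sqinter>\<^bsub>CS\<^esub> b') = \<top>\<^bsub>CS\<^esub>"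
        using m' meet_comm[of CS] join_comm[of CS] by metis+
      then show "a \<squnion>\<^bsub>CS\<^esub> b \<in> ?P"
        using meet[OF ab(3,4)] join[OF ab(1,2)] by blast
    qed (use sub in auto)
    moreover have "generators \<subseteq> ?P"
    proof -
      have "nabla L s \<in> ?P \<and> delta L s \<in> ?P" if s: "s \<in> S" for s
        using nabla_delta_partial[OF s] nabla_in_sym_basis[OF s] delta_in_sym_basis[OF s]
          meet_comm[of CS "nabla L s"] join_comm[of CS "nabla L s"] by auto
      then show ?thesis by blast
    qed
    ultimately show ?thesis using sym_basis_induct[of ?P] that by blast
  qed
  \<comment> \<open>The congruences that are joins of basic ones form a subframe containing the generators.\<close>
  define below where "below r = {b \<in> sym_basis. b \<subseteq> r}" for r
  let ?J = "{r \<in> carrier CS. r \<subseteq> \<Squnion>\<^bsub>CS\<^esub>(below r)}"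
  have below: "below r \<subseteq> carrier CS" for r using sub by (auto simp: below_def)
  have below_mono: "\<Squnion>\<^bsub>CS\<^esub>(below r) \<subseteq> \<Squnion>\<^bsub>CS\<^esub>(below q)" if "r \<subseteq> q" for r q
    using N.sup_mono[of "below r" "below q"] below that by (auto simp: below_def)
  have basic: "b \<in> ?J" if "b \<in> sym_basis" for b
    using N.sup_upper[OF below, of b b] that sub by (auto simp: below_def)
  have nabla: "nabla L a \<in> ?J" if a: "a \<in> carrier L" for a
  proof -
    have "nabla L (\<Squnion>{s \<in> S. s \<sqsubseteq> a}) \<subseteq> \<Squnion>\<^bsub>CS\<^esub>(below (nabla L a))"
    proof (rule partial_nabla_sup_le)
      fix s assume "s \<in> {s \<in> S. s \<sqsubseteq> a}"
      then have "nabla L s \<in> below (nabla L a)"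
        using nabla_in_sym_basis nabla_le_iff[OF basis_carrier a] by (auto simp: below_def)
      then show "nabla L s \<subseteq> \<Squnion>\<^bsub>CS\<^esub>(below (nabla L a))" using N.sup_upper[OF below] by simp
    qed (use N.sup_closed[OF below] basis_subset in auto)
    then show ?thesis using sup_basis_below[OF a] nabla_in_partial[OF a] by simp
  qed
  have "subframe (congruence_frame L) ?J"
    unfolding subframe_def
  proof (intro conjI ballI allI impI)
    show "?J \<subseteq> carrier (congruence_frame L)" using partial_subset by auto
    show "\<top>\<^bsub>congruence_frame L\<^esub> \<in> ?J" using basic[OF top] by (simp add: partial_top congruence_frame_top)
    fix r q assume "r \<in> ?J" "q \<in> ?J"
    then have rq: "r \<in> carrier CS" "q \<in> carrier CS" "r \<subseteq> \<Squnion>\<^bsub>CS\<^esub>(below r)" "q \<subseteq> \<Squnion>\<^bsub>CS\<^esub>(below q)" by auto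
    have "r \<inter> q \<subseteq> \<Squnion>\<^bsub>CS\<^esub>(below r) \<inter> \<Squnion>\<^bsub>CS\<^esub>(below q)" using rq by blast
    also have "\<dots> = \<Squnion>\<^bsub>CS\<^esub>{a \<sqinter>\<^bsub>CS\<^esub> b | a b. a \<in> below r \<and> b \<in> below q}"
      using N.sup_meet_sup[OF below below] N.sup_closed[OF below] by (simp add: partial_meet)
    also have "\<dots> \<subseteq> \<Squnion>\<^bsub>CS\<^esub>(below (r \<inter> q))"
    proof -
      have "{a \<sqinter>\<^bsub>CS\<^esub> b | a b. a \<in> below r \<and> b \<in> below q} \<subseteq> below (r \<inter> q)"
      proof clarify
        fix a b assume ab: "a \<in> below r" "b \<in> below q"
        then have "a \<sqinter>\<^bsub>CS\<^esub> b = a \<inter> b" using below by (intro partial_meet) auto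
        then show "a \<sqinter>\<^bsub>CS\<^esub> b \<in> below (r \<inter> q)" using ab meet[of a b] by (auto simp: below_def)
      qed
      then show ?thesis using N.sup_mono[OF _ below] by simp
    qed
    finally have "r \<inter> q \<subseteq> \<Squnion>\<^bsub>CS\<^esub>(below (r \<inter> q))" .
    moreover have "r \<inter> q \<in> carrier CS" using N.meet_closed[OF rq(1,2)] partial_meet[OF rq(1,2)] by simp
    moreover have "r \<sqinter>\<^bsub>congruence_frame L\<^esub> q = r \<inter> q"
      using rq(1,2) partial_subset by (intro congruence_frame_meet) auto
    ultimately show "r \<sqinter>\<^bsub>congruence_frame L\<^esub> q \<in> ?J" by simp
  next
    fix A assume A: "A \<subseteq> ?J"
    then have Ac: "A \<subseteq> carrier CS" by blast
    have "r \<subseteq> \<Squnion>\<^bsub>CS\<^esub>(below (\<Squnion>\<^bsub>CS\<^esub>A))" if "r \<in> A" for r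
      using A that below_mono[of r "\<Squnion>\<^bsub>CS\<^esub>A"] N.sup_upper[OF Ac that] by auto
    then have "\<Squnion>\<^bsub>CS\<^esub>A \<subseteq> \<Squnion>\<^bsub>CS\<^esub>(below (\<Squnion>\<^bsub>CS\<^esub>A))"
      using N.sup_least[OF Ac N.sup_closed[OF below]] by simp
    then show "\<Squnion>\<^bsub>congruence_frame L\<^esub>A \<in> ?J"
      using N.sup_closed[OF Ac] by (simp add: partial_sup[OF Ac])
  qed
  then have J: "carrier CS \<subseteq> ?J"
    unfolding partial_congruence_frame_def[of "(L, S)"] fst_conv snd_conv
    using nabla basic delta_in_sym_basis by (intro generated_subframe_least) (auto simp: partial_congruence_frame_def)
  show ?thesis
  proof (intro symmetric_frith.intro frith.intro frith_axioms.intro symmetric_frith_axioms.intro)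
    show "frame CS" by (rule frame_partial)
    show "bounded_sublattice CS sym_basis"
      using sublattice_sym_basis bot top by (simp add: bounded_sublattice_def)
    show "\<exists>A\<subseteq>sym_basis. r = \<Squnion>\<^bsub>CS\<^esub>A" if r: "r \<in> carrier CS" for r
    proof (intro exI conjI)
      show "below r \<subseteq> sym_basis" by (auto simp: below_def)
      have "\<Squnion>\<^bsub>CS\<^esub>(below r) \<subseteq> r" using N.sup_least[OF below r] by (simp add: below_def)
      then show "r = \<Squnion>\<^bsub>CS\<^esub>(below r)" using J r by blast
    qed
  qed (rule complement)
qed

end

section \<open>Complete Frith frames are those with a compact basis\<close>

text \<open>A cover of \<open>b\<close> together with a complement of \<open>b\<close> covers the top.\<close>

lemma (in symmetric_frith) compact_basis_if_top_compact:
  assumes top: "compact_in L \<top>" and bS: "b \<in> S"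
  shows "compact_in L b"
  unfolding compact_in_def
proof (intro conjI allI impI)
  show b: "b \<in> carrier L" by (rule basis_carrier[OF bS])
  obtain b' where b': "b' \<in> carrier L" "b \<sqinter> b' = \<bottom>" "b \<squnion> b' = \<top>"
    using complement[OF bS] basis_carrier by blast
  fix A assume A: "A \<subseteq> carrier L" and le: "b \<sqsubseteq> \<Squnion>A"
  have iA: "insert b' A \<subseteq> carrier L" using A b' by simp
  have "b \<sqsubseteq> \<Squnion>(insert b' A)" "b' \<sqsubseteq> \<Squnion>(insert b' A)"
    using le_trans[OF le sup_mono[OF subset_insertI iA]] sup_upper[OF iA] A b iA by auto
  then have "b \<squnion> b' \<sqsubseteq> \<Squnion>(insert b' A)" using b b'(1) iA by (intro join_le) auto
  then have "\<top> \<sqsubseteq> \<Squnion>(insert b' A)" using b'(3) by simp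
  then obtain F where F: "F \<subseteq> insert b' A" "finite F" "\<top> \<sqsubseteq> \<Squnion>F"
    by (rule compact_inE[OF top iA])
  define F' where "F' = F - {b'}"
  have c: "F' \<subseteq> A" "F' \<subseteq> carrier L" "F \<subseteq> carrier L" "F \<subseteq> insert b' F'" "finite F'"
    using F(1,2) A b' by (auto simp: F'_def)
  have "\<Squnion>F \<sqsubseteq> \<Squnion>(insert b' F')" using c b' by (intro sup_mono) auto
  then have "\<top> \<sqsubseteq> b' \<squnion> \<Squnion>F'" using le_trans[OF F(3)] c b' by (simp add: sup_insert)
  then have "b' \<squnion> \<Squnion>F' = \<top>" using c b' top_higher by (intro le_antisym) auto
  then have "b = b \<sqinter> (b' \<squnion> \<Squnion>F')" using b by (simp add: meet_top)
  also have "\<dots> = b \<sqinter> \<Squnion>F'" using b b' c by (simp add: meet_join_distrib join_absorb)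
  finally have "b \<sqsubseteq> \<Squnion>F'" using meet_right[of b "\<Squnion>F'"] b c by simp
  then show "\<exists>A\<^sub>0\<subseteq>A. finite A\<^sub>0 \<and> b \<sqsubseteq> \<Squnion>A\<^sub>0" using c(1,5) by blast
qed

context frith
begin

text \<open>The embedding \<open>nabla\<close> preserves joins and reflects the order, so compactness descends along it.\<close>

theorem complete_imp_compact_basis:
  assumes complete: "frith_complete (L, S)" and s: "s \<in> S"
  shows "compact_in L s"
  unfolding compact_in_def
proof (intro conjI allI impI)
  show sc: "s \<in> carrier L" by (rule basis_carrier[OF s])
  interpret N: symmetric_frith CS sym_basis by (rule symmetric_frith_symmetrization)
  have comp: "compact_in CS (nabla L s)"
    using complete nabla_in_sym_basis[OF s] N.symmetric_complete_imp_compact_basis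
    by (simp add: frith_complete_def frith_symmetrization_eq)
  fix A assume A: "A \<subseteq> carrier L" and le: "s \<sqsubseteq> \<Squnion>A"
  have nA: "nabla L ` A \<subseteq> carrier CS" using A nabla_in_partial by auto
  have "nabla L s \<subseteq> nabla L (\<Squnion>A)" using le sc A by (simp add: nabla_le_iff)
  also have "\<dots> \<subseteq> \<Squnion>\<^bsub>CS\<^esub>(nabla L ` A)"
    using N.sup_upper[OF nA] N.sup_closed[OF nA] A by (intro partial_nabla_sup_le) auto
  finally have "nabla L s \<sqsubseteq>\<^bsub>CS\<^esub> \<Squnion>\<^bsub>CS\<^esub>(nabla L ` A)" by simp
  then obtain R where R: "R \<subseteq> nabla L ` A" "finite R" "nabla L s \<sqsubseteq>\<^bsub>CS\<^esub> \<Squnion>\<^bsub>CS\<^esub>R"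
    by (rule compact_inE[OF comp nA])
  obtain E where E: "E \<subseteq> A" "finite E" "R = nabla L ` E" using finite_subset_image[OF R(2,1)] by blast
  have Ec: "E \<subseteq> carrier L" using E A by blast
  have "\<Squnion>\<^bsub>CS\<^esub>R \<sqsubseteq>\<^bsub>CS\<^esub> nabla L (\<Squnion>E)"
  proof (rule N.sup_least)
    fix r assume "r \<in> R"
    then obtain a where a: "a \<in> E" "r = nabla L a" using E(3) by blast
    then have "a \<in> carrier L" "a \<sqsubseteq> \<Squnion>E" using Ec sup_upper[OF Ec] by auto
    then show "r \<sqsubseteq>\<^bsub>CS\<^esub> nabla L (\<Squnion>E)" using a(2) Ec by (simp add: nabla_le_iff)
  qed (use R(1) nA nabla_in_partial Ec in auto)
  then have "nabla L s \<subseteq> nabla L (\<Squnion>E)" using R(3) by simp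
  then have "s \<sqsubseteq> \<Squnion>E" using sc Ec by (simp add: nabla_le_iff)
  then show "\<exists>A\<^sub>0\<subseteq>A. finite A\<^sub>0 \<and> s \<sqsubseteq> \<Squnion>A\<^sub>0" using E by blast
qed

text \<open>
  The trace of a lattice congruence \<open>e\<close> on \<open>S\<close> extends to the relation \<open>basis_closure e\<close>, in which
  \<open>x\<close> lies below \<open>y\<close> if every basic element below \<open>x\<close> is below some basic element of \<open>y\<close> modulo
  \<open>e\<close>. When the basis is compact this is a frame congruence, even though \<open>e\<close> is only closed under
  finite joins.
\<close>

definition below_mod :: "('a \<times> 'a) set \<Rightarrow> 'a \<Rightarrow> 'a set" where
  "below_mod e y = {s \<in> S. \<exists>t\<in>S. t \<sqsubseteq> y \<and> (s, s \<sqinter> t) \<in> e}"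

definition basis_closure :: "('a \<times> 'a) set \<Rightarrow> ('a \<times> 'a) set" where
  "basis_closure e = {(x, y). x \<in> carrier L \<and> y \<in> carrier L \<and>
     down x \<subseteq> below_mod e y \<and> down y \<subseteq> below_mod e x}"

lemma below_mod_mono:
  assumes "e \<subseteq> e'" "y \<sqsubseteq> y'" "y \<in> carrier L" "y' \<in> carrier L"
  shows "below_mod e y \<subseteq> below_mod e' y'"
proof
  fix s assume "s \<in> below_mod e y"
  then obtain t where t: "s \<in> S" "t \<in> S" "t \<sqsubseteq> y" "(s, s \<sqinter> t) \<in> e" by (auto simp: below_mod_def)
  have "t \<sqsubseteq> y'" using le_trans[OF t(3) assms(2)] assms(3,4) basis_carrier[OF t(2)] by simp
  then show "s \<in> below_mod e' y'" using t assms(1) by (auto simp: below_mod_def)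
qed

lemma basis_closure_mono: "e \<subseteq> e' \<Longrightarrow> basis_closure e \<subseteq> basis_closure e'"
  using below_mod_mono[of e e' x x for x] unfolding basis_closure_def by blast

lemma below_mod_ideal:
  assumes e: "lattice_congruence e" and y: "y \<in> carrier L"
  shows "below_mod e y \<in> ideals"
proof -
  note refl = congruence_refl[OF e]
  have "\<bottom> \<in> below_mod e y"
    using basis_bottom bottom_lower[OF y] refl[OF bottom_closed] meet_bottom[OF bottom_closed]
    by (auto simp: below_mod_def)
  moreover have "s' \<in> below_mod e y" if s: "s \<in> below_mod e y" and s': "s' \<in> S" "s' \<sqsubseteq> s" for s s'
  proof -
    obtain t where t: "t \<in> S" "t \<sqsubseteq> y" "(s, s \<sqinter> t) \<in> e" and sS: "s \<in> S" using s by (auto simp: below_mod_def)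
    have c: "s \<in> carrier L" "s' \<in> carrier L" "t \<in> carrier L" using sS s' t basis_carrier by auto
    have "(s' \<sqinter> s, s' \<sqinter> (s \<sqinter> t)) \<in> e" using congruence_meet[OF e refl[OF c(2)] t(3)] .
    moreover have "s' \<sqinter> (s \<sqinter> t) = s' \<sqinter> t"
      using c s'(2) meet_absorb[of s' s] by (simp add: meet_assoc[symmetric])
    ultimately show ?thesis using c s' t meet_absorb[of s' s] by (auto simp: below_mod_def)
  qed
  moreover have "s \<squnion> s' \<in> below_mod e y" if s: "s \<in> below_mod e y" "s' \<in> below_mod e y" for s s'
  proof -
    obtain t where t: "t \<in> S" "t \<sqsubseteq> y" "(s, s \<sqinter> t) \<in> e" and sS: "s \<in> S" using s(1) by (auto simp: below_mod_def)
    obtain t' where t': "t' \<in> S" "t' \<sqsubseteq> y" "(s', s' \<sqinter> t') \<in> e" and s'S: "s' \<in> S"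
      using s(2) by (auto simp: below_mod_def)
    have c: "s \<in> carrier L" "s' \<in> carrier L" "t \<in> carrier L" "t' \<in> carrier L"
      using sS s'S t t' basis_carrier by auto
    have "(s \<squnion> s', (s \<squnion> s') \<sqinter> (t \<squnion> t')) \<in> e"
    proof (rule congruence_sandwich[OF e congruence_join[OF e t(3) t'(3)]])
      show "(s \<sqinter> t) \<squnion> (s' \<sqinter> t') \<sqsubseteq> (s \<squnion> s') \<sqinter> (t \<squnion> t')"
        using c by (intro join_le meet_mono join_left join_right) auto
    qed (use c meet_left in auto)
    moreover have "t \<squnion> t' \<sqsubseteq> y" using t t' c y by (intro join_le)
    ultimately show ?thesis
      using basis_join[OF sS s'S] basis_join[OF t(1) t'(1)] unfolding below_mod_def by blast
  qed
  moreover have "below_mod e y \<subseteq> S" by (auto simp: below_mod_def)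
  ultimately show ?thesis unfolding ideals_def by blast
qed

lemma below_mod_trans:
  assumes e: "lattice_congruence e" and yz: "down y \<subseteq> below_mod e z"
  shows "below_mod e y \<subseteq> below_mod e z"
proof
  fix s assume "s \<in> below_mod e y"
  then obtain t where t: "t \<in> S" "t \<sqsubseteq> y" "(s, s \<sqinter> t) \<in> e" and sS: "s \<in> S" by (auto simp: below_mod_def)
  then have "t \<in> below_mod e z" using yz by (auto simp: down_def)
  then obtain u where u: "u \<in> S" "u \<sqsubseteq> z" "(t, t \<sqinter> u) \<in> e" by (auto simp: below_mod_def)
  have c: "s \<in> carrier L" "t \<in> carrier L" "u \<in> carrier L" using sS t u basis_carrier by auto
  have "(s \<sqinter> t, s \<sqinter> (t \<sqinter> u)) \<in> e" using congruence_meet[OF e congruence_refl[OF e c(1)] u(3)] .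
  then have "(s, s \<sqinter> (t \<sqinter> u)) \<in> e" using congruence_trans[OF e t(3)] by blast
  then have "(s, s \<sqinter> u) \<in> e"
    by (rule congruence_sandwich[OF e]) (use c in \<open>auto intro!: meet_mono meet_left meet_right\<close>)
  then show "s \<in> below_mod e z" using sS u by (auto simp: below_mod_def)
qed

lemma principal_subset_below_mod:
  assumes e: "lattice_congruence e" and x: "x \<in> carrier L"
  shows "down x \<subseteq> below_mod e x"
proof
  fix s assume "s \<in> down x"
  then have s: "s \<in> S" "s \<sqsubseteq> x" by (auto simp: down_def)
  then have "(s, s \<sqinter> s) \<in> e"
    using congruence_refl[OF e] basis_carrier[OF s(1)] meet_absorb[of s s] by simp
  then show "s \<in> below_mod e x" using s by (auto simp: below_mod_def)
qed

lemma below_mod_meet: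
  assumes e: "lattice_congruence e" and y: "y \<in> carrier L" "y' \<in> carrier L"
  shows "below_mod e y \<inter> below_mod e y' \<subseteq> below_mod e (y \<sqinter> y')"
proof clarify
  fix s assume s: "s \<in> below_mod e y" "s \<in> below_mod e y'"
  obtain t where t: "t \<in> S" "t \<sqsubseteq> y" "(s, s \<sqinter> t) \<in> e" and sS: "s \<in> S" using s(1) by (auto simp: below_mod_def)
  obtain t' where t': "t' \<in> S" "t' \<sqsubseteq> y'" "(s, s \<sqinter> t') \<in> e" using s(2) by (auto simp: below_mod_def)
  have c: "s \<in> carrier L" "t \<in> carrier L" "t' \<in> carrier L" using sS t t' basis_carrier by auto
  have "(s \<sqinter> t, (s \<sqinter> t') \<sqinter> t) \<in> e" using congruence_meet[OF e t'(3) congruence_refl[OF e c(2)]] .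
  moreover have "(s \<sqinter> t') \<sqinter> t = s \<sqinter> (t \<sqinter> t')"
    using meet_assoc[OF c(1,3,2)] by (simp add: meet_comm[of L t])
  ultimately have "(s, s \<sqinter> (t \<sqinter> t')) \<in> e"
    using congruence_trans[OF e t(3)] by simp
  moreover have "t \<sqinter> t' \<sqsubseteq> y \<sqinter> y'" using t t' c y by (intro meet_mono)
  ultimately show "s \<in> below_mod e (y \<sqinter> y')"
    using sS basis_meet[OF t(1) t'(1)] by (auto simp: below_mod_def)
qed

end

locale compact_frith = frith +
  assumes compact_basis: "s \<in> S \<Longrightarrow> compact_in L s"
begin

lemma down_sup_subset:
  assumes J: "J \<in> ideals" and A: "A \<subseteq> carrier L" "\<And>a. a \<in> A \<Longrightarrow> down a \<subseteq> J"
  shows "down (\<Squnion>A) \<subseteq> J"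
proof
  fix s assume "s \<in> down (\<Squnion>A)"
  then have s: "s \<in> S" "s \<sqsubseteq> \<Squnion>A" by (auto simp: down_def)
  let ?T = "{t \<in> S. \<exists>a\<in>A. t \<sqsubseteq> a}"
  have "?T \<subseteq> carrier L" "s \<sqsubseteq> \<Squnion>?T" using basis_subset s(2) sup_basis_refinement[OF A(1)] by auto
  then obtain T where T: "T \<subseteq> ?T" "finite T" "s \<sqsubseteq> \<Squnion>T" by (rule compact_inE[OF compact_basis[OF s(1)]])
  have "T \<subseteq> J" using T(1) A(2) by (auto simp: down_def)
  then show "s \<in> J" using ideals_down[OF J ideals_finite_sup[OF J T(2)] s(1) T(3)] by blast
qed

lemma frame_congruence_basis_closure:
  assumes e: "lattice_congruence e"
  shows "frame_congruence L (basis_closure e)"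
proof (rule frame_congruenceI)
  show "basis_closure e \<subseteq> carrier L \<times> carrier L" by (auto simp: basis_closure_def)
  show "(x, x) \<in> basis_closure e" if "x \<in> carrier L" for x
    using that principal_subset_below_mod[OF e] by (auto simp: basis_closure_def)
  show "(y, x) \<in> basis_closure e" if "(x, y) \<in> basis_closure e" for x y
    using that by (auto simp: basis_closure_def)
  show "(x, z) \<in> basis_closure e" if "(x, y) \<in> basis_closure e" "(y, z) \<in> basis_closure e" for x y z
    using that below_mod_trans[OF e, of y z] below_mod_trans[OF e, of y x] unfolding basis_closure_def by blast
  show "(x \<sqinter> x', y \<sqinter> y') \<in> basis_closure e"
    if xy: "(x, y) \<in> basis_closure e" "(x', y') \<in> basis_closure e" for x y x' y'
  proof -
    have c: "x \<in> carrier L" "y \<in> carrier L" "x' \<in> carrier L" "y' \<in> carrier L"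
      using xy by (auto simp: basis_closure_def)
    have "down (x \<sqinter> x') \<subseteq> down x \<inter> down x'"
      "down (y \<sqinter> y') \<subseteq> down y \<inter> down y'"
      using c by (auto simp: down_def basis_carrier
          dest: le_trans[OF _ meet_left] le_trans[OF _ meet_right])
    moreover have "down x \<subseteq> below_mod e y" "down x' \<subseteq> below_mod e y'"
      "down y \<subseteq> below_mod e x" "down y' \<subseteq> below_mod e x'"
      using xy by (auto simp: basis_closure_def)
    ultimately have "down (x \<sqinter> x') \<subseteq> below_mod e (y \<sqinter> y')"
      "down (y \<sqinter> y') \<subseteq> below_mod e (x \<sqinter> x')"
      using below_mod_meet[OF e c(2,4)] below_mod_meet[OF e c(1,3)] by blast+
    then show ?thesis using c by (simp add: basis_closure_def)
  qed
  fix R assume R: "R \<subseteq> basis_closure e"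
  have c: "fst ` R \<subseteq> carrier L" "snd ` R \<subseteq> carrier L" using R by (auto simp: basis_closure_def)
  have "down x \<subseteq> below_mod e (\<Squnion>(snd ` R)) \<and> down y \<subseteq> below_mod e (\<Squnion>(fst ` R))"
    if xy: "(x, y) \<in> R" for x y
  proof -
    have im: "x \<in> fst ` R" "y \<in> snd ` R" using imageI[OF xy, of fst] imageI[OF xy, of snd] by simp_all
    then have "below_mod e x \<subseteq> below_mod e (\<Squnion>(fst ` R))" "below_mod e y \<subseteq> below_mod e (\<Squnion>(snd ` R))"
      using below_mod_mono[OF subset_refl sup_upper[OF c(1) im(1)] _ sup_closed[OF c(1)]]
        below_mod_mono[OF subset_refl sup_upper[OF c(2) im(2)] _ sup_closed[OF c(2)]]
        subsetD[OF c(1) im(1)] subsetD[OF c(2) im(2)] by simp_all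
    moreover have "(x, y) \<in> basis_closure e" using xy R by blast
    ultimately show ?thesis by (simp add: basis_closure_def) blast
  qed
  then have *: "\<And>a. a \<in> fst ` R \<Longrightarrow> down a \<subseteq> below_mod e (\<Squnion>(snd ` R))"
    "\<And>a. a \<in> snd ` R \<Longrightarrow> down a \<subseteq> below_mod e (\<Squnion>(fst ` R))"
    by (metis imageE prod.collapse)+
  have "down (\<Squnion>(fst ` R)) \<subseteq> below_mod e (\<Squnion>(snd ` R))"
    "down (\<Squnion>(snd ` R)) \<subseteq> below_mod e (\<Squnion>(fst ` R))"
    using down_sup_subset[OF below_mod_ideal[OF e sup_closed[OF c(2)]] c(1)] *(1)
      down_sup_subset[OF below_mod_ideal[OF e sup_closed[OF c(1)]] c(2)] *(2) by blast+
  then show "(\<Squnion>(fst ` R), \<Squnion>(snd ` R)) \<in> basis_closure e" using c by (simp add: basis_closure_def)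
qed

text \<open>
  Basic congruences are recovered from their traces on the basis. For \<open>delta a\<close> this needs that
  \<open>a \<sqinter> s\<close> is again basic, which is why \<open>a\<close> has to be basic; for \<open>nabla a\<close> it rests on
  compactness of the basic elements below \<open>a \<squnion> y\<close>. The property passes to meets and joins.
\<close>

lemma sym_basis_finitary:
  assumes "r \<in> sym_basis"
  shows "r \<subseteq> basis_closure r"
proof -
  interpret N: frame CS by (rule frame_partial)
  let ?P = "{r \<in> carrier CS. r \<subseteq> basis_closure r}"
  have lc: "lattice_congruence r" if "r \<in> carrier CS" for r
    using that partial_subset by (auto intro: lattice_congruence_if_frame)
  have closureI: "r \<subseteq> basis_closure r"
    if r: "r \<in> carrier CS" and fin: "\<And>x y s. (x, y) \<in> r \<Longrightarrow> s \<in> S \<Longrightarrow> s \<sqsubseteq> x \<Longrightarrow> s \<in> below_mod r y" for r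
  proof clarify
    fix x y assume xy: "(x, y) \<in> r"
    then show "(x, y) \<in> basis_closure r"
      using congruence_carrier[OF lc[OF r] xy] congruence_sym[OF lc[OF r] xy] fin
      unfolding basis_closure_def down_def by blast
  qed
  have "nabla L a \<in> ?P" if a: "a \<in> S" for a
  proof -
    have ac: "a \<in> carrier L" using basis_carrier[OF a] .
    have "nabla L a \<subseteq> basis_closure (nabla L a)"
    proof (rule closureI[OF nabla_in_partial[OF ac]])
      fix x y s assume xy: "(x, y) \<in> nabla L a" and s: "s \<in> S" "s \<sqsubseteq> x"
      have c: "x \<in> carrier L" "y \<in> carrier L" "a \<squnion> x = a \<squnion> y" "s \<in> carrier L"
        using xy s basis_carrier by (auto simp: nabla_def)
      \<comment> \<open>This ideal contains everything basic below \<open>a\<close> (identified with \<open>\<bottom>\<close>) or below \<open>y\<close>,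
        hence, by compactness, everything basic below \<open>a \<squnion> y = a \<squnion> x\<close>.\<close>
      have j: "below_mod (nabla L a) y \<in> ideals" by (rule below_mod_ideal[OF lc[OF nabla_in_partial[OF ac]] c(2)])
      have "down (\<Squnion>{a, y}) \<subseteq> below_mod (nabla L a) y"
      proof (rule down_sup_subset[OF j])
        fix b assume "b \<in> {a, y}"
        then show "down b \<subseteq> below_mod (nabla L a) y"
        proof (elim insertE emptyE)
          assume "b = a"
          show ?thesis
          proof
            fix u assume "u \<in> down b"
            then have u: "u \<in> S" "u \<in> carrier L" "u \<sqsubseteq> a" using \<open>b = a\<close> basis_carrier by (auto simp: down_def)
            then have "(u, u \<sqinter> \<bottom>) \<in> nabla L a"
              using ac by (simp add: nabla_def meet_bottom join_bottom join_absorb2)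
            then show "u \<in> below_mod (nabla L a) y"
              using u(1) basis_bottom bottom_lower[OF c(2)] by (auto simp: below_mod_def)
          qed
        next
          assume "b = y"
          then show ?thesis
            using principal_subset_below_mod[OF lc[OF nabla_in_partial[OF ac]] c(2)] by simp
        qed
      qed (use ac c in auto)
      moreover have "s \<sqsubseteq> a \<squnion> y" using le_trans[OF s(2) join_right[OF ac c(1)]] c ac by simp
      ultimately show "s \<in> below_mod (nabla L a) y" using s(1) by (auto simp: down_def join_def)
    qed
    then show ?thesis using nabla_in_partial[OF ac] by simp
  qed
  moreover have "delta L a \<in> ?P" if a: "a \<in> S" for a
  proof -
    have ac: "a \<in> carrier L" using basis_carrier[OF a] .
    have "delta L a \<subseteq> basis_closure (delta L a)"
    proof (rule closureI[OF delta_in_partial[OF a]])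
      fix x y s assume xy: "(x, y) \<in> delta L a" and s: "s \<in> S" "s \<sqsubseteq> x"
      have c: "x \<in> carrier L" "y \<in> carrier L" "a \<sqinter> x = a \<sqinter> y" "s \<in> carrier L"
        using xy s basis_carrier by (auto simp: delta_def)
      have "a \<sqinter> s \<sqsubseteq> a \<sqinter> y" using meet_mono[of a a s x] ac c s(2) by simp
      then have "a \<sqinter> s \<sqsubseteq> y" using le_trans[OF _ meet_right[OF ac c(2)]] ac c by simp
      moreover have "s \<sqinter> (a \<sqinter> s) = a \<sqinter> s" using ac c by (intro meet_absorb2) (auto intro: meet_right)
      moreover have "a \<sqinter> (a \<sqinter> s) = a \<sqinter> s" using ac c by (intro meet_absorb2) (auto intro: meet_left)
      ultimately show "s \<in> below_mod (delta L a) y"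
        using basis_meet[OF a s(1)] s(1) ac c
        by (auto simp: below_mod_def delta_def intro!: bexI[of _ "a \<sqinter> s"])
    qed
    then show ?thesis using delta_in_partial[OF a] by simp
  qed
  ultimately have gen: "generators \<subseteq> ?P" by blast
  have "sublattice CS ?P"
    unfolding sublattice_def
  proof (intro conjI ballI)
    fix r q assume "r \<in> ?P" "q \<in> ?P"
    then have rq: "r \<in> carrier CS" "q \<in> carrier CS" "r \<subseteq> basis_closure r" "q \<subseteq> basis_closure q" by auto
    have int: "r \<inter> q \<in> carrier CS" using N.meet_closed[OF rq(1,2)] partial_meet[OF rq(1,2)] by simp
    have "r \<inter> q \<subseteq> basis_closure (r \<inter> q)"
    proof (rule closureI[OF int])
      fix x y s assume xy: "(x, y) \<in> r \<inter> q" and s: "s \<in> S" "s \<sqsubseteq> x"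
      have y: "y \<in> carrier L" using xy congruence_carrier[OF lc[OF rq(1)]] by blast
      have "s \<in> below_mod r y" "s \<in> below_mod q y"
        using xy s rq(3,4) by (auto simp: basis_closure_def down_def)
      then obtain t t' where t: "t \<in> S" "t \<sqsubseteq> y" "(s, s \<sqinter> t) \<in> r" "t' \<in> S" "t' \<sqsubseteq> y" "(s, s \<sqinter> t') \<in> q"
        by (auto simp: below_mod_def)
      have c: "s \<in> carrier L" "t \<in> carrier L" "t' \<in> carrier L" using t s basis_carrier by auto
      have "(s, s \<sqinter> (t \<squnion> t')) \<in> r"
        by (rule congruence_sandwich[OF lc[OF rq(1)] t(3)])
          (use c in \<open>auto intro!: meet_mono meet_left join_left\<close>)
      moreover have "(s, s \<sqinter> (t \<squnion> t')) \<in> q"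
        by (rule congruence_sandwich[OF lc[OF rq(2)] t(6)])
          (use c in \<open>auto intro!: meet_mono meet_left join_right\<close>)
      moreover have "t \<squnion> t' \<sqsubseteq> y" using t c y by (intro join_le)
      ultimately show "s \<in> below_mod (r \<inter> q) y"
        using s(1) basis_join[OF t(1,4)] by (auto simp: below_mod_def)
    qed
    then show "r \<sqinter>\<^bsub>CS\<^esub> q \<in> ?P" using int partial_meet[OF rq(1,2)] by simp
    let ?j = "r \<squnion>\<^bsub>CS\<^esub> q"
    have j: "?j \<in> carrier CS" using rq by simp
    interpret C: frame "congruence_frame L" by (rule frame_congruence_frame)
    have "r \<subseteq> basis_closure ?j" "q \<subseteq> basis_closure ?j"
      using subset_trans[OF rq(3) basis_closure_mono] subset_trans[OF rq(4) basis_closure_mono]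
        N.join_left[OF rq(1,2)] N.join_right[OF rq(1,2)] by simp_all
    then have "r \<squnion>\<^bsub>congruence_frame L\<^esub> q \<subseteq> basis_closure ?j"
      using C.join_le[of r "basis_closure ?j" q] frame_congruence_basis_closure[OF lc[OF j]] rq(1,2) partial_subset
      by auto
    then show "?j \<in> ?P" using j partial_join[OF rq(1,2)] by simp
  qed auto
  then show ?thesis using sym_basis_induct[OF _ gen] assms by blast
qed

lemma directed_union_lattice_congruence:
  assumes D: "D \<noteq> {}" "\<And>d. d \<in> D \<Longrightarrow> lattice_congruence d"
    and dir: "\<And>d d'. d \<in> D \<Longrightarrow> d' \<in> D \<Longrightarrow> \<exists>d''\<in>D. d \<subseteq> d'' \<and> d' \<subseteq> d''"
  shows "lattice_congruence (\<Union>D)"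
proof -
  have two: "\<exists>d\<in>D. p \<in> d \<and> q \<in> d" if pq: "p \<in> \<Union>D" "q \<in> \<Union>D" for p q
  proof -
    obtain d d' where "d \<in> D" "d' \<in> D" "p \<in> d" "q \<in> d'" using pq by blast
    then show ?thesis using dir[of d d'] by blast
  qed
  have "equiv (carrier L) (\<Union>D)"
  proof (rule equivI)
    show "\<Union>D \<subseteq> carrier L \<times> carrier L" using congruence_subset[OF D(2)] by blast
    show "refl_on (carrier L) (\<Union>D)" using D(1) congruence_refl[OF D(2)] by (fastforce simp: refl_on_def)
    show "sym (\<Union>D)" using congruence_sym[OF D(2)] by (blast intro: symI)
    show "trans (\<Union>D)"
    proof (rule transI)
      fix x y z assume "(x, y) \<in> \<Union>D" "(y, z) \<in> \<Union>D"
      then obtain d where "d \<in> D" "(x, y) \<in> d" "(y, z) \<in> d" using two by meson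
      then show "(x, z) \<in> \<Union>D" using congruence_trans[OF D(2)] by blast
    qed
  qed
  moreover have "(x \<sqinter> x', y \<sqinter> y') \<in> \<Union>D \<and> (x \<squnion> x', y \<squnion> y') \<in> \<Union>D"
    if "(x, y) \<in> \<Union>D" "(x', y') \<in> \<Union>D" for x y x' y'
  proof -
    obtain d where "d \<in> D" "(x, y) \<in> d" "(x', y') \<in> d" using two \<open>(x, y) \<in> _\<close> \<open>(x', y') \<in> _\<close> by meson
    then show ?thesis using congruence_meet[OF D(2)] congruence_join[OF D(2)] by blast
  qed
  ultimately show ?thesis unfolding lattice_congruence_def by blast
qed

text \<open>
  The basis closure of the directed union \<open>e\<close> of the finite joins contains the whole family. If
  the family joins to the top, then \<open>e\<close> identifies \<open>\<top>\<close> with a basic element below \<open>\<bottom>\<close>, and so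
  does already one of the finite joins.
\<close>

lemma symmetrization_top_compact: "compact_in CS \<top>\<^bsub>CS\<^esub>"
proof -
  interpret N: symmetric_frith CS sym_basis by (rule symmetric_frith_symmetrization)
  show ?thesis
  proof (rule N.compact_inI_basis)
    interpret C: frame "congruence_frame L" by (rule frame_congruence_frame)
    fix T assume T: "T \<subseteq> sym_basis" and le: "\<top>\<^bsub>CS\<^esub> \<sqsubseteq>\<^bsub>CS\<^esub> \<Squnion>\<^bsub>CS\<^esub>T"
    have Tc: "T \<subseteq> carrier CS" using T N.basis_subset by blast
    define D where "D = {\<Squnion>\<^bsub>CS\<^esub>F | F. F \<subseteq> T \<and> finite F}"
    define e where "e = \<Union>D"
    have Dc: "D \<subseteq> carrier CS" using Tc by (auto simp: D_def)
    have e: "lattice_congruence e"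
      unfolding e_def
    proof (rule directed_union_lattice_congruence)
      show "D \<noteq> {}" by (auto simp: D_def)
      show "lattice_congruence d" if "d \<in> D" for d
        using that Dc partial_subset by (auto intro!: lattice_congruence_if_frame)
      fix d d' assume "d \<in> D" "d' \<in> D"
      then obtain F F' where F: "F \<subseteq> T" "finite F" "d = \<Squnion>\<^bsub>CS\<^esub>F" "F' \<subseteq> T" "finite F'" "d' = \<Squnion>\<^bsub>CS\<^esub>F'"
        by (auto simp: D_def)
      have "d \<subseteq> \<Squnion>\<^bsub>CS\<^esub>(F \<union> F')" "d' \<subseteq> \<Squnion>\<^bsub>CS\<^esub>(F \<union> F')"
        using N.sup_mono[of F "F \<union> F'"] N.sup_mono[of F' "F \<union> F'"] subset_trans[OF F(1) Tc]
          subset_trans[OF F(4) Tc] F(3,6) by simp_all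
      moreover have "\<Squnion>\<^bsub>CS\<^esub>(F \<union> F') \<in> D" using F unfolding D_def by blast
      ultimately show "\<exists>d''\<in>D. d \<subseteq> d'' \<and> d' \<subseteq> d''" by blast
    qed
    have "t \<subseteq> basis_closure e" if t: "t \<in> T" for t
    proof -
      have tc: "t \<in> carrier CS" using t Tc by blast
      have "\<Squnion>\<^bsub>CS\<^esub>{t} \<in> D" using t unfolding D_def by blast
      then have "t \<subseteq> e" using tc by (auto simp: e_def)
      then show ?thesis using sym_basis_finitary[of t] basis_closure_mono[of t e] t T by blast
    qed
    then have "\<Squnion>\<^bsub>congruence_frame L\<^esub>T \<subseteq> basis_closure e"
      using C.sup_least[of T "basis_closure e"] Tc partial_subset frame_congruence_basis_closure[OF e] by auto
    then have "carrier L \<times> carrier L \<subseteq> basis_closure e" using le Tc by (simp add: partial_sup partial_top)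
    then have "(\<top>, \<bottom>) \<in> basis_closure e" by auto
    then have "\<top> \<in> below_mod e \<bottom>" using basis_top basis_carrier by (auto simp: basis_closure_def down_def)
    then obtain t where t: "t \<in> S" "t \<sqsubseteq> \<bottom>" "(\<top>, \<top> \<sqinter> t) \<in> e" by (auto simp: below_mod_def)
    have "t = \<bottom>" using t basis_carrier bottom_lower by (intro le_antisym) auto
    then have "(\<top>, \<bottom>) \<in> e" using t(3) meet_bottom[OF top_closed] by simp
    then obtain F where F: "F \<subseteq> T" "finite F" "(\<top>, \<bottom>) \<in> \<Squnion>\<^bsub>CS\<^esub>F" by (auto simp: e_def D_def)
    have Fc: "\<Squnion>\<^bsub>CS\<^esub>F \<in> carrier CS" using F Tc by auto
    then have lF: "lattice_congruence (\<Squnion>\<^bsub>CS\<^esub>F)" using partial_subset by (auto intro: lattice_congruence_if_frame)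
    have "nabla L \<top> \<subseteq> \<Squnion>\<^bsub>CS\<^esub>F"
      using nabla_subset_iff[OF lF top_closed] congruence_sym[OF lF F(3)] by simp
    moreover have "delta L \<top> \<subseteq> \<Squnion>\<^bsub>CS\<^esub>F"
      using congruence_refl[OF lF] by (auto simp: delta_def meet_comm[of L \<top>] meet_top)
    ultimately have "\<Squnion>\<^bsub>CS\<^esub>F = carrier L \<times> carrier L"
      using nabla_delta_complement(2)[OF top_closed lF] by blast
    then show "\<exists>F\<subseteq>T. finite F \<and> \<top>\<^bsub>CS\<^esub> \<sqsubseteq>\<^bsub>CS\<^esub> \<Squnion>\<^bsub>CS\<^esub>F" using F by (auto simp: partial_top intro!: exI[of _ F])
  qed simp
qed

theorem compact_basis_imp_complete: "frith_complete (L, S)"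
proof -
  interpret N: symmetric_frith CS sym_basis by (rule symmetric_frith_symmetrization)
  show ?thesis
    unfolding frith_complete_def frith_symmetrization_eq symmetric_frith_complete_def
    by (rule N.compact_basis_imp_complete_wrt[OF N.compact_basis_if_top_compact[OF symmetrization_top_compact]])
qed

end

corollary cfrith_iff: "cfrith (L, S) \<longleftrightarrow> compact_frith L S"
proof
  assume c: "cfrith (L, S)"
  then interpret frith L S by (simp add: cfrith_def frith_frame_iff)
  show "compact_frith L S"
    using c complete_imp_compact_basis by unfold_locales (simp add: cfrith_def)
next
  assume "compact_frith L S"
  then interpret compact_frith L S .
  show "cfrith (L, S)" using compact_basis_imp_complete frith_axioms by (simp add: cfrith_def frith_frame_iff)
qed

section \<open>Complete Pervin spaces are those realizing all prime filters\<close>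

definition pervin_prime_filter :: "'a pervin \<Rightarrow> 'a set set \<Rightarrow> bool" where
  "pervin_prime_filter P \<Phi> \<longleftrightarrow> \<Phi> \<subseteq> snd P \<and> fst P \<in> \<Phi> \<and> {} \<notin> \<Phi> \<and>
     (\<forall>A\<in>\<Phi>. \<forall>B\<in>snd P. A \<subseteq> B \<longrightarrow> B \<in> \<Phi>) \<and> (\<forall>A\<in>\<Phi>. \<forall>B\<in>\<Phi>. A \<inter> B \<in> \<Phi>) \<and>
     (\<forall>A\<in>snd P. \<forall>B\<in>snd P. A \<union> B \<in> \<Phi> \<longrightarrow> A \<in> \<Phi> \<or> B \<in> \<Phi>)"

definition realizes_prime_filters :: "'a pervin \<Rightarrow> bool" where
  "realizes_prime_filters P \<longleftrightarrow>
     (\<forall>\<Phi>. pervin_prime_filter P \<Phi> \<longrightarrow> (\<exists>x\<in>fst P. \<Phi> = {A \<in> snd P. x \<in> A}))"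

lemma
  assumes "pervin_space P"
  shows pervin_subset: "A \<in> snd P \<Longrightarrow> A \<subseteq> fst P"
    and pervin_empty: "{} \<in> snd P" and pervin_whole: "fst P \<in> snd P"
    and pervin_Int: "A \<in> snd P \<Longrightarrow> B \<in> snd P \<Longrightarrow> A \<inter> B \<in> snd P"
    and pervin_Un: "A \<in> snd P \<Longrightarrow> B \<in> snd P \<Longrightarrow> A \<union> B \<in> snd P"
  using assms by (auto simp: pervin_space_def)

lemma neighbourhood_prime_filter:
  "pervin_space P \<Longrightarrow> x \<in> fst P \<Longrightarrow> pervin_prime_filter P {A \<in> snd P. x \<in> A}"
  by (auto simp: pervin_prime_filter_def pervin_space_def)

lemma symmetric_pervinI:
  assumes "\<C> \<subseteq> Pow X" "X \<in> \<C>" "\<And>A. A \<in> \<C> \<Longrightarrow> X - A \<in> \<C>"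
    and Int: "\<And>A B. A \<in> \<C> \<Longrightarrow> B \<in> \<C> \<Longrightarrow> A \<inter> B \<in> \<C>"
  shows "symmetric_pervin_space (X, \<C>)"
proof -
  have "A \<union> B \<in> \<C>" if "A \<in> \<C>" "B \<in> \<C>" for A B
  proof -
    have "A \<union> B = X - ((X - A) \<inter> (X - B))" using assms(1) that by blast
    then show ?thesis using assms(3) Int that by simp
  qed
  moreover have "{} \<in> \<C>" using assms(3)[OF assms(2)] by simp
  ultimately have "pervin_space (X, \<C>)" using assms by (auto simp: pervin_space_def)
  moreover have "\<exists>B\<in>\<C>. A \<inter> B = {} \<and> A \<union> B = X" if "A \<in> \<C>" for A
    using assms(1,3) that by (intro bexI[of _ "X - A"]) auto
  ultimately show ?thesis by (simp add: symmetric_pervin_space_def)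
qed

lemma symmetric_pervin_complement:
  assumes "symmetric_pervin_space P" "A \<in> snd P"
  shows "fst P - A \<in> snd P"
proof -
  obtain B where B: "B \<in> snd P" "A \<inter> B = {}" "A \<union> B = fst P"
    using assms unfolding symmetric_pervin_space_def by blast
  then have "fst P - A = B" by blast
  then show ?thesis using B by simp
qed

lemma symmetric_generated_boolean_algebra:
  assumes P: "pervin_space P"
  shows "symmetric_pervin_space (fst P, generated_boolean_algebra P)"
proof (rule symmetric_pervinI)
  let ?all = "{B. symmetric_pervin_space (fst P, B) \<and> snd P \<subseteq> B}"
  have "Pow (fst P) \<in> ?all" using pervin_subset[OF P] by (auto intro!: symmetric_pervinI)
  then show "generated_boolean_algebra P \<subseteq> Pow (fst P)" unfolding generated_boolean_algebra_def by blast
  have all: "pervin_space (fst P, B)" if "B \<in> ?all" for B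
    using that by (simp add: symmetric_pervin_space_def)
  show "fst P \<in> generated_boolean_algebra P"
    using pervin_whole[OF all] by (simp add: generated_boolean_algebra_def)
  show "fst P - A \<in> generated_boolean_algebra P" if "A \<in> generated_boolean_algebra P" for A
    using that symmetric_pervin_complement[of "(fst P, B)" A for B]
    by (simp add: generated_boolean_algebra_def)
  show "A \<inter> B \<in> generated_boolean_algebra P"
    if "A \<in> generated_boolean_algebra P" "B \<in> generated_boolean_algebra P" for A B
    using that pervin_Int[OF all, of _ A B] by (simp add: generated_boolean_algebra_def)
qed

lemma generated_boolean_algebra_upper: "snd P \<subseteq> generated_boolean_algebra P"
  by (auto simp: generated_boolean_algebra_def)

lemma generated_boolean_algebra_induct:
  "symmetric_pervin_space (fst P, \<C>) \<Longrightarrow> snd P \<subseteq> \<C> \<Longrightarrow> generated_boolean_algebra P \<subseteq> \<C>"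
  by (auto simp: generated_boolean_algebra_def)

text \<open>
  The space of all prime filters of a Boolean algebra of sets is a dense \<open>T\<^sub>0\<close> extension, so a
  complete space contains all its points.
\<close>

lemma symmetric_complete_realizes:
  fixes P :: "'a pervin"
  assumes sym: "symmetric_pervin_space P" and t0: "t0_space (pervin_topology P)"
    and complete: "symmetric_pervin_complete P"
  shows "realizes_prime_filters P"
proof -
  have P: "pervin_space P" using sym by (simp add: symmetric_pervin_space_def)
  \<comment> \<open>The points of \<open>Q\<close> are the prime filters, with basic sets \<open>e A\<close>; \<open>f\<close> is the embedding.\<close>
  define Y where "Y = {\<Phi>. pervin_prime_filter P \<Phi>}"
  define e where "e A = {\<Phi> \<in> Y. A \<in> \<Phi>}" for A
  define Q where "Q = (Y, e ` snd P)"
  have Y: "\<Phi> \<subseteq> snd P" "fst P \<in> \<Phi>" "{} \<notin> \<Phi>" "A \<in> \<Phi> \<Longrightarrow> B \<in> snd P \<Longrightarrow> A \<subseteq> B \<Longrightarrow> B \<in> \<Phi>"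
    "A \<in> \<Phi> \<Longrightarrow> B \<in> \<Phi> \<Longrightarrow> A \<inter> B \<in> \<Phi>"
    "A \<in> snd P \<Longrightarrow> B \<in> snd P \<Longrightarrow> A \<union> B \<in> \<Phi> \<Longrightarrow> A \<in> \<Phi> \<or> B \<in> \<Phi>"
    if "\<Phi> \<in> Y" for \<Phi> A B
    using that by (auto simp: Y_def pervin_prime_filter_def)
  have e_Int: "e A \<inter> e B = e (A \<inter> B)" if "A \<in> snd P" "B \<in> snd P" for A B
    using Y(4)[of _ "A \<inter> B" A] Y(4)[of _ "A \<inter> B" B] Y(5) that unfolding e_def by blast
  have e_compl: "Y - e A = e (fst P - A)" if A: "A \<in> snd P" for A
  proof -
    have A': "fst P - A \<in> snd P" by (rule symmetric_pervin_complement[OF sym A])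
    have "A \<in> \<Phi> \<longleftrightarrow> fst P - A \<notin> \<Phi>" if \<Phi>: "\<Phi> \<in> Y" for \<Phi>
    proof -
      have "A \<union> (fst P - A) = fst P" "A \<inter> (fst P - A) = {}" using pervin_subset[OF P A] by auto
      then show ?thesis using Y(6)[OF \<Phi> A A'] Y(5)[OF \<Phi>, of A "fst P - A"] Y(2,3)[OF \<Phi>] by auto
    qed
    then show ?thesis unfolding e_def by blast
  qed
  have symQ: "symmetric_pervin_space Q"
    unfolding Q_def
  proof (rule symmetric_pervinI)
    show "e ` snd P \<subseteq> Pow Y" by (auto simp: e_def)
    have "e (fst P) = Y" using Y(2) by (auto simp: e_def)
    then show "Y \<in> e ` snd P" using pervin_whole[OF P] by blast
    show "Y - U \<in> e ` snd P" if "U \<in> e ` snd P" for U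
      using that e_compl symmetric_pervin_complement[OF sym] by auto
    show "U \<inter> V \<in> e ` snd P" if "U \<in> e ` snd P" "V \<in> e ` snd P" for U V
      using that e_Int pervin_Int[OF P] by auto
  qed
  then have Q: "pervin_space Q" by (simp add: symmetric_pervin_space_def)
  have Q_simps: "fst Q = Y" "snd Q = e ` snd P" by (simp_all add: Q_def)
  have t0Q: "t0_space (pervin_topology Q)"
    unfolding t0_pervin_iff[OF Q] Q_simps
  proof (intro ballI impI)
    fix \<Phi> \<Psi> assume \<Phi>: "\<Phi> \<in> Y" "\<Psi> \<in> Y" and eq: "\<forall>T\<in>e ` snd P. \<Phi> \<in> T \<longleftrightarrow> \<Psi> \<in> T"
    have "A \<in> \<Phi> \<longleftrightarrow> A \<in> \<Psi>" if "A \<in> snd P" for A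
      using bspec[OF eq imageI[OF that]] \<Phi> by (simp add: e_def)
    then show "\<Phi> = \<Psi>" using Y(1)[OF \<Phi>(1)] Y(1)[OF \<Phi>(2)] by blast
  qed
  define f where "f = (\<lambda>x\<in>fst P. {A \<in> snd P. x \<in> A})"
  have fY: "f x \<in> Y" if "x \<in> fst P" for x
    using neighbourhood_prime_filter[OF P that] that by (simp add: f_def Y_def)
  have pre: "f -` e A \<inter> fst P = A" if "A \<in> snd P" for A
    using pervin_subset[OF P that] that fY by (auto simp: e_def f_def)
  have hom: "f \<in> pervin_hom P Q"
    using fY pre by (auto simp: pervin_hom_def Q_simps f_def)
  have "inj_on f (fst P)"
  proof (rule inj_onI)
    fix x y assume xy: "x \<in> fst P" "y \<in> fst P" "f x = f y"
    then have "{A \<in> snd P. x \<in> A} = {A \<in> snd P. y \<in> A}" by (simp add: f_def)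
    then have "\<forall>A\<in>snd P. x \<in> A \<longleftrightarrow> y \<in> A" by blast
    then show "x = y" using t0 xy(1,2) unfolding t0_pervin_iff[OF P] by blast
  qed
  moreover have "\<exists>T\<in>snd Q. A = f -` T \<inter> fst P" if "A \<in> snd P" for A
    using pre[OF that] that by (auto simp: Q_simps)
  ultimately have "pervin_extremal_mono P Q f" using hom by (simp add: pervin_extremal_mono_def)
  moreover have "pervin_dense P Q f"
    unfolding pervin_dense_iff[OF Q] Q_simps
  proof (intro ballI impI)
    fix T assume T: "T \<in> e ` snd P" "T \<noteq> {}"
    then obtain A where A: "A \<in> snd P" "T = e A" by blast
    have "A \<noteq> {}" using T(2) A(2) Y(3) by (auto simp: e_def)
    then show "T \<inter> f ` fst P \<noteq> {}" using pre[OF A(1)] A(2) by blast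
  qed
  ultimately have "pervin_iso P Q f"
    using complete[unfolded symmetric_pervin_complete_def symmetric_pervin_complete_wrt_def,
        rule_format, of Q f] symQ t0Q by blast
  then obtain g where g: "g \<in> pervin_hom Q P" "pervin_comp Q f g = pervin_id Q"
    by (auto simp: pervin_iso_def)
  show ?thesis
    unfolding realizes_prime_filters_def
  proof (intro allI impI)
    fix \<Phi> assume "pervin_prime_filter P \<Phi>"
    then have \<Phi>: "\<Phi> \<in> fst Q" by (simp add: Q_simps Y_def)
    have gx: "g \<Phi> \<in> fst P" using g(1) \<Phi> by (auto simp: pervin_hom_def dest: PiE_mem)
    have "f (g \<Phi>) = \<Phi>"
      using fun_cong[OF g(2), of \<Phi>] \<Phi> by (simp add: pervin_comp_def pervin_id_def compose_def)
    then show "\<exists>x\<in>fst P. \<Phi> = {A \<in> snd P. x \<in> A}" using gx by (auto simp: f_def)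
  qed
qed

text \<open>
  A prime filter \<open>\<Phi>\<close> of the lattice decides every set in the generated Boolean algebra: the sets
  containing some \<open>A - B\<close> with \<open>A \<in> \<Phi>\<close> and \<open>B \<notin> \<Phi>\<close> form its unique extension to an ultrafilter.
\<close>

lemma prime_filter_extends_to_generated_algebra:
  assumes P: "pervin_space P" and \<Phi>: "pervin_prime_filter P \<Phi>"
  obtains \<Psi> where "pervin_prime_filter (fst P, generated_boolean_algebra P) \<Psi>" "\<Phi> = \<Psi> \<inter> snd P"
proof -
  let ?X = "fst P" and ?B = "generated_boolean_algebra P"
  have F: "\<Phi> \<subseteq> snd P" "?X \<in> \<Phi>" "{} \<notin> \<Phi>" "\<And>A B. A \<in> \<Phi> \<Longrightarrow> B \<in> snd P \<Longrightarrow> A \<subseteq> B \<Longrightarrow> B \<in> \<Phi>"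
    "\<And>A B. A \<in> \<Phi> \<Longrightarrow> B \<in> \<Phi> \<Longrightarrow> A \<inter> B \<in> \<Phi>"
    "\<And>A B. A \<in> snd P \<Longrightarrow> B \<in> snd P \<Longrightarrow> A \<union> B \<in> \<Phi> \<Longrightarrow> A \<in> \<Phi> \<or> B \<in> \<Phi>"
    using \<Phi> by (auto simp: pervin_prime_filter_def)
  have symB: "symmetric_pervin_space (?X, ?B)" by (rule symmetric_generated_boolean_algebra[OF P])
  then have B: "pervin_space (?X, ?B)" by (simp add: symmetric_pervin_space_def)
  define large where "large C \<longleftrightarrow> (\<exists>A\<in>\<Phi>. \<exists>B\<in>snd P - \<Phi>. A - B \<subseteq> C)" for C
  have large_Int: "large (C \<inter> D)" if CD: "large C" "large D" for C D
  proof -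
    obtain A B where AB: "A \<in> \<Phi>" "B \<in> snd P - \<Phi>" "A - B \<subseteq> C" using CD(1) by (auto simp: large_def)
    obtain A' B' where AB': "A' \<in> \<Phi>" "B' \<in> snd P - \<Phi>" "A' - B' \<subseteq> D" using CD(2) by (auto simp: large_def)
    have "B \<union> B' \<in> snd P - \<Phi>" using AB AB' F(6)[of B B'] pervin_Un[OF P] by auto
    moreover have "(A \<inter> A') - (B \<union> B') \<subseteq> C \<inter> D" using AB(3) AB'(3) by blast
    ultimately show ?thesis using F(5)[OF AB(1) AB'(1)] unfolding large_def by blast
  qed
  have large_mono: "large D" if "large C" "C \<subseteq> D" for C D
    using that unfolding large_def by (meson subset_trans)
  have not_large_empty: "\<not> large {}" using F(4) unfolding large_def by auto
  have empty: "{} \<in> snd P - \<Phi>" using F(3) pervin_empty[OF P] by simp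
  have large_in: "large A" if "A \<in> \<Phi>" for A
    using that empty unfolding large_def by blast
  have large_out: "large (?X - A)" if "A \<in> snd P" "A \<notin> \<Phi>" for A
    using that F(2) unfolding large_def by blast
  let ?decided = "{C \<in> Pow ?X. large C \<or> large (?X - C)}"
  have "symmetric_pervin_space (?X, ?decided)"
  proof (rule symmetric_pervinI)
    show "?X \<in> ?decided" using large_in[OF F(2)] by simp
    show "?X - A \<in> ?decided" if "A \<in> ?decided" for A using that by (auto simp: double_diff)
    show "A \<inter> B \<in> ?decided" if "A \<in> ?decided" "B \<in> ?decided" for A B
      using that large_Int[of A B] large_mono[of "?X - A" "?X - A \<inter> B"] large_mono[of "?X - B" "?X - A \<inter> B"]
      by blast
  qed auto
  moreover have "snd P \<subseteq> ?decided" using large_in large_out pervin_subset[OF P] by blast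
  ultimately have decided: "?B \<subseteq> ?decided" by (rule generated_boolean_algebra_induct)
  define \<Psi> where "\<Psi> = {C \<in> ?B. large C}"
  have "pervin_prime_filter (?X, ?B) \<Psi>"
    unfolding pervin_prime_filter_def fst_conv snd_conv
  proof (intro conjI ballI impI)
    show "\<Psi> \<subseteq> ?B" "{} \<notin> \<Psi>" using not_large_empty by (auto simp: \<Psi>_def)
    show "?X \<in> \<Psi>" using large_in[OF F(2)] pervin_whole[OF B] by (simp add: \<Psi>_def)
    show "D \<in> \<Psi>" if "C \<in> \<Psi>" "D \<in> ?B" "C \<subseteq> D" for C D
      using that large_mono by (auto simp: \<Psi>_def)
    show "C \<inter> D \<in> \<Psi>" if "C \<in> \<Psi>" "D \<in> \<Psi>" for C D
      using that large_Int pervin_Int[OF B] by (auto simp: \<Psi>_def)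
    show "C \<in> \<Psi> \<or> D \<in> \<Psi>" if CD: "C \<in> ?B" "D \<in> ?B" "C \<union> D \<in> \<Psi>" for C D
    proof (rule ccontr)
      assume "\<not> (C \<in> \<Psi> \<or> D \<in> \<Psi>)"
      then have "large (?X - C)" "large (?X - D)" "large (C \<union> D)" using CD decided by (auto simp: \<Psi>_def)
      then have "large ((?X - C) \<inter> (?X - D) \<inter> (C \<union> D))" using large_Int by blast
      moreover have "(?X - C) \<inter> (?X - D) \<inter> (C \<union> D) = {}" by blast
      ultimately show False using not_large_empty by simp
    qed
  qed
  moreover have "\<Phi> = \<Psi> \<inter> snd P"
  proof
    show "\<Phi> \<subseteq> \<Psi> \<inter> snd P" using F(1) large_in generated_boolean_algebra_upper[of P] by (auto simp: \<Psi>_def)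
    show "\<Psi> \<inter> snd P \<subseteq> \<Phi>"
    proof
      fix A assume A: "A \<in> \<Psi> \<inter> snd P"
      then have "large A" by (simp add: \<Psi>_def)
      then have "A \<in> \<Phi>" if "A \<notin> \<Phi>"
        using large_Int[OF _ large_out[OF _ that]] not_large_empty A by (metis Diff_disjoint IntE)
      then show "A \<in> \<Phi>" by blast
    qed
  qed
  ultimately show thesis by (rule that)
qed

lemma t0_generated_boolean_algebra:
  assumes P: "pervin_space P" and t0: "t0_space (pervin_topology P)"
  shows "t0_space (pervin_topology (fst P, generated_boolean_algebra P))"
proof -
  have B: "pervin_space (fst P, generated_boolean_algebra P)"
    using symmetric_generated_boolean_algebra[OF P] by (simp add: symmetric_pervin_space_def)
  show ?thesis
    using t0 generated_boolean_algebra_upper[of P] unfolding t0_pervin_iff[OF P] t0_pervin_iff[OF B]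
    by (simp add: subset_iff)
qed

text \<open>
  Conversely, a point \<open>y\<close> of a dense extension traces a prime filter on \<open>P\<close>; a point realizing
  it is sent to \<open>y\<close>, since the two cannot be separated.
\<close>

lemma realizes_imp_complete_wrt:
  fixes P :: "'a pervin"
  assumes P: "pervin_space P" and real: "realizes_prime_filters P"
  shows "symmetric_pervin_complete_wrt TYPE('b) (fst P, generated_boolean_algebra P)"
  unfolding symmetric_pervin_complete_wrt_def
proof (intro allI impI, elim conjE)
  let ?B = "generated_boolean_algebra P"
  fix Q :: "'b pervin" and f
  assume symQ: "symmetric_pervin_space Q" and t0: "t0_space (pervin_topology Q)"
    and mono: "pervin_extremal_mono (fst P, ?B) Q f" and dense: "pervin_dense (fst P, ?B) Q f"
  have Q: "pervin_space Q" using symQ by (simp add: symmetric_pervin_space_def)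
  have f: "f \<in> fst P \<rightarrow>\<^sub>E fst Q" "\<And>T. T \<in> snd Q \<Longrightarrow> f -` T \<inter> fst P \<in> ?B"
    "\<And>A. A \<in> ?B \<Longrightarrow> \<exists>T\<in>snd Q. A = f -` T \<inter> fst P"
    using mono by (auto simp: pervin_extremal_mono_def pervin_hom_def)
  have dT: "f -` T \<inter> fst P \<noteq> {}" if "T \<in> snd Q" "T \<noteq> {}" for T
    using dense that unfolding pervin_dense_iff[OF Q] by fastforce
  have reflect: "T \<subseteq> T'" if TT: "T \<in> snd Q" "T' \<in> snd Q" "f -` T \<inter> fst P \<subseteq> f -` T' \<inter> fst P" for T T'
  proof -
    have "T \<inter> (fst Q - T') \<in> snd Q" using pervin_Int[OF Q TT(1) symmetric_pervin_complement[OF symQ TT(2)]] .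
    moreover have "f -` (T \<inter> (fst Q - T')) \<inter> fst P = {}" using TT(3) by blast
    ultimately have "T \<inter> (fst Q - T') = {}" using dT by blast
    then show ?thesis using pervin_subset[OF Q TT(1)] by blast
  qed
  have "fst Q \<subseteq> f ` fst P"
  proof
    fix y assume y: "y \<in> fst Q"
    define \<Phi> where "\<Phi> = {A \<in> snd P. \<exists>T\<in>snd Q. A = f -` T \<inter> fst P \<and> y \<in> T}"
    have mem: "A \<in> \<Phi> \<longleftrightarrow> y \<in> T" if "A \<in> snd P" "T \<in> snd Q" "A = f -` T \<inter> fst P" for A T
      using that reflect[of _ T] unfolding \<Phi>_def by blast
    have ex: "\<exists>T\<in>snd Q. A = f -` T \<inter> fst P" if "A \<in> snd P" for A
      using f(3) that generated_boolean_algebra_upper[of P] by blast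
    have fQ: "f -` fst Q \<inter> fst P = fst P" using f(1) by auto
    have "pervin_prime_filter P \<Phi>"
      unfolding pervin_prime_filter_def
    proof (intro conjI ballI impI)
      show "\<Phi> \<subseteq> snd P" by (auto simp: \<Phi>_def)
      show "fst P \<in> \<Phi>" using mem[OF pervin_whole[OF P] pervin_whole[OF Q]] fQ y by simp
      show "{} \<notin> \<Phi>" using mem[OF pervin_empty[OF P] pervin_empty[OF Q]] by simp
      fix A B assume AB: "A \<in> \<Phi>" "B \<in> \<Phi>"
      then obtain T U where T: "A \<in> snd P" "T \<in> snd Q" "A = f -` T \<inter> fst P" "y \<in> T"
        and U: "B \<in> snd P" "U \<in> snd Q" "B = f -` U \<inter> fst P" "y \<in> U"
        by (auto simp: \<Phi>_def)
      have "A \<inter> B = f -` (T \<inter> U) \<inter> fst P" using T(3) U(3) by blast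
      then show "A \<inter> B \<in> \<Phi>"
        using mem[OF pervin_Int[OF P T(1) U(1)] pervin_Int[OF Q T(2) U(2)]] T(4) U(4) by simp
    next
      fix A B assume A: "A \<in> \<Phi>" and B: "B \<in> snd P" and sub: "A \<subseteq> B"
      obtain T where T: "T \<in> snd Q" "A = f -` T \<inter> fst P" "y \<in> T" using A by (auto simp: \<Phi>_def)
      obtain U where U: "U \<in> snd Q" "B = f -` U \<inter> fst P" using ex[OF B] by blast
      show "B \<in> \<Phi>" using reflect[OF T(1) U(1)] sub T U mem[OF B U] by blast
    next
      fix A B assume AB: "A \<in> snd P" "B \<in> snd P" "A \<union> B \<in> \<Phi>"
      obtain T where T: "T \<in> snd Q" "A = f -` T \<inter> fst P" using ex[OF AB(1)] by blast
      obtain U where U: "U \<in> snd Q" "B = f -` U \<inter> fst P" using ex[OF AB(2)] by blast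
      have "A \<union> B = f -` (T \<union> U) \<inter> fst P" using T(2) U(2) by blast
      then have "y \<in> T \<union> U" using mem[OF pervin_Un[OF P AB(1,2)] pervin_Un[OF Q T(1) U(1)]] AB(3) by simp
      then show "A \<in> \<Phi> \<or> B \<in> \<Phi>" using mem[OF AB(1) T] mem[OF AB(2) U] by blast
    qed
    then obtain x where x: "x \<in> fst P" "\<Phi> = {A \<in> snd P. x \<in> A}"
      using real unfolding realizes_prime_filters_def by blast
    let ?agree = "{A \<in> Pow (fst P). \<forall>T\<in>snd Q. A = f -` T \<inter> fst P \<longrightarrow> (f x \<in> T \<longleftrightarrow> y \<in> T)} \<inter> ?B"
    have fx: "f x \<in> fst Q" using f(1) x(1) by auto
    have agreeI: "A \<in> ?agree" if "A \<in> ?B" "T \<in> snd Q" "A = f -` T \<inter> fst P" "f x \<in> T \<longleftrightarrow> y \<in> T" for A T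
    proof -
      have "T' = T" if "T' \<in> snd Q" "A = f -` T' \<inter> fst P" for T'
        using reflect[of T T'] reflect[of T' T] that \<open>T \<in> snd Q\<close> \<open>A = f -` T \<inter> fst P\<close> by blast
      then show ?thesis using that by auto
    qed
    have symB: "symmetric_pervin_space (fst P, ?B)" by (rule symmetric_generated_boolean_algebra[OF P])
    then have B: "pervin_space (fst P, ?B)" by (simp add: symmetric_pervin_space_def)
    \<comment> \<open>Basic sets of \<open>Q\<close> are determined by their preimages, so agreement at \<open>f x\<close> and \<open>y\<close> is a
      property of the preimage and can be propagated through the generated algebra.\<close>
    have "symmetric_pervin_space (fst P, ?agree)"
    proof (rule symmetric_pervinI)
      show "fst P \<in> ?agree"
        using pervin_whole[OF B] pervin_whole[OF Q] fQ fx y by (intro agreeI[of _ "fst Q"]) auto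
      fix A assume A: "A \<in> ?agree"
      then have AB: "A \<in> ?B" by simp
      obtain T where T: "T \<in> snd Q" "A = f -` T \<inter> fst P" using f(3)[OF AB] by blast
      have T': "f x \<in> T \<longleftrightarrow> y \<in> T" using A T by simp
      have "fst P - A = f -` (fst Q - T) \<inter> fst P" using T(2) f(1) by auto
      then show "fst P - A \<in> ?agree"
        using symmetric_pervin_complement[OF symB, of A] A symmetric_pervin_complement[OF symQ T(1)] T' fx y
        by (intro agreeI[of _ "fst Q - T"]) simp_all
      fix B' assume B': "B' \<in> ?agree"
      then have BB: "B' \<in> ?B" by simp
      obtain U where U: "U \<in> snd Q" "B' = f -` U \<inter> fst P" using f(3)[OF BB] by blast
      have U': "f x \<in> U \<longleftrightarrow> y \<in> U" using B' U by simp
      show "A \<inter> B' \<in> ?agree"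
      proof (rule agreeI[OF _ pervin_Int[OF Q T(1) U(1)]])
        show "A \<inter> B' \<in> ?B" using pervin_Int[OF B, of A B'] AB BB by simp
        show "A \<inter> B' = f -` (T \<inter> U) \<inter> fst P" using T(2) U(2) by blast
      qed (use T' U' in simp)
    qed auto
    moreover have "snd P \<subseteq> ?agree"
    proof
      fix A assume A: "A \<in> snd P"
      obtain T where T: "T \<in> snd Q" "A = f -` T \<inter> fst P" using ex[OF A] by blast
      have "f x \<in> T \<longleftrightarrow> x \<in> A" using T(2) x(1) by blast
      also have "\<dots> \<longleftrightarrow> y \<in> T" using mem[OF A T] x(2) A by blast
      finally show "A \<in> ?agree" using A generated_boolean_algebra_upper[of P] T by (intro agreeI) auto
    qed
    ultimately have "?B \<subseteq> ?agree" by (rule generated_boolean_algebra_induct)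
    then have "\<forall>T\<in>snd Q. f x \<in> T \<longleftrightarrow> y \<in> T" using f(2) by blast
    then have "f x = y" using t0 fx y unfolding t0_pervin_iff[OF Q] by blast
    then show "y \<in> f ` fst P" using x(1) by blast
  qed
  then have "f ` fst (fst P, ?B) = fst Q" using f(1) by auto
  then show "pervin_iso (fst P, ?B) Q f" by (rule surj_extremal_mono_iso[OF Q mono])
qed

text \<open>
  Completeness concerns the generated Boolean algebra, realization the lattice itself; the
  extension of prime filters makes up the difference.
\<close>

theorem cpervin_iff:
  "cpervin P \<longleftrightarrow> pervin_space P \<and> t0_space (pervin_topology P) \<and> realizes_prime_filters P"
proof
  assume c: "cpervin P"
  then have P: "pervin_space P" and t0: "t0_space (pervin_topology P)"
    and complete: "symmetric_pervin_complete (fst P, generated_boolean_algebra P)"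
    by (auto simp: cpervin_def pervin_complete_def)
  have real: "realizes_prime_filters (fst P, generated_boolean_algebra P)"
    by (rule symmetric_complete_realizes[OF symmetric_generated_boolean_algebra[OF P]
          t0_generated_boolean_algebra[OF P t0] complete])
  have "realizes_prime_filters P"
    unfolding realizes_prime_filters_def
  proof (intro allI impI)
    fix \<Phi> assume "pervin_prime_filter P \<Phi>"
    then obtain \<Psi> where \<Psi>: "pervin_prime_filter (fst P, generated_boolean_algebra P) \<Psi>" "\<Phi> = \<Psi> \<inter> snd P"
      by (rule prime_filter_extends_to_generated_algebra[OF P])
    then obtain x where "x \<in> fst P" "\<Psi> = {A \<in> generated_boolean_algebra P. x \<in> A}"
      using real unfolding realizes_prime_filters_def by auto
    then show "\<exists>x\<in>fst P. \<Phi> = {A \<in> snd P. x \<in> A}"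
      using \<Psi>(2) generated_boolean_algebra_upper[of P] by blast
  qed
  then show "pervin_space P \<and> t0_space (pervin_topology P) \<and> realizes_prime_filters P" using P t0 by blast
next
  assume "pervin_space P \<and> t0_space (pervin_topology P) \<and> realizes_prime_filters P"
  then show "cpervin P"
    using realizes_imp_complete_wrt[of P]
    by (simp add: cpervin_def pervin_complete_def symmetric_pervin_complete_def)
qed

section \<open>Prime filters and points\<close>

context frith
begin

definition prime_filter :: "'a set \<Rightarrow> bool" where
  "prime_filter F \<longleftrightarrow> F \<subseteq> S \<and> \<top> \<in> F \<and> \<bottom> \<notin> F \<and> (\<forall>a\<in>F. \<forall>b\<in>S. a \<sqsubseteq> b \<longrightarrow> b \<in> F) \<and>
     (\<forall>a\<in>F. \<forall>b\<in>F. a \<sqinter> b \<in> F) \<and> (\<forall>a\<in>S. \<forall>b\<in>S. a \<squnion> b \<in> F \<longrightarrow> a \<in> F \<or> b \<in> F)"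

lemma prime_filter_finite_sup:
  assumes F: "prime_filter F" and "finite T" "T \<subseteq> S" "\<Squnion>T \<in> F"
  shows "\<exists>t\<in>T. t \<in> F"
  using assms(2-)
proof (induction T)
  case empty
  then show ?case using F by (simp add: sup_empty prime_filter_def)
next
  case (insert t T)
  then have tT: "t \<in> S" "T \<subseteq> S" "t \<in> carrier L" "T \<subseteq> carrier L" using basis_subset by auto
  then have "t \<squnion> \<Squnion>T \<in> F" "\<Squnion>T \<in> S"
    using insert.prems(2) finite_sup_in_basis[OF insert.hyps(1)] by (simp_all add: sup_insert)
  then have "t \<in> F \<or> \<Squnion>T \<in> F" using F tT(1) by (simp add: prime_filter_def)
  then show ?case using insert by auto
qed

text \<open>
  A prime ideal of the lattice of basic elements below \<open>s\<close> extending the trace of \<open>I\<close> turns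
  mere properness into separation from \<open>s\<close>.
\<close>

lemma prime_filter_separation:
  assumes pit: "prime_ideal_theorem TYPE('a)"
    and I: "I \<in> ideals" and s: "s \<in> S" "s \<notin> I"
  obtains F where "prime_filter F" "s \<in> F" "F \<inter> I = {}"
proof -
  let ?T = "down s" and ?D = "L\<lparr>carrier := down s\<rparr>"
  have sc: "s \<in> carrier L" by (rule basis_carrier[OF s(1)])
  have T: "?T \<in> ideals" by (rule down_in[OF sc])
  note Tc = subsetD[OF ideals_carrier[OF T]]
  have T_le: "a \<sqsubseteq> s" if "a \<in> ?T" for a using that by (simp add: down_def)
  have T_join: "a \<squnion> b \<in> ?T" if "a \<in> ?T" "b \<in> ?T" for a b using ideals_join[OF T that] .
  have T_meet: "a \<sqinter> b \<in> ?T" if ab: "a \<in> ?T" "b \<in> ?T" for a b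
    using ideals_down[OF T ab(1), of "a \<sqinter> b"] ab Tc meet_left basis_meet by (simp add: down_def)
  have sT: "s \<in> ?T" using s(1) sc by (simp add: down_def)
  interpret D: partial_order ?D
    by unfold_locales (use Tc in \<open>auto simp: eq_is_equal intro: le_antisym dest: le_trans\<close>)
  have join_D: "a \<squnion>\<^bsub>?D\<^esub> b = a \<squnion> b" if ab: "a \<in> ?T" "b \<in> ?T" for a b
    unfolding join_def[of ?D]
    by (rule D.sup_eqI) (use ab Tc T_join join_left join_right join_le in auto)
  have meet_D: "a \<sqinter>\<^bsub>?D\<^esub> b = a \<sqinter> b" if ab: "a \<in> ?T" "b \<in> ?T" for a b
    unfolding meet_def[of ?D]
    by (rule D.inf_eqI) (use ab Tc T_meet meet_left meet_right meet_le in auto)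
  have "bounded_lattice ?D"
  proof
    fix a b assume "a \<in> carrier ?D" "b \<in> carrier ?D"
    then have ab: "a \<in> ?T" "b \<in> ?T" by auto
    have "is_lub ?D (a \<squnion> b) {a, b}"
      by (rule least_UpperI) (use ab Tc T_join join_left join_right join_le in \<open>auto simp: Upper_def\<close>)
    then show "\<exists>j. is_lub ?D j {a, b}" ..
    have "is_glb ?D (a \<sqinter> b) {a, b}"
      by (rule greatest_LowerI) (use ab Tc T_meet meet_left meet_right meet_le in \<open>auto simp: Lower_def\<close>)
    then show "\<exists>m. is_glb ?D m {a, b}" ..
  next
    show "\<exists>b. least ?D b (carrier ?D)"
      using ideals_bottom[OF T] bottom_lower Tc by (auto simp: least_def intro!: exI[of _ \<bottom>])
    show "\<exists>t. greatest ?D t (carrier ?D)"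
      using sT T_le by (auto simp: greatest_def intro!: exI[of _ s])
  qed
  then have D: "bounded_distributive_lattice ?D"
    using Tc T_join T_meet by (simp add: bounded_distributive_lattice_def join_D meet_D meet_join_distrib)
  have "proper_lattice_ideal ?D (I \<inter> ?T)"
    unfolding proper_lattice_ideal_def lattice_ideal_def
  proof (intro conjI ballI impI)
    have IT: "I \<inter> ?T \<in> ideals" by (rule ideals_Int[OF I T])
    show "I \<inter> ?T \<subseteq> carrier ?D" by simp
    show "I \<inter> ?T \<noteq> {}" using ideals_bottom[OF IT] by blast
    show "a \<in> I \<inter> ?T" if "a \<in> carrier ?D" "b \<in> I \<inter> ?T" "a \<sqsubseteq>\<^bsub>?D\<^esub> b" for a b
      using ideals_down[OF IT that(2), of a] that(1,3) ideals_subset[OF T] by auto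
    show "a \<squnion>\<^bsub>?D\<^esub> b \<in> I \<inter> ?T" if "a \<in> I \<inter> ?T" "b \<in> I \<inter> ?T" for a b
      using ideals_join[OF IT that] join_D[of a b] that by simp
    show "I \<inter> ?T \<noteq> carrier ?D" using sT s(2) by auto
  qed
  then obtain J where J: "prime_lattice_ideal ?D J" "I \<inter> ?T \<subseteq> J"
    using pit D unfolding prime_ideal_theorem_def by blast
  have J_sub: "J \<subseteq> ?T" and J_ne: "J \<noteq> {}" and J_prop: "J \<noteq> ?T"
    and J_down: "\<And>a b. b \<in> J \<Longrightarrow> a \<in> ?T \<Longrightarrow> a \<sqsubseteq> b \<Longrightarrow> a \<in> J"
    and J_join: "\<And>a b. a \<in> J \<Longrightarrow> b \<in> J \<Longrightarrow> a \<squnion> b \<in> J"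
    and J_prime: "\<And>a b. a \<in> ?T \<Longrightarrow> b \<in> ?T \<Longrightarrow> a \<sqinter> b \<in> J \<Longrightarrow> a \<in> J \<or> b \<in> J"
  proof -
    have J': "J \<subseteq> ?T \<and> J \<noteq> {} \<and> (\<forall>a\<in>?T. \<forall>b\<in>J. a \<sqsubseteq> b \<longrightarrow> a \<in> J) \<and>
        (\<forall>a\<in>J. \<forall>b\<in>J. a \<squnion>\<^bsub>?D\<^esub> b \<in> J) \<and> J \<noteq> ?T \<and>
        (\<forall>a\<in>?T. \<forall>b\<in>?T. a \<sqinter>\<^bsub>?D\<^esub> b \<in> J \<longrightarrow> a \<in> J \<or> b \<in> J)"
      using J(1) by (simp add: prime_lattice_ideal_def proper_lattice_ideal_def lattice_ideal_def)
    show "J \<subseteq> ?T" "J \<noteq> {}" "J \<noteq> ?T" using J' by simp_all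
    show "a \<in> J" if "b \<in> J" "a \<in> ?T" "a \<sqsubseteq> b" for a b using J' that by metis
    show "a \<squnion> b \<in> J" if ab: "a \<in> J" "b \<in> J" for a b
    proof -
      have "a \<in> ?T" "b \<in> ?T" using J' ab by auto
      then show ?thesis using J' ab join_D[of a b] by metis
    qed
    show "a \<in> J \<or> b \<in> J" if "a \<in> ?T" "b \<in> ?T" "a \<sqinter> b \<in> J" for a b
      using J' that meet_D[of a b] by simp
  qed
  have sJ: "s \<notin> J" using J_sub J_prop J_down T_le by blast
  have cut: "t \<sqinter> s \<in> ?T" "t \<sqinter> s \<sqsubseteq> t" if "t \<in> S" for t
    using that s(1) sc basis_meet basis_carrier meet_right meet_left by (auto simp: down_def)
  define F where "F = {t \<in> S. t \<sqinter> s \<notin> J}"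
  have "prime_filter F"
    unfolding prime_filter_def
  proof (intro conjI ballI impI)
    show "F \<subseteq> S" by (auto simp: F_def)
    show "\<top> \<in> F" using sJ sc basis_top meet_top by (simp add: F_def meet_comm)
    obtain j where "j \<in> J" using J_ne by blast
    then have "\<bottom> \<in> J"
      using J_down[OF _ ideals_bottom[OF T] bottom_lower[OF Tc]] J_sub by blast
    then show "\<bottom> \<notin> F" using sc meet_bottom by (simp add: F_def meet_comm)
  next
    fix a b assume a: "a \<in> F" and b: "b \<in> S" and ab: "a \<sqsubseteq> b"
    have aS: "a \<in> S" "a \<sqinter> s \<notin> J" using a by (auto simp: F_def)
    have "a \<sqinter> s \<sqsubseteq> b \<sqinter> s" using ab aS b sc basis_carrier by (intro meet_mono) auto
    then show "b \<in> F" using J_down[of "b \<sqinter> s" "a \<sqinter> s"] cut(1)[OF aS(1)] aS b by (auto simp: F_def)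
  next
    fix a b assume "a \<in> F" "b \<in> F"
    then have ab: "a \<in> S" "b \<in> S" "a \<sqinter> s \<notin> J" "b \<sqinter> s \<notin> J" by (auto simp: F_def)
    have c: "a \<in> carrier L" "b \<in> carrier L" using ab basis_carrier by auto
    have "(a \<sqinter> s) \<sqinter> (b \<sqinter> s) \<sqsubseteq> (a \<sqinter> b) \<sqinter> s"
    proof (intro meet_le)
      show "(a \<sqinter> s) \<sqinter> (b \<sqinter> s) \<sqsubseteq> a" "(a \<sqinter> s) \<sqinter> (b \<sqinter> s) \<sqsubseteq> b" "(a \<sqinter> s) \<sqinter> (b \<sqinter> s) \<sqsubseteq> s"
        using c sc le_trans[OF meet_left[of "a \<sqinter> s" "b \<sqinter> s"] meet_left[of a s]]
          le_trans[OF meet_right[of "a \<sqinter> s" "b \<sqinter> s"] meet_left[of b s]]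
          le_trans[OF meet_right[of "a \<sqinter> s" "b \<sqinter> s"] meet_right[of b s]] by auto
    qed (use c sc in auto)
    moreover have "(a \<sqinter> s) \<sqinter> (b \<sqinter> s) \<in> ?T" by (intro T_meet cut ab)
    ultimately have "(a \<sqinter> b) \<sqinter> s \<notin> J" using J_down J_prime cut(1) ab by blast
    then show "a \<sqinter> b \<in> F" using ab basis_meet by (simp add: F_def)
  next
    fix a b assume ab: "a \<in> S" "b \<in> S" "a \<squnion> b \<in> F"
    have "(a \<squnion> b) \<sqinter> s = (a \<sqinter> s) \<squnion> (b \<sqinter> s)"
      using meet_join_distrib[of s a b] ab(1,2) sc basis_carrier by (simp add: meet_comm)
    then show "a \<in> F \<or> b \<in> F" using ab J_join[of "a \<sqinter> s" "b \<sqinter> s"] by (auto simp: F_def)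
  qed
  moreover have "s \<in> F" using s(1) sJ sc meet_absorb[of s s] by (simp add: F_def)
  moreover have "F \<inter> I = {}"
  proof -
    have "t \<sqinter> s \<in> J" if "t \<in> I" for t
      using J(2) ideals_down[OF I that _ cut(2)] cut(1) that ideals_subset[OF I]
        basis_meet[OF _ s(1)] by blast
    then show ?thesis by (auto simp: F_def)
  qed
  ultimately show thesis by (rule that)
qed

end

lemma two_frame_top: "\<top>\<^bsub>two_frame\<^esub> = True"
  and two_frame_meet: "a \<sqinter>\<^bsub>two_frame\<^esub> b = (a \<and> b)"
  and two_frame_sup: "\<Squnion>\<^bsub>two_frame\<^esub>A = (True \<in> A)"
proof -
  interpret partial_order two_frame by unfold_locales (auto simp: two_frame_def)
  show "\<top>\<^bsub>two_frame\<^esub> = True" by (rule top_eqI) (auto simp: two_frame_def)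
  show "a \<sqinter>\<^bsub>two_frame\<^esub> b = (a \<and> b)"
    unfolding meet_def by (rule inf_eqI) (auto simp: two_frame_def)
  show "\<Squnion>\<^bsub>two_frame\<^esub>A = (True \<in> A)"
    by (rule sup_eqI) (auto simp: two_frame_def)
qed

lemma points_iff:
  "p \<in> points L \<longleftrightarrow> p \<in> extensional (carrier L) \<and> p \<top>\<^bsub>L\<^esub> \<and>
     (\<forall>x\<in>carrier L. \<forall>y\<in>carrier L. p (x \<sqinter>\<^bsub>L\<^esub> y) \<longleftrightarrow> p x \<and> p y) \<and>
     (\<forall>A\<subseteq>carrier L. p (\<Squnion>\<^bsub>L\<^esub>A) \<longleftrightarrow> (\<exists>a\<in>A. p a))"
proof -
  have "p \<in> carrier L \<rightarrow>\<^sub>E carrier two_frame \<longleftrightarrow> p \<in> extensional (carrier L)"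
    by (auto simp: two_frame_def PiE_def)
  moreover have "True \<in> p ` A \<longleftrightarrow> (\<exists>a\<in>A. p a)" for A by auto
  ultimately show ?thesis
    by (simp add: points_def frame_hom_def two_frame_top two_frame_meet two_frame_sup)
qed

lemma point_extensional: "p \<in> points L \<Longrightarrow> p \<in> extensional (carrier L)"
  and point_top: "p \<in> points L \<Longrightarrow> p \<top>\<^bsub>L\<^esub>"
  and point_meet: "p \<in> points L \<Longrightarrow> x \<in> carrier L \<Longrightarrow> y \<in> carrier L \<Longrightarrow> p (x \<sqinter>\<^bsub>L\<^esub> y) \<longleftrightarrow> p x \<and> p y"
  and point_sup: "p \<in> points L \<Longrightarrow> A \<subseteq> carrier L \<Longrightarrow> p (\<Squnion>\<^bsub>L\<^esub>A) \<longleftrightarrow> (\<exists>a\<in>A. p a)"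
  by (simp_all add: points_iff)

lemma point_join:
  "p \<in> points L \<Longrightarrow> x \<in> carrier L \<Longrightarrow> y \<in> carrier L \<Longrightarrow> p (x \<squnion>\<^bsub>L\<^esub> y) \<longleftrightarrow> p x \<or> p y"
  using point_sup[of p L "{x, y}"] by (simp add: join_def)

lemma (in frith) point_bottom: "p \<in> points L \<Longrightarrow> \<not> p \<bottom>"
  using point_sup[of p L "{}"] by (simp add: sup_empty)

lemma (in frith) point_mono: "p \<in> points L \<Longrightarrow> x \<in> carrier L \<Longrightarrow> y \<in> carrier L \<Longrightarrow> x \<sqsubseteq> y \<Longrightarrow> p x \<Longrightarrow> p y"
  using point_meet[of p L x y] meet_absorb[of x y] by simp

lemma mem_hat: "p \<in> hat L a \<longleftrightarrow> p \<in> points L \<and> p a"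
  by (simp add: hat_def)

lemma hat_meet: "a \<in> carrier L \<Longrightarrow> b \<in> carrier L \<Longrightarrow> hat L (a \<sqinter>\<^bsub>L\<^esub> b) = hat L a \<inter> hat L b"
  by (auto simp: mem_hat point_meet)

lemma hat_join: "a \<in> carrier L \<Longrightarrow> b \<in> carrier L \<Longrightarrow> hat L (a \<squnion>\<^bsub>L\<^esub> b) = hat L a \<union> hat L b"
  by (auto simp: mem_hat point_join)

lemma hat_sup: "A \<subseteq> carrier L \<Longrightarrow> hat L (\<Squnion>\<^bsub>L\<^esub>A) = \<Union>(hat L ` A)"
  by (auto simp: mem_hat point_sup)

lemma hat_top: "hat L \<top>\<^bsub>L\<^esub> = points L"
  by (auto simp: mem_hat point_top)

context frith
begin

lemma hat_bottom: "hat L \<bottom> = {}"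
  by (auto simp: mem_hat point_bottom)

lemma point_determined_by_basis:
  assumes pq: "p \<in> points L" "q \<in> points L" and eq: "\<And>s. s \<in> S \<Longrightarrow> p s \<longleftrightarrow> q s"
  shows "p = q"
proof (rule extensionalityI[OF point_extensional[OF pq(1)] point_extensional[OF pq(2)]])
  fix a assume "a \<in> carrier L"
  then obtain A where A: "A \<subseteq> S" "a = \<Squnion>A" using joins_of_basis by blast
  then have "A \<subseteq> carrier L" "(\<exists>a\<in>A. p a) \<longleftrightarrow> (\<exists>a\<in>A. q a)" using basis_subset eq by blast+
  then show "p a = q a" using A(2) point_sup[OF pq(1), of A] point_sup[OF pq(2), of A] by simp
qed

lemma point_prime_filter:
  assumes p: "p \<in> points L"
  shows "prime_filter {s \<in> S. p s}"
  unfolding prime_filter_def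
proof (intro conjI ballI impI)
  fix a b assume "a \<in> {s \<in> S. p s}" "b \<in> S" "a \<sqsubseteq> b"
  then show "b \<in> {s \<in> S. p s}" using point_mono[OF p basis_carrier basis_carrier, of a b] by simp
qed (auto simp: basis_top basis_meet basis_carrier point_top[OF p] point_bottom[OF p] point_meet[OF p]
    point_join[OF p])

end

text \<open>Compactness of the basis is what makes the filter generated by a prime filter of \<open>S\<close> completely prime.\<close>

lemma (in compact_frith) point_of_prime_filter:
  assumes F: "prime_filter F"
  obtains p where "p \<in> points L" "\<And>s. s \<in> S \<Longrightarrow> p s \<longleftrightarrow> s \<in> F"
proof -
  have FS: "F \<subseteq> S" and F_top: "\<top> \<in> F" and F_up: "\<And>a b. a \<in> F \<Longrightarrow> b \<in> S \<Longrightarrow> a \<sqsubseteq> b \<Longrightarrow> b \<in> F"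
    and F_meet: "\<And>a b. a \<in> F \<Longrightarrow> b \<in> F \<Longrightarrow> a \<sqinter> b \<in> F"
    using F by (auto simp: prime_filter_def)
  have Fc: "s \<in> carrier L" if "s \<in> F" for s using FS basis_carrier that by blast
  define p where "p = (\<lambda>a\<in>carrier L. \<exists>s\<in>F. s \<sqsubseteq> a)"
  have p: "p a \<longleftrightarrow> (\<exists>s\<in>F. s \<sqsubseteq> a)" if "a \<in> carrier L" for a using that by (simp add: p_def)
  have up: "p b" if ab: "p a" "a \<sqsubseteq> b" "a \<in> carrier L" "b \<in> carrier L" for a b
  proof -
    obtain s where s: "s \<in> F" "s \<sqsubseteq> a" using ab(1) p[OF ab(3)] by blast
    then show ?thesis using le_trans[OF s(2) ab(2) Fc[OF s(1)] ab(3,4)] p[OF ab(4)] by blast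
  qed
  have "p \<in> points L"
    unfolding points_iff
  proof (intro conjI ballI allI impI)
    show "p \<in> extensional (carrier L)" by (simp add: p_def)
    show "p \<top>" using F_top by (auto simp: p)
    fix x y assume c: "x \<in> carrier L" "y \<in> carrier L"
    show "p (x \<sqinter> y) \<longleftrightarrow> p x \<and> p y"
    proof (intro iffI conjI; (elim conjE)?)
      show "p (x \<sqinter> y) \<Longrightarrow> p x" by (rule up[of "x \<sqinter> y"]) (use c meet_left in auto)
      show "p (x \<sqinter> y) \<Longrightarrow> p y" by (rule up[of "x \<sqinter> y"]) (use c meet_right in auto)
      assume "p x" "p y"
      then obtain s t where st: "s \<in> F" "s \<sqsubseteq> x" "t \<in> F" "t \<sqsubseteq> y" using p c by blast
      then have "s \<sqinter> t \<sqsubseteq> x \<sqinter> y" using c Fc by (intro meet_mono)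
      then show "p (x \<sqinter> y)" using F_meet[OF st(1,3)] p[of "x \<sqinter> y"] c by auto
    qed
  next
    fix A assume A: "A \<subseteq> carrier L"
    show "p (\<Squnion>A) \<longleftrightarrow> (\<exists>a\<in>A. p a)"
    proof
      assume "\<exists>a\<in>A. p a"
      then obtain a where a: "a \<in> A" "p a" by blast
      then show "p (\<Squnion>A)" using up[OF a(2) sup_upper[OF A a(1)]] A by auto
    next
      assume "p (\<Squnion>A)"
      then obtain s where s: "s \<in> F" "s \<sqsubseteq> \<Squnion>A" using p[of "\<Squnion>A"] A by auto
      let ?T = "{t \<in> S. \<exists>a\<in>A. t \<sqsubseteq> a}"
      have sS: "s \<in> S" using s(1) FS by blast
      have "?T \<subseteq> carrier L" "s \<sqsubseteq> \<Squnion>?T" using basis_subset s(2) sup_basis_refinement[OF A] by auto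
      then obtain T where T: "T \<subseteq> ?T" "finite T" "s \<sqsubseteq> \<Squnion>T"
        by (rule compact_inE[OF compact_basis[OF sS]])
      have TS: "T \<subseteq> S" using T(1) by blast
      have "\<Squnion>T \<in> F" by (rule F_up[OF s(1) finite_sup_in_basis[OF T(2) TS] T(3)])
      then obtain t where t: "t \<in> T" "t \<in> F" using prime_filter_finite_sup[OF F T(2) TS] by blast
      then obtain a where "a \<in> A" "t \<sqsubseteq> a" using T(1) by blast
      then show "\<exists>a\<in>A. p a" using t(2) A p by blast
    qed
  qed
  moreover have "p s \<longleftrightarrow> s \<in> F" if "s \<in> S" for s
    using that F_up p[OF basis_carrier[OF that]] basis_carrier[OF that] by auto
  ultimately show thesis by (rule that)
qed

text \<open>
  Spatiality: a basic element that is not below \<open>b\<close> is separated by a point from the ideal of the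
  basic elements below \<open>b\<close>, hence from \<open>b\<close>.
\<close>

lemma (in compact_frith) hat_reflects_order:
  assumes pit: "prime_ideal_theorem TYPE('a)"
    and ab: "a \<in> carrier L" "b \<in> carrier L" "hat L a \<subseteq> hat L b"
  shows "a \<sqsubseteq> b"
proof (rule le_via_basis[OF ab(1,2)])
  fix s assume s: "s \<in> S" "s \<sqsubseteq> a"
  show "s \<sqsubseteq> b"
  proof (rule ccontr)
    assume "\<not> s \<sqsubseteq> b"
    then have nmem: "s \<notin> down b" by (simp add: down_def)
    obtain F where F: "prime_filter F" "s \<in> F" "F \<inter> down b = {}"
      by (rule prime_filter_separation[OF pit down_in[OF ab(2)] s(1) nmem])
    obtain p where p: "p \<in> points L" "\<And>t. t \<in> S \<Longrightarrow> p t \<longleftrightarrow> t \<in> F"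
      by (rule point_of_prime_filter[OF F(1)]) blast
    have "p a" using point_mono[OF p(1) basis_carrier[OF s(1)] ab(1) s(2)] p(2)[OF s(1)] F(2) by simp
    then have "p b" using ab(3) p(1) by (auto simp: mem_hat)
    then have "p (\<Squnion>(down b))" using sup_down[OF ab(2)] by simp
    then obtain t where t: "t \<in> down b" "p t"
      using point_sup[OF p(1), of "down b"] basis_subset by (auto simp: down_def)
    then have "t \<in> F" using p(2)[of t] by (simp add: down_def)
    then show False using F(3) t(1) by blast
  qed
qed

section \<open>The adjunction\<close>

abbreviation opens :: "'a pervin \<Rightarrow> 'a set set" where
  "opens P \<equiv> {U. openin (pervin_topology P) U}"

lemma Omega_eq: "fst (Omega P) = inclusion_order (opens P)"
  by (simp add: Omega_def inclusion_order_def)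

lemma Omega_simps [simp]:
  "carrier (fst (Omega P)) = opens P" "le (fst (Omega P)) = (\<subseteq>)" "snd (Omega P) = snd P"
  by (simp_all add: Omega_def)

lemma Omega_meet:
  "openin (pervin_topology P) U \<Longrightarrow> openin (pervin_topology P) V \<Longrightarrow> U \<sqinter>\<^bsub>fst (Omega P)\<^esub> V = U \<inter> V"
  unfolding Omega_eq by (rule inclusion_order_meet_eq_Int) auto

lemma Omega_sup: "D \<subseteq> opens P \<Longrightarrow> \<Squnion>\<^bsub>fst (Omega P)\<^esub>D = \<Union>D"
  unfolding Omega_eq by (rule inclusion_order_sup_eq_Union) auto

lemma Omega_join:
  "openin (pervin_topology P) U \<Longrightarrow> openin (pervin_topology P) V \<Longrightarrow> U \<squnion>\<^bsub>fst (Omega P)\<^esub> V = U \<union> V"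
  using Omega_sup[of "{U, V}" P] by (simp add: join_def)

lemma Omega_bottom: "\<bottom>\<^bsub>fst (Omega P)\<^esub> = {}"
  unfolding Omega_eq by (rule inclusion_order_bottom) auto

lemma openin_subset_fst: "pervin_space P \<Longrightarrow> openin (pervin_topology P) U \<Longrightarrow> U \<subseteq> fst P"
  using openin_subset[of "pervin_topology P" U] topspace_pervin[of P] by simp

lemma Omega_top:
  assumes P: "pervin_space P"
  shows "\<top>\<^bsub>fst (Omega P)\<^esub> = fst P"
  unfolding Omega_eq
  by (rule inclusion_order_top)
    (use openin_pervin[OF pervin_whole[OF P]] openin_subset_fst[OF P] in auto)

lemma open_eq_Union_basic:
  assumes P: "pervin_space P" and U: "openin (pervin_topology P) U"
  shows "U = \<Union>{T \<in> snd P. T \<subseteq> U}"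
  using pervin_base[OF P U] by blast

lemma frith_Omega:
  assumes P: "pervin_space P"
  shows "frith (fst (Omega P)) (snd P)"
proof (intro frith.intro frith_axioms.intro)
  show "frame (fst (Omega P))"
    unfolding Omega_eq by (rule frame_of_open_sets) auto
  show "bounded_sublattice (fst (Omega P)) (snd P)"
    using P openin_pervin[of _ P]
    by (auto simp: bounded_sublattice_def sublattice_def Omega_meet Omega_join Omega_top[OF P]
        Omega_bottom pervin_space_def)
  fix U assume U: "U \<in> carrier (fst (Omega P))"
  have "{T \<in> snd P. T \<subseteq> U} \<subseteq> opens P" using openin_pervin by blast
  then have "U = \<Squnion>\<^bsub>fst (Omega P)\<^esub>{T \<in> snd P. T \<subseteq> U}"
    using open_eq_Union_basic[OF P, of U] U by (simp add: Omega_sup)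
  then show "\<exists>A\<subseteq>snd P. U = \<Squnion>\<^bsub>fst (Omega P)\<^esub>A"
    by (intro exI[of _ "{T \<in> snd P. T \<subseteq> U}"] conjI) auto
qed

lemma frith_frame_iff_frith: "frith_frame F \<longleftrightarrow> frith (fst F) (snd F)"
  using frith_frame_iff[of "fst F" "snd F"] by simp

lemma frith_frame_Omega: "pervin_space P \<Longrightarrow> frith_frame (Omega P)"
  using frith_Omega by (simp add: frith_frame_iff_frith)

lemma
  assumes "f \<in> pervin_hom P Q"
  shows pervin_hom_mem: "x \<in> fst P \<Longrightarrow> f x \<in> fst Q"
    and pervin_hom_preimage: "T \<in> snd Q \<Longrightarrow> f -` T \<inter> fst P \<in> snd P"
  using assms by (auto simp: pervin_hom_def dest: PiE_mem)

lemma pervin_hom_continuous: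
  assumes Q: "pervin_space Q" and f: "f \<in> pervin_hom P Q" and V: "openin (pervin_topology Q) V"
  shows "openin (pervin_topology P) (f -` V \<inter> fst P)"
proof -
  have "f -` V \<inter> fst P = \<Union>((\<lambda>T. f -` T \<inter> fst P) ` {T \<in> snd Q. T \<subseteq> V})"
    by (subst open_eq_Union_basic[OF Q V]) blast
  moreover have "openin (pervin_topology P) (\<Union>((\<lambda>T. f -` T \<inter> fst P) ` {T \<in> snd Q. T \<subseteq> V}))"
    using pervin_hom_preimage[OF f] openin_pervin[of _ P] by (intro openin_Union) auto
  ultimately show ?thesis by (simp only:)
qed

lemma Omega_map_apply: "openin (pervin_topology Q) V \<Longrightarrow> Omega_map P Q f V = f -` V \<inter> fst P"
  by (simp add: Omega_map_def)

lemma Omega_map_hom: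
  assumes P: "pervin_space P" and Q: "pervin_space Q" and f: "f \<in> pervin_hom P Q"
  shows "Omega_map P Q f \<in> frith_hom (Omega Q) (Omega P)"
proof -
  have cont: "openin (pervin_topology P) (f -` V \<inter> fst P)" if "openin (pervin_topology Q) V" for V
    by (rule pervin_hom_continuous[OF Q f that])
  have "Omega_map P Q f \<in> frame_hom (fst (Omega Q)) (fst (Omega P))"
    unfolding frame_hom_def mem_Collect_eq
  proof (intro conjI ballI allI impI)
    show "Omega_map P Q f \<in> carrier (fst (Omega Q)) \<rightarrow>\<^sub>E carrier (fst (Omega P))"
      using cont by (auto simp: Omega_map_def)
    have "openin (pervin_topology Q) (fst Q)" by (rule openin_pervin[OF pervin_whole[OF Q]])
    then show "Omega_map P Q f \<top>\<^bsub>fst (Omega Q)\<^esub> = \<top>\<^bsub>fst (Omega P)\<^esub>"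
      using pervin_hom_mem[OF f] by (auto simp: Omega_top[OF P] Omega_top[OF Q] Omega_map_apply)
  next
    fix U V assume "U \<in> carrier (fst (Omega Q))" "V \<in> carrier (fst (Omega Q))"
    then have UV: "openin (pervin_topology Q) U" "openin (pervin_topology Q) V" by auto
    show "Omega_map P Q f (U \<sqinter>\<^bsub>fst (Omega Q)\<^esub> V) = Omega_map P Q f U \<sqinter>\<^bsub>fst (Omega P)\<^esub> Omega_map P Q f V"
      using UV cont[OF UV(1)] cont[OF UV(2)]
      by (simp add: Omega_meet Omega_map_apply openin_Int) blast
  next
    fix D assume D: "D \<subseteq> carrier (fst (Omega Q))"
    have im: "Omega_map P Q f ` D = (\<lambda>V. f -` V \<inter> fst P) ` D"
      using D by (intro image_cong refl Omega_map_apply) auto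
    have sub: "(\<lambda>V. f -` V \<inter> fst P) ` D \<subseteq> opens P" using D cont by auto
    have "\<Squnion>\<^bsub>fst (Omega Q)\<^esub>D = \<Union>D" "openin (pervin_topology Q) (\<Union>D)" using D Omega_sup[of D Q] by auto
    then show "Omega_map P Q f (\<Squnion>\<^bsub>fst (Omega Q)\<^esub>D) = \<Squnion>\<^bsub>fst (Omega P)\<^esub>(Omega_map P Q f ` D)"
      unfolding im Omega_sup[OF sub] by (auto simp: Omega_map_apply)
  qed
  moreover have "Omega_map P Q f ` snd (Omega Q) \<subseteq> snd (Omega P)"
    using pervin_hom_preimage[OF f] openin_pervin[of _ Q] by (auto simp: Omega_map_apply)
  ultimately show ?thesis by (simp add: frith_hom_def)
qed

lemma Omega_map_id:
  assumes P: "pervin_space P"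
  shows "Omega_map P P (pervin_id P) = frith_id (Omega P)"
proof
  fix U
  show "Omega_map P P (pervin_id P) U = frith_id (Omega P) U"
  proof (cases "openin (pervin_topology P) U")
    case True
    have "pervin_id P -` U \<inter> fst P = U" using openin_subset_fst[OF P True] by (auto simp: pervin_id_def)
    then show ?thesis using True by (simp add: Omega_map_apply frith_id_def)
  qed (simp add: Omega_map_def frith_id_def)
qed

lemma Omega_map_comp:
  assumes R: "pervin_space R" and Q: "pervin_space Q" and f: "f \<in> pervin_hom P Q" and g: "g \<in> pervin_hom Q R"
  shows "Omega_map P R (pervin_comp P g f) = frith_comp (Omega R) (Omega_map P Q f) (Omega_map Q R g)"
proof
  fix W
  show "Omega_map P R (pervin_comp P g f) W = frith_comp (Omega R) (Omega_map P Q f) (Omega_map Q R g) W"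
  proof (cases "openin (pervin_topology R) W")
    case True
    then have "Omega_map P R (pervin_comp P g f) W = f -` (g -` W \<inter> fst Q) \<inter> fst P"
      using pervin_hom_mem[OF f] by (auto simp: Omega_map_apply pervin_comp_def compose_def)
    also have "\<dots> = Omega_map P Q f (Omega_map Q R g W)"
      using True pervin_hom_continuous[OF R g True] by (simp add: Omega_map_apply)
    finally show ?thesis using True by (simp add: frith_comp_def compose_def)
  qed (simp add: Omega_map_def frith_comp_def compose_def)
qed

lemma pervin_space_pt:
  assumes F: "frith_frame F"
  shows "pervin_space (pt F)"
proof -
  interpret frith "fst F" "snd F" using F by (simp add: frith_frame_iff_frith)
  let ?hat = "hat (fst F)"
  have ops: "?hat a \<inter> ?hat b \<in> ?hat ` snd F \<and> ?hat a \<union> ?hat b \<in> ?hat ` snd F"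
    if ab: "a \<in> snd F" "b \<in> snd F" for a b
    using imageI[OF basis_meet[OF ab], of ?hat] imageI[OF basis_join[OF ab], of ?hat] basis_carrier ab
    by (simp add: hat_meet hat_join)
  show ?thesis
    unfolding pervin_space_def pt_def fst_conv snd_conv
  proof (intro conjI ballI)
    show "?hat ` snd F \<subseteq> Pow (points (fst F))" by (auto simp: mem_hat)
    show "{} \<in> ?hat ` snd F" "points (fst F) \<in> ?hat ` snd F"
      using imageI[OF basis_bottom, of ?hat] imageI[OF basis_top, of ?hat] by (simp_all add: hat_bottom hat_top)
  qed (use ops in auto)
qed

lemma pt_simps [simp]: "fst (pt F) = points (fst F)" "snd (pt F) = hat (fst F) ` snd F"
  by (simp_all add: pt_def)

text \<open>Since \<open>hat\<close> preserves joins, the unions of basic sets are again of the form \<open>hat a\<close>.\<close>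

lemma open_pt_iff:
  assumes F: "frith_frame F"
  shows "openin (pervin_topology (pt F)) U \<longleftrightarrow> U \<in> hat (fst F) ` carrier (fst F)"
proof -
  interpret frith "fst F" "snd F" using F by (simp add: frith_frame_iff_frith)
  show ?thesis
  proof
    assume U: "openin (pervin_topology (pt F)) U"
    let ?A = "{s \<in> snd F. hat (fst F) s \<subseteq> U}"
    have "U = \<Union>(hat (fst F) ` ?A)"
      using open_eq_Union_basic[OF pervin_space_pt[OF F] U] by auto
    also have "\<dots> = hat (fst F) (\<Squnion>\<^bsub>fst F\<^esub>?A)" using basis_subset by (intro hat_sup[symmetric]) auto
    finally have "U = hat (fst F) (\<Squnion>\<^bsub>fst F\<^esub>?A)" .
    moreover have "\<Squnion>\<^bsub>fst F\<^esub>?A \<in> carrier (fst F)" using basis_subset by (intro sup_closed) auto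
    ultimately show "U \<in> hat (fst F) ` carrier (fst F)" by (rule image_eqI)
  next
    assume "U \<in> hat (fst F) ` carrier (fst F)"
    then obtain a where a: "a \<in> carrier (fst F)" "U = hat (fst F) a" by blast
    obtain A where A: "A \<subseteq> snd F" "a = \<Squnion>\<^bsub>fst F\<^esub>A" using joins_of_basis[OF a(1)] by blast
    have "U = \<Union>(hat (fst F) ` A)" using hat_sup[of A "fst F"] A basis_subset a(2) by auto
    then show "openin (pervin_topology (pt F)) U"
      using A(1) openin_pervin[of _ "pt F"] by auto
  qed
qed

lemma point_compose:
  fixes L (structure)
  assumes L: "frame L" and h: "h \<in> frame_hom L M" and p: "p \<in> points M"
  shows "compose (carrier L) p h \<in> points L"
proof -
  interpret frame L by (rule L)
  have comp: "compose (carrier L) p h a = p (h a)" if "a \<in> carrier L" for a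
    using that by (simp add: compose_def)
  show ?thesis
    unfolding points_iff
  proof (intro conjI ballI allI impI)
    show "compose (carrier L) p h \<in> extensional (carrier L)" by (simp add: compose_def)
    show "compose (carrier L) p h \<top>" using frame_hom_top[OF h] point_top[OF p] by (simp add: comp)
    show "compose (carrier L) p h (x \<sqinter> y) \<longleftrightarrow> compose (carrier L) p h x \<and> compose (carrier L) p h y"
      if "x \<in> carrier L" "y \<in> carrier L" for x y
      using that frame_hom_meet[OF h that] frame_hom_closed[OF h] point_meet[OF p] by (simp add: comp)
    show "compose (carrier L) p h (\<Squnion>A) \<longleftrightarrow> (\<exists>a\<in>A. compose (carrier L) p h a)" if A: "A \<subseteq> carrier L" for A
    proof -
      have "h ` A \<subseteq> carrier M" using A frame_hom_closed[OF h] by blast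
      then have "p (h (\<Squnion>A)) \<longleftrightarrow> (\<exists>a\<in>A. p (h a))" using frame_hom_sup[OF h A] point_sup[OF p] by simp
      then show ?thesis using A comp by (simp add: subset_iff)
    qed
  qed
qed

lemma
  assumes "h \<in> frith_hom F G"
  shows frith_hom_frame_hom: "h \<in> frame_hom (fst F) (fst G)"
    and frith_hom_basis: "s \<in> snd F \<Longrightarrow> h s \<in> snd G"
    and frith_hom_closed: "a \<in> carrier (fst F) \<Longrightarrow> h a \<in> carrier (fst G)"
  using assms frame_hom_closed[of h "fst F" "fst G" a] by (auto simp: frith_hom_def)

lemma frith_frame_frame: "frith_frame F \<Longrightarrow> frame (fst F)"
  and frith_frame_basis_subset: "frith_frame F \<Longrightarrow> snd F \<subseteq> carrier (fst F)"
  by (auto simp: frith_frame_def bounded_sublattice_def sublattice_def)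

lemma pt_map_mem:
  "frith_frame F \<Longrightarrow> h \<in> frith_hom F G \<Longrightarrow> p \<in> points (fst G) \<Longrightarrow> pt_map F G h p \<in> points (fst F)"
  using point_compose[OF frith_frame_frame frith_hom_frame_hom] by (simp add: pt_map_def)

lemma pt_map_apply:
  "p \<in> points (fst G) \<Longrightarrow> a \<in> carrier (fst F) \<Longrightarrow> pt_map F G h p a = p (h a)"
  by (simp add: pt_map_def compose_def)

lemma pt_map_preimage:
  assumes F: "frith_frame F" and h: "h \<in> frith_hom F G" and a: "a \<in> carrier (fst F)"
  shows "pt_map F G h -` hat (fst F) a \<inter> points (fst G) = hat (fst G) (h a)"
  using pt_map_mem[OF F h] pt_map_apply[OF _ a, of _ G h] by (auto simp: mem_hat)

lemma pt_map_hom: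
  assumes F: "frith_frame F" and h: "h \<in> frith_hom F G"
  shows "pt_map F G h \<in> pervin_hom (pt G) (pt F)"
  unfolding pervin_hom_def mem_Collect_eq pt_simps
proof (intro conjI ballI)
  show "pt_map F G h \<in> points (fst G) \<rightarrow>\<^sub>E points (fst F)"
    using pt_map_mem[OF F h] by (auto simp: pt_map_def PiE_def)
  fix T assume "T \<in> hat (fst F) ` snd F"
  then obtain s where s: "s \<in> snd F" "T = hat (fst F) s" by blast
  then show "pt_map F G h -` T \<inter> points (fst G) \<in> hat (fst G) ` snd G"
    using pt_map_preimage[OF F h, of s] frith_frame_basis_subset[OF F] frith_hom_basis[OF h s(1)] by auto
qed

lemma pt_map_id: "pt_map F F (frith_id F) = pervin_id (pt F)"
proof
  fix p
  show "pt_map F F (frith_id F) p = pervin_id (pt F) p"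
  proof (cases "p \<in> points (fst F)")
    case True
    have "compose (carrier (fst F)) p (frith_id F) = p"
      by (rule extensionalityI[OF _ point_extensional[OF True]]) (simp_all add: compose_def frith_id_def)
    then show ?thesis using True by (simp add: pt_map_def pervin_id_def)
  qed (simp add: pt_map_def pervin_id_def)
qed

lemma pt_map_comp:
  assumes F: "frith_frame F" and G: "frith_frame G" and h: "h \<in> frith_hom F G" and k: "k \<in> frith_hom G H"
  shows "pt_map F H (frith_comp F k h) = pervin_comp (pt H) (pt_map F G h) (pt_map G H k)"
proof
  fix p
  show "pt_map F H (frith_comp F k h) p = pervin_comp (pt H) (pt_map F G h) (pt_map G H k) p"
  proof (cases "p \<in> points (fst H)")
    case True
    have "pt_map F H (frith_comp F k h) p = pt_map F G h (pt_map G H k p)"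
      using True pt_map_mem[OF G k True] frith_hom_closed[OF h]
      by (auto simp: pt_map_def frith_comp_def compose_def fun_eq_iff)
    then show ?thesis using True by (simp add: pervin_comp_def compose_def)
  qed (simp add: pt_map_def pervin_comp_def compose_def)
qed

lemma adj_unit_point:
  assumes P: "pervin_space P" and x: "x \<in> fst P"
  shows "adj_unit P x \<in> points (fst (Omega P))"
proof -
  have "(\<Squnion>\<^bsub>fst (Omega P)\<^esub>A) = \<Union>A" "openin (pervin_topology P) (\<Union>A)" if "A \<subseteq> opens P" for A
    using that Omega_sup[OF that] by auto
  then show ?thesis
    using x openin_pervin[OF pervin_whole[OF P]]
    by (auto simp: points_iff adj_unit_def Omega_top[OF P] Omega_meet subset_iff)
qed

lemma adj_unit_apply:
  "x \<in> fst P \<Longrightarrow> openin (pervin_topology P) U \<Longrightarrow> adj_unit P x U \<longleftrightarrow> x \<in> U"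
  by (simp add: adj_unit_def)

lemma adj_unit_preimage:
  assumes P: "pervin_space P" and U: "openin (pervin_topology P) U"
  shows "adj_unit P -` hat (fst (Omega P)) U \<inter> fst P = U"
  using adj_unit_point[OF P] adj_unit_apply[OF _ U] openin_subset_fst[OF P U] by (auto simp: mem_hat)

lemma adj_unit_hom:
  assumes P: "pervin_space P"
  shows "adj_unit P \<in> pervin_hom P (pt (Omega P))"
  unfolding pervin_hom_def mem_Collect_eq pt_simps
proof (intro conjI ballI)
  show "adj_unit P \<in> fst P \<rightarrow>\<^sub>E points (fst (Omega P))"
    using adj_unit_point[OF P] by (auto simp: adj_unit_def PiE_def)
  fix T assume "T \<in> hat (fst (Omega P)) ` snd (Omega P)"
  then show "adj_unit P -` T \<inter> fst P \<in> snd P"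
    using adj_unit_preimage[OF P openin_pervin] by auto
qed

lemma adj_unit_natural:
  assumes P: "pervin_space P" and Q: "pervin_space Q" and f: "f \<in> pervin_hom P Q"
  shows "pervin_comp P (pt_map (Omega Q) (Omega P) (Omega_map P Q f)) (adj_unit P) =
    pervin_comp P (adj_unit Q) f"
proof
  fix x
  show "pervin_comp P (pt_map (Omega Q) (Omega P) (Omega_map P Q f)) (adj_unit P) x =
    pervin_comp P (adj_unit Q) f x"
  proof (cases "x \<in> fst P")
    case True
    have fx: "f x \<in> fst Q" by (rule pervin_hom_mem[OF f True])
    have pt: "pt_map (Omega Q) (Omega P) (Omega_map P Q f) (adj_unit P x) \<in> points (fst (Omega Q))"
      by (rule pt_map_mem[OF frith_frame_Omega[OF Q] Omega_map_hom[OF P Q f] adj_unit_point[OF P True]])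
    have "pt_map (Omega Q) (Omega P) (Omega_map P Q f) (adj_unit P x) = adj_unit Q (f x)"
    proof (rule extensionalityI[OF point_extensional[OF pt] point_extensional[OF adj_unit_point[OF Q fx]]])
      fix V assume "V \<in> carrier (fst (Omega Q))"
      then have V: "openin (pervin_topology Q) V" by simp
      then show "pt_map (Omega Q) (Omega P) (Omega_map P Q f) (adj_unit P x) V = adj_unit Q (f x) V"
        using True adj_unit_point[OF P True] pervin_hom_continuous[OF Q f V] fx
        by (simp add: pt_map_apply Omega_map_apply adj_unit_apply)
    qed
    then show ?thesis using True by (simp add: pervin_comp_def compose_def)
  qed (simp add: pervin_comp_def compose_def)
qed

lemma adj_counit_hom:
  assumes F: "frith_frame F"
  shows "adj_counit F \<in> frith_hom F (Omega (pt F))"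
proof -
  interpret frith "fst F" "snd F" using F by (simp add: frith_frame_iff_frith)
  note pt = pervin_space_pt[OF F]
  have open_hat: "openin (pervin_topology (pt F)) (hat (fst F) a)" if "a \<in> carrier (fst F)" for a
    using that open_pt_iff[OF F] by blast
  have "adj_counit F \<in> frame_hom (fst F) (fst (Omega (pt F)))"
    unfolding frame_hom_def mem_Collect_eq
  proof (intro conjI ballI allI impI)
    show "adj_counit F \<in> carrier (fst F) \<rightarrow>\<^sub>E carrier (fst (Omega (pt F)))"
      using open_hat by (auto simp: adj_counit_def)
    show "adj_counit F \<top>\<^bsub>fst F\<^esub> = \<top>\<^bsub>fst (Omega (pt F))\<^esub>"
      by (simp add: adj_counit_def Omega_top[OF pt] hat_top)
    show "adj_counit F (x \<sqinter>\<^bsub>fst F\<^esub> y) = adj_counit F x \<sqinter>\<^bsub>fst (Omega (pt F))\<^esub> adj_counit F y"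
      if "x \<in> carrier (fst F)" "y \<in> carrier (fst F)" for x y
      using that open_hat by (simp add: adj_counit_def hat_meet Omega_meet)
    fix A assume A: "A \<subseteq> carrier (fst F)"
    have im: "adj_counit F ` A = hat (fst F) ` A"
      using A by (intro image_cong refl) (auto simp: adj_counit_def)
    have "hat (fst F) ` A \<subseteq> opens (pt F)" using A open_hat by auto
    then show "adj_counit F (\<Squnion>\<^bsub>fst F\<^esub>A) = \<Squnion>\<^bsub>fst (Omega (pt F))\<^esub>(adj_counit F ` A)"
      unfolding im using A by (simp add: adj_counit_def hat_sup Omega_sup)
  qed
  moreover have "adj_counit F ` snd F = hat (fst F) ` snd F"
    using basis_subset by (intro image_cong refl) (auto simp: adj_counit_def)
  ultimately show ?thesis by (simp add: frith_hom_def)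
qed

lemma adj_counit_natural:
  assumes F: "frith_frame F" and G: "frith_frame G" and h: "h \<in> frith_hom F G"
  shows "frith_comp F (Omega_map (pt G) (pt F) (pt_map F G h)) (adj_counit F) =
    frith_comp F (adj_counit G) h"
proof
  fix a
  show "frith_comp F (Omega_map (pt G) (pt F) (pt_map F G h)) (adj_counit F) a =
    frith_comp F (adj_counit G) h a"
  proof (cases "a \<in> carrier (fst F)")
    case True
    have "openin (pervin_topology (pt F)) (hat (fst F) a)" using True open_pt_iff[OF F] by blast
    then have "Omega_map (pt G) (pt F) (pt_map F G h) (adj_counit F a) = hat (fst G) (h a)"
      using True pt_map_preimage[OF F h True] by (simp add: adj_counit_def Omega_map_apply)
    then show ?thesis
      using True frith_hom_closed[OF h True] by (simp add: frith_comp_def compose_def adj_counit_def)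
  qed (simp add: frith_comp_def compose_def)
qed

lemma Omega_triangle:
  assumes P: "pervin_space P"
  shows "frith_comp (Omega P) (Omega_map P (pt (Omega P)) (adj_unit P)) (adj_counit (Omega P)) =
    frith_id (Omega P)"
proof
  fix U
  show "frith_comp (Omega P) (Omega_map P (pt (Omega P)) (adj_unit P)) (adj_counit (Omega P)) U =
    frith_id (Omega P) U"
  proof (cases "openin (pervin_topology P) U")
    case True
    have "openin (pervin_topology (pt (Omega P))) (hat (fst (Omega P)) U)"
      using True open_pt_iff[OF frith_frame_Omega[OF P]] by auto
    then have "Omega_map P (pt (Omega P)) (adj_unit P) (adj_counit (Omega P) U) = U"
      using True adj_unit_preimage[OF P True] by (simp add: adj_counit_def Omega_map_apply)
    then show ?thesis using True by (simp add: frith_comp_def frith_id_def compose_def)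
  qed (simp add: frith_comp_def frith_id_def compose_def)
qed

lemma pt_triangle:
  assumes F: "frith_frame F"
  shows "pervin_comp (pt F) (pt_map F (Omega (pt F)) (adj_counit F)) (adj_unit (pt F)) = pervin_id (pt F)"
proof
  fix p
  show "pervin_comp (pt F) (pt_map F (Omega (pt F)) (adj_counit F)) (adj_unit (pt F)) p = pervin_id (pt F) p"
  proof (cases "p \<in> points (fst F)")
    case True
    have u: "adj_unit (pt F) p \<in> points (fst (Omega (pt F)))"
      using adj_unit_point[OF pervin_space_pt[OF F]] True by simp
    have pt: "pt_map F (Omega (pt F)) (adj_counit F) (adj_unit (pt F) p) \<in> points (fst F)"
      by (rule pt_map_mem[OF F adj_counit_hom[OF F] u])
    have "pt_map F (Omega (pt F)) (adj_counit F) (adj_unit (pt F) p) = p"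
    proof (rule extensionalityI[OF point_extensional[OF pt] point_extensional[OF True]])
      fix a assume a: "a \<in> carrier (fst F)"
      have "openin (pervin_topology (pt F)) (hat (fst F) a)" using a open_pt_iff[OF F] by blast
      then show "pt_map F (Omega (pt F)) (adj_counit F) (adj_unit (pt F) p) a = p a"
        using a True pt_map_apply[OF u a] by (simp add: adj_counit_def adj_unit_apply mem_hat)
    qed
    then show ?thesis using True by (simp add: pervin_comp_def pervin_id_def compose_def)
  qed (simp add: pervin_comp_def pervin_id_def compose_def)
qed

section \<open>The duality\<close>

lemma cfrith_iff_compact: "cfrith F \<longleftrightarrow> compact_frith (fst F) (snd F)"
  using cfrith_iff[of "fst F" "snd F"] by simp

lemma Omega_prime_filter_iff:
  assumes P: "pervin_space P"
  shows "frith.prime_filter (fst (Omega P)) (snd P) \<Phi> \<longleftrightarrow> pervin_prime_filter P \<Phi>"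
proof -
  interpret frith "fst (Omega P)" "snd P" by (rule frith_Omega[OF P])
  have "A \<sqinter>\<^bsub>fst (Omega P)\<^esub> B = A \<inter> B" "A \<squnion>\<^bsub>fst (Omega P)\<^esub> B = A \<union> B" if "A \<in> snd P" "B \<in> snd P" for A B
    using that by (simp_all add: Omega_meet Omega_join openin_pervin)
  then show ?thesis
    unfolding prime_filter_def pervin_prime_filter_def Omega_top[OF P] Omega_bottom Omega_simps
    by (auto simp: subset_iff)
qed

text \<open>
  A basic open set that is not covered by finitely many members of a family lies outside the
  ideal they generate. The Prime Ideal Theorem separates it from this ideal by a prime filter,
  whose realizing point is left uncovered.
\<close>

theorem cfrith_Omega:
  fixes P :: "'x pervin"
  assumes pit: "prime_ideal_theorem TYPE('x set)" and c: "cpervin P"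
  shows "cfrith (Omega P)"
proof -
  have P: "pervin_space P" and real: "realizes_prime_filters P" using c by (auto simp: cpervin_iff)
  interpret frith "fst (Omega P)" "snd P" by (rule frith_Omega[OF P])
  have "compact_in (fst (Omega P)) A" if A: "A \<in> snd P" for A
  proof (rule compact_inI_basis)
    show "A \<in> carrier (fst (Omega P))" using A by (simp add: openin_pervin)
    fix T assume T: "T \<subseteq> snd P" and le: "A \<sqsubseteq>\<^bsub>fst (Omega P)\<^esub> \<Squnion>\<^bsub>fst (Omega P)\<^esub>T"
    have "T \<subseteq> opens P" using T openin_pervin by blast
    then have cover: "A \<subseteq> \<Union>T" using le by (simp add: Omega_sup)
    have "A \<in> generated_ideal T"
    proof (rule ccontr)
      assume "A \<notin> generated_ideal T"
      then obtain \<Phi> where \<Phi>: "prime_filter \<Phi>" "A \<in> \<Phi>" "\<Phi> \<inter> generated_ideal T = {}"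
        by (rule prime_filter_separation[OF pit generated_ideal_in[OF T] A])
      then obtain x where x: "\<Phi> = {B \<in> snd P. x \<in> B}"
        using real Omega_prime_filter_iff[OF P] unfolding realizes_prime_filters_def by blast
      then obtain B where "B \<in> T" "x \<in> B" using \<Phi>(2) cover by blast
      then show False using \<Phi>(3) x T generated_ideal_upper[OF T] by blast
    qed
    then show "\<exists>T\<^sub>0\<subseteq>T. finite T\<^sub>0 \<and> A \<sqsubseteq>\<^bsub>fst (Omega P)\<^esub> \<Squnion>\<^bsub>fst (Omega P)\<^esub>T\<^sub>0"
      unfolding generated_ideal_def by blast
  qed
  then have "compact_frith (fst (Omega P)) (snd P)" by unfold_locales
  then show ?thesis by (simp add: cfrith_iff_compact)
qed

text \<open>
  A prime filter of basic sets of \<open>pt F\<close> pulls back along \<open>hat\<close> to a prime filter of basic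
  elements, which compactness turns into a point.
\<close>

theorem cpervin_pt:
  assumes c: "cfrith F"
  shows "cpervin (pt F)"
proof -
  have F: "frith_frame F" using c by (simp add: cfrith_def)
  interpret compact_frith "fst F" "snd F" using c by (simp add: cfrith_iff_compact)
  let ?hat = "hat (fst F)"
  note pt = pervin_space_pt[OF F]
  have "t0_space (pervin_topology (pt F))"
    unfolding t0_pervin_iff[OF pt] pt_simps
  proof (intro ballI impI)
    fix p q assume pq: "p \<in> points (fst F)" "q \<in> points (fst F)" "\<forall>T\<in>?hat ` snd F. p \<in> T \<longleftrightarrow> q \<in> T"
    show "p = q"
    proof (rule point_determined_by_basis[OF pq(1,2)])
      show "p s \<longleftrightarrow> q s" if "s \<in> snd F" for s
        using bspec[OF pq(3) imageI[OF that]] pq(1,2) by (simp add: mem_hat)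
    qed
  qed
  moreover have "realizes_prime_filters (pt F)"
    unfolding realizes_prime_filters_def
  proof (intro allI impI)
    fix \<Phi> assume \<Phi>: "pervin_prime_filter (pt F) \<Phi>"
    have \<Phi>': "\<Phi> \<subseteq> ?hat ` snd F" "points (fst F) \<in> \<Phi>" "{} \<notin> \<Phi>"
      "\<And>A B. A \<in> \<Phi> \<Longrightarrow> B \<in> ?hat ` snd F \<Longrightarrow> A \<subseteq> B \<Longrightarrow> B \<in> \<Phi>"
      "\<And>A B. A \<in> \<Phi> \<Longrightarrow> B \<in> \<Phi> \<Longrightarrow> A \<inter> B \<in> \<Phi>"
      "\<And>A B. A \<in> ?hat ` snd F \<Longrightarrow> B \<in> ?hat ` snd F \<Longrightarrow> A \<union> B \<in> \<Phi> \<Longrightarrow> A \<in> \<Phi> \<or> B \<in> \<Phi>"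
      using \<Phi> by (auto simp: pervin_prime_filter_def)
    have "prime_filter {s \<in> snd F. ?hat s \<in> \<Phi>}"
      unfolding prime_filter_def
    proof (intro conjI ballI impI)
      show "\<top>\<^bsub>fst F\<^esub> \<in> {s \<in> snd F. ?hat s \<in> \<Phi>}" using basis_top \<Phi>'(2) by (simp add: hat_top)
      show "\<bottom>\<^bsub>fst F\<^esub> \<notin> {s \<in> snd F. ?hat s \<in> \<Phi>}" using \<Phi>'(3) by (simp add: hat_bottom)
    next
      fix a b assume a: "a \<in> {s \<in> snd F. ?hat s \<in> \<Phi>}" and b: "b \<in> snd F" and le: "a \<sqsubseteq>\<^bsub>fst F\<^esub> b"
      have ac: "a \<in> carrier (fst F)" "b \<in> carrier (fst F)" using a b basis_carrier by auto
      have "?hat a \<subseteq> ?hat b" using point_mono[OF _ ac le] by (auto simp: mem_hat)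
      then show "b \<in> {s \<in> snd F. ?hat s \<in> \<Phi>}" using \<Phi>'(4)[of "?hat a" "?hat b"] a b by simp
    next
      fix a b assume "a \<in> {s \<in> snd F. ?hat s \<in> \<Phi>}" "b \<in> {s \<in> snd F. ?hat s \<in> \<Phi>}"
      then show "a \<sqinter>\<^bsub>fst F\<^esub> b \<in> {s \<in> snd F. ?hat s \<in> \<Phi>}"
        using \<Phi>'(5) basis_meet basis_carrier by (simp add: hat_meet)
    next
      fix a b assume "a \<in> snd F" "b \<in> snd F" "a \<squnion>\<^bsub>fst F\<^esub> b \<in> {s \<in> snd F. ?hat s \<in> \<Phi>}"
      then show "a \<in> {s \<in> snd F. ?hat s \<in> \<Phi>} \<or> b \<in> {s \<in> snd F. ?hat s \<in> \<Phi>}"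
        using \<Phi>'(6)[of "?hat a" "?hat b"] basis_carrier by (simp add: hat_join)
    qed auto
    then obtain p where p: "p \<in> points (fst F)"
      "\<And>s. s \<in> snd F \<Longrightarrow> p s \<longleftrightarrow> s \<in> {s \<in> snd F. ?hat s \<in> \<Phi>}"
      by (rule point_of_prime_filter) blast
    have "\<Phi> = {A \<in> snd (pt F). p \<in> A}"
    proof (rule Set.set_eqI)
      fix A
      show "A \<in> \<Phi> \<longleftrightarrow> A \<in> {A \<in> snd (pt F). p \<in> A}"
        using \<Phi>'(1) p by (auto simp: mem_hat)
    qed
    then show "\<exists>x\<in>fst (pt F). \<Phi> = {A \<in> snd (pt F). x \<in> A}" using p(1) by auto
  qed
  ultimately show ?thesis using pt by (simp add: cpervin_iff)
qed

text \<open>A point of the frame of open sets is determined by the prime filter of its basic sets, which some \<open>x\<close> realizes.\<close>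

theorem adj_unit_iso:
  assumes c: "cpervin P"
  shows "pervin_iso P (pt (Omega P)) (adj_unit P)"
proof -
  have P: "pervin_space P" and t0: "t0_space (pervin_topology P)" and real: "realizes_prime_filters P"
    using c by (auto simp: cpervin_iff)
  interpret frith "fst (Omega P)" "snd P" by (rule frith_Omega[OF P])
  have mono: "pervin_extremal_mono P (pt (Omega P)) (adj_unit P)"
    unfolding pervin_extremal_mono_def
  proof (intro conjI ballI)
    show "adj_unit P \<in> pervin_hom P (pt (Omega P))" by (rule adj_unit_hom[OF P])
    show "inj_on (adj_unit P) (fst P)"
    proof (rule inj_onI)
      fix x y assume xy: "x \<in> fst P" "y \<in> fst P" "adj_unit P x = adj_unit P y"
      have "x \<in> T \<longleftrightarrow> y \<in> T" if "T \<in> snd P" for T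
        using adj_unit_apply[OF xy(1) openin_pervin[OF that]] adj_unit_apply[OF xy(2) openin_pervin[OF that]]
          xy(3) by simp
      then show "x = y" using t0 xy(1,2) unfolding t0_pervin_iff[OF P] by blast
    qed
    show "\<exists>T\<in>snd (pt (Omega P)). A = adj_unit P -` T \<inter> fst P" if "A \<in> snd P" for A
      using adj_unit_preimage[OF P openin_pervin[OF that]] that by auto
  qed
  have "p \<in> adj_unit P ` fst P" if p: "p \<in> points (fst (Omega P))" for p
  proof -
    have "pervin_prime_filter P {A \<in> snd P. p A}"
      using point_prime_filter[OF p] by (simp add: Omega_prime_filter_iff[OF P])
    then obtain x where x: "x \<in> fst P" "{A \<in> snd P. p A} = {A \<in> snd P. x \<in> A}"
      unfolding realizes_prime_filters_def using real realizes_prime_filters_def by blast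
    have "p = adj_unit P x"
    proof (rule point_determined_by_basis[OF p adj_unit_point[OF P x(1)]])
      show "p A \<longleftrightarrow> adj_unit P x A" if "A \<in> snd P" for A
        using x(2) that adj_unit_apply[OF x(1) openin_pervin[OF that]] by blast
    qed
    then show ?thesis using x(1) by blast
  qed
  then have "adj_unit P ` fst P = fst (pt (Omega P))" using adj_unit_point[OF P] by auto
  then show ?thesis
    by (rule surj_extremal_mono_iso[OF pervin_space_pt[OF frith_frame_Omega[OF P]] mono])
qed

theorem adj_counit_iso:
  fixes F :: "'l frith"
  assumes pit: "prime_ideal_theorem TYPE('l)" and c: "cfrith F"
  shows "frith_iso F (Omega (pt F)) (adj_counit F)"
proof -
  have F: "frith_frame F" using c by (simp add: cfrith_def)
  interpret compact_frith "fst F" "snd F" using c by (simp add: cfrith_iff_compact)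
  show ?thesis
  proof (rule bij_frith_iso)
    show "frame (fst F)" "snd F \<subseteq> carrier (fst F)" using frame_axioms basis_subset by auto
    show "frame (fst (Omega (pt F)))"
      by (rule frith_frame_frame[OF frith_frame_Omega[OF pervin_space_pt[OF F]]])
    show "adj_counit F \<in> frith_hom F (Omega (pt F))" by (rule adj_counit_hom[OF F])
    have "inj_on (adj_counit F) (carrier (fst F))"
    proof (rule inj_onI)
      fix a b assume ab: "a \<in> carrier (fst F)" "b \<in> carrier (fst F)" "adj_counit F a = adj_counit F b"
      then show "a = b"
        using hat_reflects_order[OF pit, of a b] hat_reflects_order[OF pit, of b a]
        by (intro le_antisym) (simp_all add: adj_counit_def)
    qed
    moreover have "adj_counit F ` carrier (fst F) = hat (fst F) ` carrier (fst F)"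
      by (rule image_cong[OF HOL.refl]) (simp add: adj_counit_def)
    then have "adj_counit F ` carrier (fst F) = carrier (fst (Omega (pt F)))"
      using open_pt_iff[OF F] by auto
    ultimately show "bij_betw (adj_counit F) (carrier (fst F)) (carrier (fst (Omega (pt F))))"
      by (simp add: bij_betw_def)
    have "adj_counit F ` snd F = hat (fst F) ` snd F"
      using basis_subset by (intro image_cong refl) (auto simp: adj_counit_def)
    then show "adj_counit F ` snd F = snd (Omega (pt F))" by simp
  qed
qed

theorem theorem4p13:
  assumes PIT: "prime_ideal_theorem TYPE('x set)" "prime_ideal_theorem TYPE('l)"
  shows
    \<comment> \<open>\<open>Omega\<close> is a functor from Pervin spaces to the opposite of Frith frames\<close>
    "(\<forall>P::'x pervin. pervin_space P \<longrightarrow> frith_frame (Omega P)) \<and>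
     (\<forall>(P::'x pervin) (Q::'y pervin) f.
        pervin_space P \<and> pervin_space Q \<and> f \<in> pervin_hom P Q \<longrightarrow>
        Omega_map P Q f \<in> frith_hom (Omega Q) (Omega P)) \<and>
     (\<forall>P::'x pervin. pervin_space P \<longrightarrow> Omega_map P P (pervin_id P) = frith_id (Omega P)) \<and>
     (\<forall>(P::'x pervin) (Q::'y pervin) (R::'z pervin) f g.
        pervin_space P \<and> pervin_space Q \<and> pervin_space R \<and>
        f \<in> pervin_hom P Q \<and> g \<in> pervin_hom Q R \<longrightarrow>
        Omega_map P R (pervin_comp P g f) =
          frith_comp (Omega R) (Omega_map P Q f) (Omega_map Q R g)) \<and>
     \<comment> \<open>\<open>pt\<close> is a functor from the opposite of Frith frames to Pervin spaces\<close>
     (\<forall>F::'l frith. frith_frame F \<longrightarrow> pervin_space (pt F)) \<and>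
     (\<forall>(F::'l frith) (G::'m frith) h.
        frith_frame F \<and> frith_frame G \<and> h \<in> frith_hom F G \<longrightarrow>
        pt_map F G h \<in> pervin_hom (pt G) (pt F)) \<and>
     (\<forall>F::'l frith. frith_frame F \<longrightarrow> pt_map F F (frith_id F) = pervin_id (pt F)) \<and>
     (\<forall>(F::'l frith) (G::'m frith) (H::'n frith) h k.
        frith_frame F \<and> frith_frame G \<and> frith_frame H \<and>
        h \<in> frith_hom F G \<and> k \<in> frith_hom G H \<longrightarrow>
        pt_map F H (frith_comp F k h) =
          pervin_comp (pt H) (pt_map F G h) (pt_map G H k)) \<and>
     \<comment> \<open>unit and counit are natural and satisfy the triangle identities\<close>
     (\<forall>P::'x pervin. pervin_space P \<longrightarrow> adj_unit P \<in> pervin_hom P (pt (Omega P))) \<and>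
     (\<forall>(P::'x pervin) (Q::'y pervin) f.
        pervin_space P \<and> pervin_space Q \<and> f \<in> pervin_hom P Q \<longrightarrow>
        pervin_comp P (pt_map (Omega Q) (Omega P) (Omega_map P Q f)) (adj_unit P) =
          pervin_comp P (adj_unit Q) f) \<and>
     (\<forall>F::'l frith. frith_frame F \<longrightarrow> adj_counit F \<in> frith_hom F (Omega (pt F))) \<and>
     (\<forall>(F::'l frith) (G::'m frith) h.
        frith_frame F \<and> frith_frame G \<and> h \<in> frith_hom F G \<longrightarrow>
        frith_comp F (Omega_map (pt G) (pt F) (pt_map F G h)) (adj_counit F) =
          frith_comp F (adj_counit G) h) \<and>
     (\<forall>P::'x pervin. pervin_space P \<longrightarrow>
        frith_comp (Omega P) (Omega_map P (pt (Omega P)) (adj_unit P)) (adj_counit (Omega P)) =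
          frith_id (Omega P)) \<and>
     (\<forall>F::'l frith. frith_frame F \<longrightarrow>
        pervin_comp (pt F) (pt_map F (Omega (pt F)) (adj_counit F)) (adj_unit (pt F)) =
          pervin_id (pt F)) \<and>
     \<comment> \<open>both functors restrict to the full subcategories\<close>
     (\<forall>P::'x pervin. cpervin P \<longrightarrow> cfrith (Omega P)) \<and>
     (\<forall>F::'l frith. cfrith F \<longrightarrow> cpervin (pt F)) \<and>
     \<comment> \<open>where the unit and the counit are isomorphisms\<close>
     (\<forall>P::'x pervin. cpervin P \<longrightarrow> pervin_iso P (pt (Omega P)) (adj_unit P)) \<and>
     (\<forall>F::'l frith. cfrith F \<longrightarrow> frith_iso F (Omega (pt F)) (adj_counit F))"
  by (intro conjI allI impI; (elim conjE)?;
      (rule frith_frame_Omega Omega_map_hom Omega_map_id Omega_map_comp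
        pervin_space_pt pt_map_hom pt_map_id pt_map_comp
        adj_unit_hom adj_unit_natural adj_counit_hom adj_counit_natural Omega_triangle pt_triangle
        cfrith_Omega[OF PIT(1)] cpervin_pt adj_unit_iso adj_counit_iso[OF PIT(2)]; assumption))

end
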